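(* Let $(M,g)$ be an $(n+1)$-dimensional conical manifold and let $\underline{\Delta}_F$ be the Friedrichs extension of the conical Laplacian $\Delta_g$ on $L_2(M)$. Then the semigroup $\{e^{t\underline{\Delta}_F}\}_{t\ge0}$ on $L_2(M)$ is Markovian.
   Context: Conical manifold: Let $n\ge1$ and let $(\tilde M,\tilde g)$ be a smooth compact $(n+1)$-dimensional Riemannian manifold with smooth, possibly disconnected, boundary $B=\partial\tilde M$, which is a finite disjoint union of closed smooth connected manifolds, and let $h=\tilde g|_{B}$. Set $M=\tilde M\setminus B$, with a smooth Riemannian metric $g$ such that in a closed collar neighbourhood $(0,1]\times B$ of the boundary, with coordinates $(x,y)$, $g=dx^2+x^2h(y)$, and outside the collar $g$ is uniformly equivalent to $\tilde g$. $L_p(M)$ is taken with respect to the volume measure $d\mu_g$. $\underline{\Delta}_F$ is the self-adjoint operator on $L_2(M)$ such that $-\underline{\Delta}_F$ is associated with the closure of the quadratic form $\mathfrak a(u,v)=\int_M(\nabla u|\nabla v)_g\,d\mu_g$ defined on $C_c^\infty(M)$; being non-positive and self-adjoint it generates a contraction $C_0$-semigroup on $L_2(M)$. A strongly continuous semigroup $T(t)$ on $L_2(M)$ is called Markovian if it is positive (it maps nonnegative functions to nonnegative functions) and $L_\infty$-contractive: $\|T(t)u\|_\infty\le\|u\|_\infty$ for all $t\ge0$ and $u\in L_\infty(M)\cap L_2(M)$. *)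

theory Defs
  imports "HOL-Analysis.Analysis" "HOL-Probability.Essential_Supremum"
begin

section \<open>Smooth maps\<close>

text \<open>\<open>Ck_on k f S\<close> is the usual notion of class \<open>C\<^sup>k\<close> only for open \<open>S\<close>.\<close>

primrec Ck_on ::
    "nat \<Rightarrow> ('e::euclidean_space \<Rightarrow> 'f::real_normed_vector) \<Rightarrow> 'e set \<Rightarrow> bool" where
  "Ck_on 0 f S \<longleftrightarrow> continuous_on S f"
| "Ck_on (Suc k) f S \<longleftrightarrow>
     (\<forall>x\<in>S. f differentiable (at x)) \<and> (\<forall>v. Ck_on k (\<lambda>x. frechet_derivative f (at x) v) S)"

text \<open>On arbitrary sets (relatively open subsets of a half-space, for instance), smoothness means
  that the map extends locally to a smooth map on an open set.\<close>

definition smooth_on :: "'e set \<Rightarrow> ('e::euclidean_space \<Rightarrow> 'f::real_normed_vector) \<Rightarrow> bool" where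
  "smooth_on S f \<longleftrightarrow>
     (\<forall>x\<in>S. \<exists>U F. open U \<and> x \<in> U \<and> (\<forall>k. Ck_on k F U) \<and> (\<forall>y\<in>S \<inter> U. F y = f y))"

section \<open>Manifolds with boundary\<close>

text \<open>The model space is \<open>\<real> \<times> \<real>\<^sup>n\<close> with \<open>n = CARD('n) \<ge> 1\<close>; the manifold has dimension \<open>n + 1\<close>.
  A chart is given by its domain and its coordinate map; the values of the coordinate map outside
  the domain are irrelevant.\<close>

type_synonym 'n coords = "real \<times> (real, 'n) vec"
type_synonym ('a, 'n) chart = "'a set \<times> ('a \<Rightarrow> 'n coords)"

definition half_space :: "(real \<times> (real^'n)) set" where
  "half_space = {0..} \<times> UNIV"

abbreviation chart_inv :: "('a, 'n::finite) chart \<Rightarrow> 'n coords \<Rightarrow> 'a" where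
  "chart_inv c \<equiv> inv_into (fst c) (snd c)"

abbreviation transition :: "('a, 'n::finite) chart \<Rightarrow> ('a, 'n) chart \<Rightarrow> 'n coords \<Rightarrow> 'n coords" where
  "transition c c' \<equiv> snd c' \<circ> chart_inv c"

definition smoothly_compatible :: "('a, 'n::finite) chart \<Rightarrow> ('a, 'n) chart \<Rightarrow> bool" where
  "smoothly_compatible c c' \<longleftrightarrow>
     smooth_on (snd c ` (fst c \<inter> fst c')) (transition c c') \<and>
     smooth_on (snd c' ` (fst c \<inter> fst c')) (transition c' c)"

definition smooth_manifold :: "'a topology \<Rightarrow> ('a, 'n::finite) chart set \<Rightarrow> bool" where
  "smooth_manifold X \<A> \<longleftrightarrow>
     Hausdorff_space X \<and> second_countable X \<and> (\<Union>c\<in>\<A>. fst c) = topspace X \<and>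
     (\<forall>c\<in>\<A>. openin X (fst c) \<and> openin (top_of_set half_space) (snd c ` fst c) \<and>
        homeomorphic_map (subtopology X (fst c)) (top_of_set (snd c ` fst c)) (snd c)) \<and>
     (\<forall>c\<in>\<A>. \<forall>c'\<in>\<A>. smoothly_compatible c c')"

definition bdry :: "('a, 'n::finite) chart set \<Rightarrow> 'a set" where
  "bdry \<A> = {p. \<exists>c\<in>\<A>. p \<in> fst c \<and> fst (snd c p) = 0}"

definition inner_part :: "'a topology \<Rightarrow> ('a, 'n::finite) chart set \<Rightarrow> 'a set" where
  "inner_part X \<A> = topspace X - bdry \<A>"

section \<open>Riemannian metrics\<close>

text \<open>A covariant 2-tensor field assigns to a chart \<open>c\<close> and a point \<open>p\<close> of its domain the bilinear
  form which represents the tensor at \<open>p\<close> in the coordinates \<open>c\<close>. A form \<open>\<beta>\<close>, given at the point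
  \<open>p\<close> in the coordinates \<open>c\<close>, represents the same tensor as \<open>\<beta>'\<close> in the coordinates \<open>c'\<close> if
  \<open>\<beta>\<close> is the pullback of \<open>\<beta>'\<close> by the differential of the transition map.\<close>

type_synonym ('a, 'n) tensor2 = "('a, 'n) chart \<Rightarrow> 'a \<Rightarrow> 'n coords \<Rightarrow> 'n coords \<Rightarrow> real"

definition same_tensor_at ::
    "'a \<Rightarrow> ('a, 'n::finite) chart \<Rightarrow> ('n coords \<Rightarrow> 'n coords \<Rightarrow> real) \<Rightarrow>
     ('a, 'n) chart \<Rightarrow> ('n coords \<Rightarrow> 'n coords \<Rightarrow> real) \<Rightarrow> bool" where
  "same_tensor_at p c \<beta> c' \<beta>' \<longleftrightarrow>
     (\<forall>D. (transition c c' has_derivative D) (at (snd c p) within snd c ` (fst c \<inter> fst c')) \<longrightarrow>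
        (\<forall>v w. \<beta> v w = \<beta>' (D v) (D w)))"

definition riemannian_metric ::
    "('a, 'n::finite) chart set \<Rightarrow> 'a set \<Rightarrow> ('a, 'n) tensor2 \<Rightarrow> bool" where
  "riemannian_metric \<A> S g \<longleftrightarrow>
     (\<forall>c\<in>\<A>. \<forall>p\<in>fst c \<inter> S. bilinear (g c p) \<and> (\<forall>v w. g c p v w = g c p w v) \<and>
        (\<forall>v. v \<noteq> 0 \<longrightarrow> g c p v v > 0)) \<and>
     (\<forall>c\<in>\<A>. \<forall>v w. smooth_on (snd c ` (fst c \<inter> S)) (\<lambda>z. g c (chart_inv c z) v w)) \<and>
     (\<forall>c\<in>\<A>. \<forall>c'\<in>\<A>. \<forall>p\<in>fst c \<inter> fst c' \<inter> S. same_tensor_at p c (g c p) c' (g c' p))"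

fun coord_frame :: "'n option \<Rightarrow> real \<times> (real^'n)" where
  "coord_frame None = (1, 0)"
| "coord_frame (Some i) = (0, axis i 1)"

definition vol_density :: "(real \<times> (real^'n) \<Rightarrow> real \<times> (real^'n) \<Rightarrow> real) \<Rightarrow> real" where
  "vol_density \<beta> =
     sqrt (det (\<chi> i j. \<beta> (coord_frame i) (coord_frame j) :: real^('n option)^('n option)))"

text \<open>The Riemannian volume measure on the open subset \<open>S\<close>: the Borel measure which in every
  chart is \<open>sqrt (det (g\<^sub>i\<^sub>j))\<close> times the Lebesgue measure. These conditions determine \<open>\<mu>\<close>.\<close>

definition riemannian_volume ::
    "'a topology \<Rightarrow> ('a, 'n::finite) chart set \<Rightarrow> 'a set \<Rightarrow> ('a, 'n) tensor2 \<Rightarrow> 'a measure \<Rightarrow> bool"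
  where
  "riemannian_volume X \<A> S g \<mu> \<longleftrightarrow>
     space \<mu> = S \<and> sets \<mu> = sigma_sets S {W. openin (subtopology X S) W} \<and>
     (\<forall>c\<in>\<A>. \<forall>W\<in>sets \<mu>. W \<subseteq> fst c \<longrightarrow>
        emeasure \<mu> W =
          (\<integral>\<^sup>+z\<in>snd c ` W. ennreal (vol_density (g c (chart_inv c z))) \<partial>lborel))"

section \<open>Conical manifolds\<close>

text \<open>A map \<open>\<Phi>\<close> from \<open>[0,1] \<times> B\<close> and a chart \<open>c\<close> with coordinates \<open>(x, y)\<close> give the chart
  \<open>\<Phi> (x, q) \<mapsto> (x, y q)\<close> on \<open>\<Phi> ([0,1] \<times> (B \<inter> dom c))\<close>, since \<open>y\<close> restricts to a chart of the
  boundary \<open>B\<close>.\<close>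

definition collar_chart ::
    "('a, 'n::finite) chart set \<Rightarrow> (real \<times> 'a \<Rightarrow> 'a) \<Rightarrow> ('a, 'n) chart \<Rightarrow> ('a, 'n) chart" where
  "collar_chart \<A> \<Phi> c =
     (\<Phi> ` ({0..1} \<times> (fst c \<inter> bdry \<A>)),
      \<lambda>p. case inv_into ({0..1} \<times> bdry \<A>) \<Phi> p of (x, q) \<Rightarrow> (x, snd (snd c q)))"

definition closed_collar ::
    "'a topology \<Rightarrow> ('a, 'n::finite) chart set \<Rightarrow> (real \<times> 'a \<Rightarrow> 'a) \<Rightarrow> bool" where
  "closed_collar X \<A> \<Phi> \<longleftrightarrow>
     embedding_map (prod_topology (top_of_set {0..1}) (subtopology X (bdry \<A>))) X \<Phi> \<and>
     openin X (\<Phi> ` ({0..<1} \<times> bdry \<A>)) \<and>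
     (\<forall>q\<in>bdry \<A>. \<Phi> (0, q) = q) \<and>
     (\<forall>c\<in>\<A>. \<forall>c'\<in>\<A>. smoothly_compatible (collar_chart \<A> \<Phi> c) c')"

text \<open>The metric \<open>h\<close> induced on the boundary by a metric on the whole manifold, in the coordinates
  \<open>y\<close> given by a chart with coordinates \<open>(x, y)\<close>.\<close>

definition bdry_metric ::
    "('a, 'n::finite) tensor2 \<Rightarrow> ('a, 'n) chart \<Rightarrow> 'a \<Rightarrow> real^'n \<Rightarrow> real^'n \<Rightarrow> real" where
  "bdry_metric g c q v w = g c q (0, v) (0, w)"

definition cone_form ::
    "real \<Rightarrow> (real^'n \<Rightarrow> real^'n \<Rightarrow> real) \<Rightarrow> real \<times> (real^'n) \<Rightarrow> real \<times> (real^'n) \<Rightarrow> real" where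
  "cone_form x h v w = fst v * fst w + x\<^sup>2 * h (snd v) (snd w)"

text \<open>By compactness, the boundary is closed and has finitely many components, each of them a
  closed smooth connected \<open>n\<close>-manifold, so this needs no separate condition.\<close>

definition conical_manifold ::
    "'a topology \<Rightarrow> ('a, 'n::finite) chart set \<Rightarrow> ('a, 'n) tensor2 \<Rightarrow> ('a, 'n) tensor2 \<Rightarrow> bool" where
  "conical_manifold X \<A> gt g \<longleftrightarrow>
     smooth_manifold X \<A> \<and> compact_space X \<and>
     riemannian_metric \<A> (topspace X) gt \<and>
     riemannian_metric \<A> (inner_part X \<A>) g \<and>
     (\<exists>\<Phi>. closed_collar X \<A> \<Phi> \<and>
        (\<forall>c\<in>\<A>. \<forall>c'\<in>\<A>. \<forall>x\<in>{0<..1}. \<forall>q\<in>fst c \<inter> bdry \<A>. \<Phi> (x, q) \<in> fst c' \<longrightarrow>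
           same_tensor_at (\<Phi> (x, q)) (collar_chart \<A> \<Phi> c) (cone_form x (bdry_metric gt c q))
             c' (g c' (\<Phi> (x, q)))) \<and>
        (\<exists>C>0. \<forall>c\<in>\<A>. \<forall>p\<in>fst c \<inter> inner_part X \<A> - \<Phi> ` ({0<..1} \<times> bdry \<A>). \<forall>v.
           gt c p v v / C \<le> g c p v v \<and> g c p v v \<le> C * gt c p v v))"

section \<open>The Dirichlet form\<close>

definition test_functions ::
    "'a topology \<Rightarrow> ('a, 'n::finite) chart set \<Rightarrow> 'a set \<Rightarrow> ('a \<Rightarrow> real) set" where
  "test_functions X \<A> S =
     {u. (\<forall>c\<in>\<A>. smooth_on (snd c ` (fst c \<inter> S)) (u \<circ> chart_inv c)) \<and>
         (\<exists>K. compactin X K \<and> K \<subseteq> S \<and> (\<forall>p\<in>S - K. u p = 0))}"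

text \<open>The coordinate vector, in the chart \<open>c\<close>, of the gradient at an interior point \<open>p\<close>: the vector
  which represents the differential of \<open>u\<close> with respect to \<open>g\<close>.\<close>

definition grad ::
    "('a, 'n::finite) tensor2 \<Rightarrow> ('a, 'n) chart \<Rightarrow> ('a \<Rightarrow> real) \<Rightarrow> 'a \<Rightarrow> 'n coords" where
  "grad g c u p =
     (THE v. \<forall>w. g c p v w = frechet_derivative (u \<circ> chart_inv c) (at (snd c p)) w)"

text \<open>The choice of the chart around \<open>p\<close> does not matter.\<close>

definition grad_inner ::
    "('a, 'n::finite) chart set \<Rightarrow> ('a, 'n) tensor2 \<Rightarrow> ('a \<Rightarrow> real) \<Rightarrow> ('a \<Rightarrow> real) \<Rightarrow> 'a \<Rightarrow> real" where
  "grad_inner \<A> g u v p =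
     (let c = (SOME c. c \<in> \<A> \<and> p \<in> fst c) in g c p (grad g c u p) (grad g c v p))"

definition dirichlet_form ::
    "('a, 'n::finite) chart set \<Rightarrow> ('a, 'n) tensor2 \<Rightarrow> 'a measure \<Rightarrow>
     ('a \<Rightarrow> real) \<Rightarrow> ('a \<Rightarrow> real) \<Rightarrow> real" where
  "dirichlet_form \<A> g \<mu> u v = (LINT p|\<mu>. grad_inner \<A> g u v p)"

section \<open>Operators and semigroups on \<open>L\<^sub>2\<close>\<close>

text \<open>Elements of the real space \<open>L\<^sub>2(\<mu>)\<close> are given by representatives. Unbounded operators are
  given by their graphs, which are closed under changing either component on a null set.\<close>

definition L2 :: "'a measure \<Rightarrow> ('a \<Rightarrow> real) set" where
  "L2 \<mu> = {u \<in> borel_measurable \<mu>. integrable \<mu> (\<lambda>p. (u p)\<^sup>2)}"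

definition L2_norm :: "'a measure \<Rightarrow> ('a \<Rightarrow> real) \<Rightarrow> real" where
  "L2_norm \<mu> u = sqrt (LINT p|\<mu>. (u p)\<^sup>2)"

definition L2_inner :: "'a measure \<Rightarrow> ('a \<Rightarrow> real) \<Rightarrow> ('a \<Rightarrow> real) \<Rightarrow> real" where
  "L2_inner \<mu> u v = (LINT p|\<mu>. u p * v p)"

text \<open>The closure of a form \<open>a\<close> with domain \<open>D\<close>, for a closable form: the domain consists of the
  limits in \<open>L\<^sub>2\<close> of sequences in \<open>D\<close> which are Cauchy for \<open>a\<close>.\<close>

definition form_approx ::
    "'a measure \<Rightarrow> ('a \<Rightarrow> real) set \<Rightarrow> (('a \<Rightarrow> real) \<Rightarrow> ('a \<Rightarrow> real) \<Rightarrow> real) \<Rightarrow>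
     (nat \<Rightarrow> 'a \<Rightarrow> real) \<Rightarrow> ('a \<Rightarrow> real) \<Rightarrow> bool" where
  "form_approx \<mu> D a us u \<longleftrightarrow>
     (\<forall>k. us k \<in> D) \<and> u \<in> L2 \<mu> \<and> (\<lambda>k. L2_norm \<mu> (\<lambda>p. us k p - u p)) \<longlonglongrightarrow> 0 \<and>
     (\<forall>e>0. \<exists>N. \<forall>j\<ge>N. \<forall>k\<ge>N. a (\<lambda>p. us j p - us k p) (\<lambda>p. us j p - us k p) < e)"

definition closure_dom ::
    "'a measure \<Rightarrow> ('a \<Rightarrow> real) set \<Rightarrow> (('a \<Rightarrow> real) \<Rightarrow> ('a \<Rightarrow> real) \<Rightarrow> real) \<Rightarrow> ('a \<Rightarrow> real) set" where
  "closure_dom \<mu> D a = {u. \<exists>us. form_approx \<mu> D a us u}"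

definition closure_form ::
    "'a measure \<Rightarrow> ('a \<Rightarrow> real) set \<Rightarrow> (('a \<Rightarrow> real) \<Rightarrow> ('a \<Rightarrow> real) \<Rightarrow> real) \<Rightarrow>
     ('a \<Rightarrow> real) \<Rightarrow> ('a \<Rightarrow> real) \<Rightarrow> real" where
  "closure_form \<mu> D a u v =
     (THE l. \<forall>us vs. form_approx \<mu> D a us u \<longrightarrow> form_approx \<mu> D a vs v \<longrightarrow>
        (\<lambda>k. a (us k) (vs k)) \<longlonglongrightarrow> l)"

definition associated_operator ::
    "'a measure \<Rightarrow> ('a \<Rightarrow> real) set \<Rightarrow> (('a \<Rightarrow> real) \<Rightarrow> ('a \<Rightarrow> real) \<Rightarrow> real) \<Rightarrow>
     (('a \<Rightarrow> real) \<times> ('a \<Rightarrow> real)) set" where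
  "associated_operator \<mu> D b =
     {(u, f). u \<in> D \<and> f \<in> L2 \<mu> \<and> (\<forall>v\<in>D. b u v = L2_inner \<mu> f v)}"

definition friedrichs_laplacian ::
    "'a topology \<Rightarrow> ('a, 'n::finite) chart set \<Rightarrow> ('a, 'n) tensor2 \<Rightarrow> 'a measure \<Rightarrow>
     (('a \<Rightarrow> real) \<times> ('a \<Rightarrow> real)) set" where
  "friedrichs_laplacian X \<A> g \<mu> =
     (let D = test_functions X \<A> (inner_part X \<A>); a = dirichlet_form \<A> g \<mu> in
      {(u, f). (u, \<lambda>p. - f p) \<in>
         associated_operator \<mu> (closure_dom \<mu> D a) (closure_form \<mu> D a)})"

text \<open>Linearity and boundedness imply that \<open>S\<close> respects equality almost everywhere.\<close>

definition bounded_L2_operator :: "'a measure \<Rightarrow> (('a \<Rightarrow> real) \<Rightarrow> 'a \<Rightarrow> real) \<Rightarrow> bool" where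
  "bounded_L2_operator \<mu> S \<longleftrightarrow>
     (\<forall>u\<in>L2 \<mu>. S u \<in> L2 \<mu>) \<and>
     (\<forall>u\<in>L2 \<mu>. \<forall>v\<in>L2 \<mu>. AE p in \<mu>. S (\<lambda>p. u p + v p) p = S u p + S v p) \<and>
     (\<forall>r. \<forall>u\<in>L2 \<mu>. AE p in \<mu>. S (\<lambda>p. r * u p) p = r * S u p) \<and>
     (\<exists>C. \<forall>u\<in>L2 \<mu>. L2_norm \<mu> (S u) \<le> C * L2_norm \<mu> u)"

definition C0_semigroup :: "'a measure \<Rightarrow> (real \<Rightarrow> ('a \<Rightarrow> real) \<Rightarrow> 'a \<Rightarrow> real) \<Rightarrow> bool" where
  "C0_semigroup \<mu> T \<longleftrightarrow>
     (\<forall>t\<ge>0. bounded_L2_operator \<mu> (T t)) \<and>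
     (\<forall>u\<in>L2 \<mu>. AE p in \<mu>. T 0 u p = u p) \<and>
     (\<forall>s\<ge>0. \<forall>t\<ge>0. \<forall>u\<in>L2 \<mu>. AE p in \<mu>. T (s + t) u p = T s (T t u) p) \<and>
     (\<forall>u\<in>L2 \<mu>. ((\<lambda>t. L2_norm \<mu> (\<lambda>p. T t u p - u p)) \<longlongrightarrow> 0) (at_right 0))"

definition generator ::
    "'a measure \<Rightarrow> (real \<Rightarrow> ('a \<Rightarrow> real) \<Rightarrow> 'a \<Rightarrow> real) \<Rightarrow> (('a \<Rightarrow> real) \<times> ('a \<Rightarrow> real)) set" where
  "generator \<mu> T =
     {(u, f). u \<in> L2 \<mu> \<and> f \<in> L2 \<mu> \<and>
        ((\<lambda>t. L2_norm \<mu> (\<lambda>p. (T t u p - u p) / t - f p)) \<longlongrightarrow> 0) (at_right 0)}"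

text \<open>A generator determines its semigroup up to equality almost everywhere, so the following says
  that \<open>T t\<close> is \<open>e\<^sup>t\<^sup>A\<close>.\<close>

definition semigroup_generated_by ::
    "'a measure \<Rightarrow> (('a \<Rightarrow> real) \<times> ('a \<Rightarrow> real)) set \<Rightarrow>
     (real \<Rightarrow> ('a \<Rightarrow> real) \<Rightarrow> 'a \<Rightarrow> real) \<Rightarrow> bool" where
  "semigroup_generated_by \<mu> A T \<longleftrightarrow> C0_semigroup \<mu> T \<and> generator \<mu> T = A"

definition Linf_norm :: "'a measure \<Rightarrow> ('a \<Rightarrow> real) \<Rightarrow> ereal" where
  "Linf_norm \<mu> u = esssup \<mu> (\<lambda>p. ereal \<bar>u p\<bar>)"

definition markovian :: "'a measure \<Rightarrow> (real \<Rightarrow> ('a \<Rightarrow> real) \<Rightarrow> 'a \<Rightarrow> real) \<Rightarrow> bool" where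
  "markovian \<mu> T \<longleftrightarrow>
     C0_semigroup \<mu> T \<and>
     (\<forall>t\<ge>0. \<forall>u\<in>L2 \<mu>. (AE p in \<mu>. 0 \<le> u p) \<longrightarrow> (AE p in \<mu>. 0 \<le> T t u p)) \<and>
     (\<forall>t\<ge>0. \<forall>u\<in>L2 \<mu>. Linf_norm \<mu> u < \<infinity> \<longrightarrow> Linf_norm \<mu> (T t u) \<le> Linf_norm \<mu> u)"

end

theory Submission
  imports Defs
begin

text \<open>The generator \<open>A\<close> of the semigroup satisfies \<open>(A u, (u - c)\<^sup>+) \<le> 0\<close> for all levels \<open>c > 0\<close>.
  Hence \<open>\<parallel>(T t u - c)\<^sup>+\<parallel>\<close> has non-positive right derivative along orbits which start in the
  domain, and, the domain being dense, it is nonincreasing for every \<open>u\<close>. So \<open>u \<le> c\<close> implies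
  \<open>T t u \<le> c\<close>; applied to \<open>u\<close> and \<open>-u\<close> this is contractivity on \<open>L\<^sub>\<infinity>\<close>, and as \<open>c\<close> tends to
  \<open>0\<close> it is positivity.

  The inequality for the generator is that of Beurling and Deny. For a test function \<open>u\<close> and a smooth
  monotone contraction \<open>F\<close> with \<open>F 0 = 0\<close>, the chain rule for the gradient gives
  \<open>a (F u) (F u) \<le> a u u\<close> and \<open>0 \<le> a u (F u)\<close>. If \<open>u\<^sub>k\<close> approximates \<open>u\<close> in the form norm and \<open>F\<^sub>k\<close>
  tends to \<open>s \<mapsto> (s - c)\<^sup>+\<close>, then \<open>F\<^sub>k (u\<^sub>k)\<close> is bounded in the form norm and tends to \<open>(u - c)\<^sup>+\<close>
  in \<open>L\<^sub>2\<close>; elements of almost minimal energy in suitable convex sets around its tails form a Cauchy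
  sequence. Closability of the form is not needed: without it \<open>closure_form\<close> would be a
  constant, and then the form vanishes on the pairs which matter.\<close>

section \<open>Positive semidefinite forms\<close>

text \<open>The obstacle is the sign of the form at (u - c)^+. It is known for a u_k (F_k u_k), with
  equal indices, while the functions F_k (u_k) need not be Cauchy in the form norm. The
  near-minimisers that replace them are no longer functions of u_k, so the pointwise positivity of
  the integrand is lost. The convex sets therefore also impose the linear inequalities a u_j x >=
  -eps for all late j; these survive minimisation and give the sign in the limit. On the semigroup
  side only strong continuity at 0 is given. Local bounds come from the uniform boundedness
  principle; they make orbits continuous, and averages of orbits give a dense domain. Elements of L2
  are functions whose laws hold almost everywhere, so completeness, Riesz representation and uniform
  boundedness are all proved in that setting. The minimisation lemma serves twice: for the
  truncations, and with constant sets for the Riesz theorem.\<close>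

lemma discriminant_le_if_quadratic_nonneg:
  fixes A B C :: real
  assumes nn: "\<And>t. 0 \<le> A - 2 * t * B + t\<^sup>2 * C" and "0 \<le> C"
  shows "B\<^sup>2 \<le> A * C"
proof (cases "C = 0")
  case True
  have "B = 0"
  proof (rule ccontr)
    assume "B \<noteq> 0"
    \<comment> \<open>At this t the quadratic, which is linear because C = 0, has the value
      -1.\<close>
    then show False using nn[of "(A + 1) / (2 * B)"] True by (simp add: field_simps)
  qed
  then show ?thesis using True by simp
next
  case False
  then have "C > 0" using assms(2) by simp
  then show ?thesis using nn[of "B / C"] by (simp add: field_simps power2_eq_square)
qed

text \<open>Shared by the inner product of L2 and the Dirichlet form. The laws are confined to
  \<open>D\<close> because an integral outside its natural domain is a default value, and positivity
  is semidefinite because functions that agree almost everywhere are not identified.\<close>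

locale psd_form =
  fixes D :: "('a \<Rightarrow> real) set" and a :: "('a \<Rightarrow> real) \<Rightarrow> ('a \<Rightarrow> real) \<Rightarrow> real"
  assumes zero_mem: "(\<lambda>p. 0) \<in> D"
    and add_mem: "u \<in> D \<Longrightarrow> v \<in> D \<Longrightarrow> (\<lambda>p. u p + v p) \<in> D"
    and scale_mem: "u \<in> D \<Longrightarrow> (\<lambda>p. r * u p) \<in> D"
    and sym: "u \<in> D \<Longrightarrow> v \<in> D \<Longrightarrow> a u v = a v u"
    and add_left: "u \<in> D \<Longrightarrow> v \<in> D \<Longrightarrow> w \<in> D \<Longrightarrow> a (\<lambda>p. u p + v p) w = a u w + a v w"
    and scale_left: "u \<in> D \<Longrightarrow> v \<in> D \<Longrightarrow> a (\<lambda>p. r * u p) v = r * a u v"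
    and nonneg: "u \<in> D \<Longrightarrow> 0 \<le> a u u"
begin

definition nrm :: "('a \<Rightarrow> real) \<Rightarrow> real" where
  "nrm u = sqrt (a u u)"

lemma minus_mem: "u \<in> D \<Longrightarrow> (\<lambda>p. - u p) \<in> D"
  using scale_mem[of u "-1"] by simp

lemma diff_mem: "u \<in> D \<Longrightarrow> v \<in> D \<Longrightarrow> (\<lambda>p. u p - v p) \<in> D"
  using add_mem[of u "\<lambda>p. - v p"] minus_mem[of v] by simp

lemma minus_left: "u \<in> D \<Longrightarrow> v \<in> D \<Longrightarrow> a (\<lambda>p. - u p) v = - a u v"
  using scale_left[of u v "-1"] by simp

lemma diff_left: "u \<in> D \<Longrightarrow> v \<in> D \<Longrightarrow> w \<in> D \<Longrightarrow> a (\<lambda>p. u p - v p) w = a u w - a v w"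
  using add_left[of u "\<lambda>p. - v p" w] minus_mem[of v] minus_left[of v w] by simp

lemma add_right: "u \<in> D \<Longrightarrow> v \<in> D \<Longrightarrow> w \<in> D \<Longrightarrow> a w (\<lambda>p. u p + v p) = a w u + a w v"
  using add_left[of u v w] by (simp add: sym add_mem)

lemma diff_right: "u \<in> D \<Longrightarrow> v \<in> D \<Longrightarrow> w \<in> D \<Longrightarrow> a w (\<lambda>p. u p - v p) = a w u - a w v"
  using diff_left[of u v w] by (simp add: sym diff_mem)

lemma scale_right: "u \<in> D \<Longrightarrow> v \<in> D \<Longrightarrow> a u (\<lambda>p. r * v p) = r * a u v"
  using scale_left[of v u r] by (simp add: sym scale_mem)

lemma zero_left: "u \<in> D \<Longrightarrow> a (\<lambda>p. 0) u = 0"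
  using scale_left[of u u 0] by simp

lemma zero_right: "u \<in> D \<Longrightarrow> a u (\<lambda>p. 0) = 0"
  using zero_left[of u] by (simp add: sym zero_mem)

lemmas mem = zero_mem add_mem scale_mem minus_mem diff_mem
lemmas bilin = add_left add_right diff_left diff_right scale_left scale_right minus_left
  zero_left zero_right

lemma square_expand:
  assumes "u \<in> D" "v \<in> D"
  shows "a (\<lambda>p. u p + r * v p) (\<lambda>p. u p + r * v p) = a u u + 2 * r * a u v + r\<^sup>2 * a v v"
  using assms sym[of v u] by (simp add: bilin mem power2_eq_square algebra_simps)

lemma Cauchy_Schwarz:
  assumes "u \<in> D" "v \<in> D"
  shows "\<bar>a u v\<bar> \<le> nrm u * nrm v"
proof -
  have "(a u v)\<^sup>2 \<le> a u u * a v v"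
  proof (rule discriminant_le_if_quadratic_nonneg)
    show "0 \<le> a u u - 2 * t * a u v + t\<^sup>2 * a v v" for t
      using nonneg[of "\<lambda>p. u p + (-t) * v p"] square_expand[OF assms, of "-t"] assms
      by (simp add: mem)
  qed (use assms nonneg in auto)
  then have "sqrt ((a u v)\<^sup>2) \<le> sqrt (a u u * a v v)" by (rule real_sqrt_le_mono)
  then show ?thesis by (simp add: nrm_def real_sqrt_mult)
qed

lemma nrm_nonneg: "u \<in> D \<Longrightarrow> 0 \<le> nrm u"
  by (simp add: nrm_def nonneg)

lemma nrm_square: "u \<in> D \<Longrightarrow> (nrm u)\<^sup>2 = a u u"
  by (simp add: nrm_def nonneg)

lemma nrm_zero: "nrm (\<lambda>p. 0) = 0"
  by (simp add: nrm_def zero_left zero_mem)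

lemma nrm_scale: "u \<in> D \<Longrightarrow> nrm (\<lambda>p. r * u p) = \<bar>r\<bar> * nrm u"
  by (simp add: nrm_def bilin mem real_sqrt_mult flip: mult.assoc)

lemma nrm_minus: "u \<in> D \<Longrightarrow> nrm (\<lambda>p. - u p) = nrm u"
  using nrm_scale[of u "-1"] by simp

lemma nrm_triangle:
  assumes "u \<in> D" "v \<in> D"
  shows "nrm (\<lambda>p. u p + v p) \<le> nrm u + nrm v"
proof (rule power2_le_imp_le)
  have "(nrm (\<lambda>p. u p + v p))\<^sup>2 = a u u + 2 * a u v + a v v"
    using square_expand[OF assms, of 1] assms by (simp add: nrm_square mem)
  also have "\<dots> \<le> (nrm u + nrm v)\<^sup>2"
    using Cauchy_Schwarz[OF assms] assms by (simp add: power2_sum nrm_square)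
  finally show "(nrm (\<lambda>p. u p + v p))\<^sup>2 \<le> (nrm u + nrm v)\<^sup>2" .
qed (use assms nrm_nonneg in auto)

lemma nrm_diff_commute:
  assumes "u \<in> D" "v \<in> D"
  shows "nrm (\<lambda>p. u p - v p) = nrm (\<lambda>p. v p - u p)"
  using nrm_minus[of "\<lambda>p. u p - v p"] assms by (simp add: mem)

lemma nrm_diff_triangle:
  assumes "u \<in> D" "v \<in> D" "w \<in> D"
  shows "nrm (\<lambda>p. u p - w p) \<le> nrm (\<lambda>p. u p - v p) + nrm (\<lambda>p. v p - w p)"
  using nrm_triangle[of "\<lambda>p. u p - v p" "\<lambda>p. v p - w p"] assms by (simp add: mem)

lemma nrm_le_add_diff:
  assumes "u \<in> D" "v \<in> D"
  shows "nrm u \<le> nrm v + nrm (\<lambda>p. u p - v p)"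
  using nrm_triangle[of v "\<lambda>p. u p - v p"] assms by (simp add: mem)

lemma parallelogram:
  assumes "u \<in> D" "v \<in> D"
  shows "a (\<lambda>p. u p - v p) (\<lambda>p. u p - v p) + 4 * a (\<lambda>p. (u p + v p) / 2) (\<lambda>p. (u p + v p) / 2)
    = 2 * a u u + 2 * a v v"
proof -
  have *: "(\<lambda>p. (u p + v p) / 2) = (\<lambda>p. (1/2) * (u p + v p))" by auto
  have "a (\<lambda>p. (u p + v p) / 2) (\<lambda>p. (u p + v p) / 2) = (1/4) * a (\<lambda>p. u p + v p) (\<lambda>p. u p + v p)"
    unfolding * using assms by (simp add: scale_left scale_right mem del: times_divide_eq_left mult_1)
  then show ?thesis using assms sym[of v u] by (simp add: bilin mem)
qed

text \<open>The parallelogram identity makes minimising sequences Cauchy, even when they are allowed to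
  move through a decreasing sequence of convex sets. This replaces weak compactness.\<close>

lemma minimising_sequence_Cauchy:
  fixes l :: "('a \<Rightarrow> real) \<Rightarrow> real"
  defines "G \<equiv> \<lambda>x. a x x - l x"
  assumes K: "\<And>n. K n \<subseteq> D" "\<And>m n. m \<le> n \<Longrightarrow> K n \<subseteq> K m"
    and mid: "\<And>n x y. x \<in> K n \<Longrightarrow> y \<in> K n \<Longrightarrow> (\<lambda>p. (x p + y p) / 2) \<in> K n"
    and l: "\<And>x y. x \<in> D \<Longrightarrow> y \<in> D \<Longrightarrow> 2 * l (\<lambda>p. (x p + y p) / 2) = l x + l y"
    and lower: "\<And>x. x \<in> D \<Longrightarrow> b \<le> G x"
    and upper: "\<And>n. w n \<in> K n" "\<And>n. G (w n) \<le> B"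
  shows "\<exists>xs. (\<forall>n. xs n \<in> K n) \<and> (\<forall>n. \<forall>y\<in>K n. G (xs n) \<le> G y + 1 / Suc n) \<and>
    (\<forall>e>0. \<exists>N. \<forall>j\<ge>N. \<forall>k\<ge>N. a (\<lambda>p. xs j p - xs k p) (\<lambda>p. xs j p - xs k p) < e)"
proof -
  \<comment> \<open>The sets shrink, so these infima increase; the points \<open>w n\<close> keep
    them below \<open>B\<close>. Their convergence is what allows points taken from different sets
    to be compared.\<close>
  define \<alpha> where "\<alpha> n = (INF x\<in>K n. G x)" for n
  have bdd: "bdd_below (G ` K n)" for n
    using lower K(1) by (auto simp: bdd_below_def)
  have \<alpha>_le: "\<alpha> n \<le> G x" if "x \<in> K n" for n x
    unfolding \<alpha>_def by (rule cINF_lower[OF bdd that])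
  have "\<exists>x\<in>K n. G x < \<alpha> n + 1 / Suc n" for n
  proof -
    have "\<alpha> n < \<alpha> n + 1 / Suc n" by simp
    then show ?thesis
      unfolding \<alpha>_def by (subst (asm) cINF_less_iff) (use upper bdd in auto)
  qed
  then obtain xs where xs: "\<And>n. xs n \<in> K n" "\<And>n. G (xs n) < \<alpha> n + 1 / Suc n" by metis
  have mono: "\<alpha> m \<le> \<alpha> n" if "m \<le> n" for m n
    unfolding \<alpha>_def using K(2)[OF that] upper(1)[of n] bdd by (intro cINF_superset_mono) auto
  have "\<alpha> n \<le> B" for n using \<alpha>_le[OF upper(1)] upper(2)[of n] by (rule order_trans)
  then have "norm (\<alpha> n) \<le> \<bar>\<alpha> 0\<bar> + \<bar>B\<bar>" for n
    using mono[of 0 n] by (smt (verit) real_norm_def zero_le)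
  then have "convergent \<alpha>"
    using mono by (intro Bseq_mono_convergent BseqI'[where K = "\<bar>\<alpha> 0\<bar> + \<bar>B\<bar>"]) auto
  then have Cau: "Cauchy \<alpha>" by (simp add: Cauchy_convergent_iff)
  \<comment> \<open>The midpoint lies in the larger set \<open>K j\<close>, so its
    \<open>G\<close>-value is at least \<open>\<alpha> j\<close>. In the parallelogram identity the
    affine part \<open>l\<close> cancels, and the near-minimality of both points leaves this
    bound.\<close>
  have key: "a (\<lambda>p. xs j p - xs k p) (\<lambda>p. xs j p - xs k p) \<le> 2 * (\<alpha> k - \<alpha> j) + 4 / Suc j"
    if "j \<le> k" for j k
  proof -
    let ?m = "\<lambda>p. (xs j p + xs k p) / 2"
    have D: "xs j \<in> D" "xs k \<in> D" using xs(1) K(1) by blast+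
    have "xs k \<in> K j" using xs(1) K(2)[OF that] by blast
    then have "\<alpha> j \<le> G ?m" by (intro \<alpha>_le mid xs(1))
    moreover have "a (\<lambda>p. xs j p - xs k p) (\<lambda>p. xs j p - xs k p) = 2 * G (xs j) + 2 * G (xs k) - 4 * G ?m"
      using parallelogram[OF D] l[OF D] by (simp add: G_def)
    moreover have "1 / Suc k \<le> 1 / Suc j" using that by (simp add: frac_le)
    moreover have "4 / Suc j = 2 * (1 / Suc j) + 2 * (1 / Suc j)" by simp
    ultimately show ?thesis using xs(2)[of j] xs(2)[of k] by argo
  qed
  have "\<exists>N. \<forall>j\<ge>N. \<forall>k\<ge>N. a (\<lambda>p. xs j p - xs k p) (\<lambda>p. xs j p - xs k p) < e" if "e > 0" for e
  proof -
    obtain N1 where N1: "\<And>j k. j \<ge> N1 \<Longrightarrow> k \<ge> N1 \<Longrightarrow> \<bar>\<alpha> k - \<alpha> j\<bar> < e / 4"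
      using CauchyD[OF Cau, of "e / 4"] \<open>e > 0\<close> by auto
    obtain N2 where N2: "8 / e < real N2" using reals_Archimedean2 by blast
    have small: "a (\<lambda>p. xs j p - xs k p) (\<lambda>p. xs j p - xs k p) < e"
      if "j \<ge> max N1 N2" "j \<le> k" for j k
    proof -
      have "8 / e < Suc j" using N2 that by linarith
      then have "4 / Suc j < e / 2" using \<open>e > 0\<close> by (simp add: field_simps)
      moreover have "\<bar>\<alpha> k - \<alpha> j\<bar> < e / 4" using N1[of j k] that by simp
      moreover have "x < e" if "x \<le> 2 * y + z" "\<bar>y\<bar> < e / 4" "z < e / 2" for x y z :: real
        using that by linarith
      ultimately show ?thesis using key[OF that(2)] by blast
    qed
    have "a (\<lambda>p. xs j p - xs k p) (\<lambda>p. xs j p - xs k p) < e"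
      if "j \<ge> max N1 N2" "k \<ge> max N1 N2" for j k
    proof (cases "j \<le> k")
      case False
      have D: "xs j \<in> D" "xs k \<in> D" using xs(1) K(1) by blast+
      have "a (\<lambda>p. xs j p - xs k p) (\<lambda>p. xs j p - xs k p) = a (\<lambda>p. xs k p - xs j p) (\<lambda>p. xs k p - xs j p)"
        using D sym by (simp add: bilin mem)
      then show ?thesis using small[of k j] False that by simp
    qed (use small that in auto)
    then show ?thesis by blast
  qed
  moreover have "G (xs n) \<le> G y + 1 / Suc n" if "y \<in> K n" for n y
    using xs(2)[of n] \<alpha>_le[OF that] by linarith
  ultimately show ?thesis using xs(1) by blast
qed

end

section \<open>The space \<open>L\<^sub>2\<close>\<close>

abbreviation L2_dist :: "'a measure \<Rightarrow> ('a \<Rightarrow> real) \<Rightarrow> ('a \<Rightarrow> real) \<Rightarrow> real" where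
  "L2_dist \<mu> u v \<equiv> L2_norm \<mu> (\<lambda>p. u p - v p)"

lemma L2_measurable: "u \<in> L2 \<mu> \<Longrightarrow> u \<in> borel_measurable \<mu>"
  by (simp add: L2_def)

lemma L2_integrable_square: "u \<in> L2 \<mu> \<Longrightarrow> integrable \<mu> (\<lambda>p. (u p)\<^sup>2)"
  by (simp add: L2_def)

lemma L2_integrable_mult:
  assumes "u \<in> L2 \<mu>" "v \<in> L2 \<mu>"
  shows "integrable \<mu> (\<lambda>p. u p * v p)"
proof (rule Bochner_Integration.integrable_bound)
  show "integrable \<mu> (\<lambda>p. (u p)\<^sup>2 + (v p)\<^sup>2)"
    using assms by (simp add: L2_integrable_square)
  have "\<bar>x * y\<bar> \<le> \<bar>x\<^sup>2 + y\<^sup>2\<bar>" for x y :: real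
  proof -
    have "0 \<le> \<bar>x\<bar> * \<bar>y\<bar>" "2 * (\<bar>x\<bar> * \<bar>y\<bar>) \<le> x\<^sup>2 + y\<^sup>2"
      using sum_squares_bound[of "\<bar>x\<bar>" "\<bar>y\<bar>"] by auto
    then show ?thesis unfolding abs_mult by linarith
  qed
  then show "AE p in \<mu>. norm (u p * v p) \<le> norm ((u p)\<^sup>2 + (v p)\<^sup>2)" by simp
qed (use assms in \<open>simp add: borel_measurable_times L2_measurable\<close>)

lemma L2_dominated:
  assumes "v \<in> L2 \<mu>" "u \<in> borel_measurable \<mu>" "\<And>p. \<bar>u p\<bar> \<le> \<bar>v p\<bar>"
  shows "u \<in> L2 \<mu>"
proof -
  have "integrable \<mu> (\<lambda>p. (u p)\<^sup>2)"
    by (rule Bochner_Integration.integrable_bound[OF L2_integrable_square[OF assms(1)]])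
       (use assms in \<open>auto simp: abs_le_square_iff\<close>)
  then show ?thesis using assms by (simp add: L2_def)
qed

lemma L2_add:
  assumes "u \<in> L2 \<mu>" "v \<in> L2 \<mu>"
  shows "(\<lambda>p. u p + v p) \<in> L2 \<mu>"
proof -
  have "integrable \<mu> (\<lambda>p. (u p)\<^sup>2 + (v p)\<^sup>2 + 2 * (u p * v p))"
    using assms by (simp add: L2_integrable_square L2_integrable_mult)
  moreover have [measurable]: "u \<in> borel_measurable \<mu>" "v \<in> borel_measurable \<mu>"
    using assms L2_measurable by blast+
  ultimately show ?thesis by (simp add: L2_def power2_sum mult.assoc)
qed

lemma L2_scale: "u \<in> L2 \<mu> \<Longrightarrow> (\<lambda>p. r * u p) \<in> L2 \<mu>"
  by (auto simp: L2_def power_mult_distrib intro: borel_measurable_times)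

lemma L2_inner_self: "L2_inner \<mu> u u = (LINT p|\<mu>. (u p)\<^sup>2)"
  by (simp add: L2_inner_def power2_eq_square)

text \<open>The \<open>rewrites\<close> clause makes every seminorm fact of the locale a fact about
  \<open>L2_norm\<close>.\<close>

global_interpretation L2: psd_form "L2 \<mu>" "L2_inner \<mu>"
  rewrites "psd_form.nrm (L2_inner \<mu>) = L2_norm \<mu>"
  for \<mu> :: "'a measure"
proof -
  show *: "psd_form (L2 \<mu>) (L2_inner \<mu>)"
  proof
    show "(\<lambda>p. 0) \<in> L2 \<mu>" by (simp add: L2_def)
    show "0 \<le> L2_inner \<mu> u u" for u by (simp add: L2_inner_self)
    show "L2_inner \<mu> (\<lambda>p. u p + v p) w = L2_inner \<mu> u w + L2_inner \<mu> v w"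
      if "u \<in> L2 \<mu>" "v \<in> L2 \<mu>" "w \<in> L2 \<mu>" for u v w
      using that by (simp add: L2_inner_def distrib_right L2_integrable_mult)
  qed (auto simp: L2_add L2_scale L2_inner_def mult.commute mult.left_commute)
  show "psd_form.nrm (L2_inner \<mu>) = L2_norm \<mu>"
    by (auto simp: psd_form.nrm_def[OF *] L2_norm_def L2_inner_self)
qed

lemma L2_norm_cong_AE:
  assumes "u \<in> borel_measurable \<mu>" "v \<in> borel_measurable \<mu>" "AE p in \<mu>. u p = v p"
  shows "L2_norm \<mu> u = L2_norm \<mu> v"
proof -
  have "(LINT p|\<mu>. (u p)\<^sup>2) = (LINT p|\<mu>. (v p)\<^sup>2)"
    by (rule integral_cong_AE) (use assms in auto)
  then show ?thesis by (simp add: L2_norm_def)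
qed

lemma L2_inner_cong_AE:
  assumes "u \<in> L2 \<mu>" "v \<in> L2 \<mu>" "w \<in> L2 \<mu>" "AE p in \<mu>. u p = v p"
  shows "L2_inner \<mu> u w = L2_inner \<mu> v w"
  unfolding L2_inner_def
  by (rule integral_cong_AE) (use assms in \<open>auto intro: borel_measurable_times L2_measurable\<close>)

lemma L2_norm_mono:
  assumes "v \<in> L2 \<mu>" "u \<in> borel_measurable \<mu>" "\<And>p. \<bar>u p\<bar> \<le> \<bar>v p\<bar>"
  shows "L2_norm \<mu> u \<le> L2_norm \<mu> v"
proof -
  have "u \<in> L2 \<mu>" by (rule L2_dominated[OF assms])
  then have "(LINT p|\<mu>. (u p)\<^sup>2) \<le> (LINT p|\<mu>. (v p)\<^sup>2)"
    using assms by (intro integral_mono L2_integrable_square) (auto simp: abs_le_square_iff)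
  then show ?thesis by (simp add: L2_norm_def)
qed

lemma L2_norm_zero_AE:
  assumes "u \<in> L2 \<mu>" "L2_norm \<mu> u = 0"
  shows "AE p in \<mu>. u p = 0"
  using assms integral_nonneg_eq_0_iff_AE[OF L2_integrable_square[OF assms(1)]]
  by (simp add: L2_norm_def)

lemma nn_integral_square:
  assumes "u \<in> L2 \<mu>"
  shows "(\<integral>\<^sup>+p. ennreal ((u p)\<^sup>2) \<partial>\<mu>) = ennreal ((L2_norm \<mu> u)\<^sup>2)"
  using nn_integral_eq_integral[OF L2_integrable_square[OF assms]]
  by (simp add: L2_norm_def)

text \<open>On a general measure an L2 bound gives no L1 bound for the increments d_n. Instead the
  sum of 2^n d_n^2 has finite integral and is therefore finite almost everywhere, and d_n <= 2^-n +
  2^n d_n^2 follows from 0 <= (1 - 2^n d_n)^2. Hence the increments are absolutely summable at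
  almost every point.\<close>

lemma L2_Cauchy_fast_subseq:
  fixes us :: "nat \<Rightarrow> 'a \<Rightarrow> real"
  assumes us: "\<And>n. us n \<in> L2 \<mu>"
    and fast: "\<And>n. L2_norm \<mu> (\<lambda>p. us (Suc n) p - us n p) \<le> (1/2) ^ n"
  shows "AE p in \<mu>. convergent (\<lambda>n. us n p)"
proof -
  define d where "d n p = \<bar>us (Suc n) p - us n p\<bar>" for n p
  have dL: "(\<lambda>p. us (Suc n) p - us n p) \<in> L2 \<mu>" for n by (simp add: L2.mem us)
  have [measurable]: "us n \<in> borel_measurable \<mu>" for n using us L2_measurable by blast
  have dm[measurable]: "d n \<in> borel_measurable \<mu>" for n unfolding d_def by measurable
  have int: "integrable \<mu> (\<lambda>p. 2 ^ n * (d n p)\<^sup>2)" for n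
    using L2_integrable_square[OF dL] by (simp add: d_def)
  have val: "(LINT p|\<mu>. 2 ^ n * (d n p)\<^sup>2) \<le> (1/2) ^ n" for n
  proof -
    have "(LINT p|\<mu>. 2 ^ n * (d n p)\<^sup>2) = 2 ^ n * (L2_norm \<mu> (\<lambda>p. us (Suc n) p - us n p))\<^sup>2"
      by (simp add: d_def L2_norm_def)
    also have "\<dots> \<le> 2 ^ n * ((1/2) ^ n)\<^sup>2"
      using fast[of n] by (intro mult_left_mono power_mono L2.nrm_nonneg dL) auto
    also have "\<dots> = (1/2) ^ n" by (simp add: power2_eq_square flip: power_mult_distrib)
    finally show ?thesis .
  qed
  have "(\<integral>\<^sup>+p. (\<Sum>n. ennreal (2 ^ n * (d n p)\<^sup>2)) \<partial>\<mu>) = (\<Sum>n. \<integral>\<^sup>+p. ennreal (2 ^ n * (d n p)\<^sup>2) \<partial>\<mu>)"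
    by (rule nn_integral_suminf) measurable
  also have "\<dots> \<le> (\<Sum>n. ennreal ((1/2) ^ n))"
    by (intro suminf_le) (use val int in \<open>auto simp: nn_integral_eq_integral intro!: ennreal_leI\<close>)
  also have "\<dots> = ennreal (\<Sum>n. (1/2) ^ n)"
    by (intro suminf_ennreal2) auto
  also have "\<dots> < \<infinity>" by simp
  finally have "AE p in \<mu>. (\<Sum>n. ennreal (2 ^ n * (d n p)\<^sup>2)) \<noteq> \<infinity>"
    by (intro nn_integral_PInf_AE) auto
  then show ?thesis
  proof (rule AE_mp, intro AE_I2 impI)
    fix p assume "(\<Sum>n. ennreal (2 ^ n * (d n p)\<^sup>2)) \<noteq> \<infinity>"
    then have "summable (\<lambda>n. 2 ^ n * (d n p)\<^sup>2)"
      by (intro summable_suminf_not_top) auto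
    then have sm: "summable (\<lambda>n. (1/2) ^ n + 2 ^ n * (d n p)\<^sup>2)"
      by (intro summable_add summable_geometric) auto
    have "norm (us (Suc n) p - us n p) \<le> (1/2) ^ n + 2 ^ n * (d n p)\<^sup>2" for n
    proof -
      have "0 \<le> (1 - 2 ^ n * d n p)\<^sup>2" by simp
      then have "0 \<le> (1/2) ^ n * (1 - 2 ^ n * d n p)\<^sup>2" by (intro mult_nonneg_nonneg) auto
      also have "\<dots> = (1/2) ^ n + 2 ^ n * (d n p)\<^sup>2 - 2 * d n p"
        by (simp add: power2_eq_square algebra_simps power_one_over)
      finally have "0 \<le> (1/2) ^ n + 2 ^ n * (d n p)\<^sup>2 - 2 * d n p" .
      moreover have "0 \<le> d n p" by (simp add: d_def)
      moreover have "x \<le> s" if "0 \<le> s - 2 * x" "0 \<le> x" for x s :: real using that by linarith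
      ultimately have "d n p \<le> (1/2) ^ n + 2 ^ n * (d n p)\<^sup>2" by blast
      then show ?thesis by (simp add: d_def)
    qed
    then have "summable (\<lambda>n. us (Suc n) p - us n p)"
      by (intro summable_comparison_test'[OF sm, of 0]) auto
    then have "convergent (\<lambda>n. (\<Sum>i<n. us (Suc i) p - us i p) + us 0 p)"
      by (intro convergent_add convergent_const) (simp add: summable_iff_convergent)
    then show "convergent (\<lambda>n. us n p)"
      using sum_lessThan_telescope[of "\<lambda>i. us i p"] by simp
  qed
qed

text \<open>Fatou's lemma for the squares. Only measurability of \<open>u\<close> is assumed: with a
  late term of a Cauchy sequence as \<open>v\<close>, the lemma yields both that the limit lies in
  L2 and how near it is.\<close>

lemma L2_limit_of_AE_limit:
  assumes us: "\<And>k. us k \<in> L2 \<mu>" and v: "v \<in> L2 \<mu>" and u: "u \<in> borel_measurable \<mu>"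
    and lim: "AE p in \<mu>. (\<lambda>k. us k p) \<longlonglongrightarrow> u p"
    and bound: "eventually (\<lambda>k. L2_dist \<mu> v (us k) \<le> e) sequentially"
  shows "(\<lambda>p. v p - u p) \<in> L2 \<mu>" "L2_dist \<mu> v u \<le> e"
proof -
  have [measurable]: "us k \<in> borel_measurable \<mu>" "v \<in> borel_measurable \<mu>" "u \<in> borel_measurable \<mu>" for k
    using us v u L2_measurable by blast+
  have D: "(\<lambda>p. v p - us k p) \<in> L2 \<mu>" for k using us v by (simp add: L2.mem)
  have e: "e \<ge> 0"
    using eventually_happens[OF bound] L2.nrm_nonneg[OF D] by (auto intro: order_trans)
  have "(\<integral>\<^sup>+p. ennreal ((v p - u p)\<^sup>2) \<partial>\<mu>)
      = (\<integral>\<^sup>+p. liminf (\<lambda>k. ennreal ((v p - us k p)\<^sup>2)) \<partial>\<mu>)"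
  proof (rule nn_integral_cong_AE, rule AE_mp[OF lim], intro AE_I2 impI)
    fix p assume "(\<lambda>k. us k p) \<longlonglongrightarrow> u p"
    then have "(\<lambda>k. ennreal ((v p - us k p)\<^sup>2)) \<longlonglongrightarrow> ennreal ((v p - u p)\<^sup>2)"
      by (intro tendsto_intros)
    from lim_imp_Liminf[OF _ this]
    show "ennreal ((v p - u p)\<^sup>2) = liminf (\<lambda>k. ennreal ((v p - us k p)\<^sup>2))"
      by simp
  qed
  also have "\<dots> \<le> liminf (\<lambda>k. \<integral>\<^sup>+p. ennreal ((v p - us k p)\<^sup>2) \<partial>\<mu>)"
    by (rule nn_integral_liminf) measurable
  also have "\<dots> \<le> ennreal (e\<^sup>2)"
  proof (rule order_trans[OF Liminf_mono])
    show "eventually (\<lambda>k. (\<integral>\<^sup>+p. ennreal ((v p - us k p)\<^sup>2) \<partial>\<mu>) \<le> ennreal (e\<^sup>2)) sequentially"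
      using bound
      by eventually_elim
        (auto simp: nn_integral_square[OF D] intro!: ennreal_leI power_mono L2.nrm_nonneg[OF D])
  qed (simp add: Liminf_const)
  finally have le: "(\<integral>\<^sup>+p. ennreal ((v p - u p)\<^sup>2) \<partial>\<mu>) \<le> ennreal (e\<^sup>2)" .
  then have "integrable \<mu> (\<lambda>p. (v p - u p)\<^sup>2)"
    by (intro integrableI_nonneg) (auto intro: le_less_trans)
  then show *: "(\<lambda>p. v p - u p) \<in> L2 \<mu>" by (simp add: L2_def)
  then show "L2_dist \<mu> v u \<le> e"
    using le nn_integral_square[OF *] e by (simp add: power2_le_iff_abs_le L2.nrm_nonneg)
qed

lemma L2_complete:
  assumes us: "\<And>n. us n \<in> L2 \<mu>"
    and Cau: "\<And>e. e > 0 \<Longrightarrow> \<exists>N. \<forall>j\<ge>N. \<forall>k\<ge>N. L2_dist \<mu> (us j) (us k) < e"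
  shows "\<exists>u\<in>L2 \<mu>. (\<lambda>n. L2_dist \<mu> (us n) u) \<longlonglongrightarrow> 0"
proof -
  obtain N where N: "\<And>e j k. e > 0 \<Longrightarrow> j \<ge> N e \<Longrightarrow> k \<ge> N e \<Longrightarrow>
      L2_dist \<mu> (us j) (us k) < e"
    using Cau by metis
  \<comment> \<open>The sum makes \<open>r n\<close> dominate \<open>N ((1/2) ^ n)\<close>, and the
    summand \<open>n\<close> makes \<open>r\<close> strictly increasing.\<close>
  define r :: "nat \<Rightarrow> nat" where "r n = (\<Sum>i\<le>n. N ((1/2) ^ i)) + n" for n
  have r_N: "r n \<ge> N ((1/2) ^ n)" for n
    unfolding r_def by (intro trans_le_add1 member_le_sum) auto
  have r_mono: "r n < r (Suc n)" for n by (simp add: r_def)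
  have "strict_mono r" using r_mono by (rule strict_monoI_Suc)
  have [measurable]: "us n \<in> borel_measurable \<mu>" for n using us L2_measurable by blast
  have "AE p in \<mu>. convergent (\<lambda>n. us (r n) p)"
  proof (rule L2_Cauchy_fast_subseq)
    show "L2_norm \<mu> (\<lambda>p. us (r (Suc n)) p - us (r n) p) \<le> (1/2) ^ n" for n
      using N[of "(1/2) ^ n" "r (Suc n)" "r n"] r_N[of n] r_mono[of n] by simp
  qed (rule us)
  then have lim: "AE p in \<mu>. (\<lambda>n. us (r n) p) \<longlonglongrightarrow> lim (\<lambda>n. us (r n) p)"
    by (simp add: convergent_LIMSEQ_iff)
  define u where "u p = lim (\<lambda>n. us (r n) p)" for p
  have um: "u \<in> borel_measurable \<mu>" unfolding u_def by measurable
  have ev: "eventually (\<lambda>k. L2_norm \<mu> (\<lambda>p. us n p - us (r k) p) \<le> e) sequentially"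
    if "e > 0" "n \<ge> N e" for e n
    using eventually_ge_at_top[of "N e"]
  proof eventually_elim
    case (elim k)
    then have "r k \<ge> N e" using \<open>strict_mono r\<close> seq_suble[of r k] by linarith
    then show ?case using N[of e n "r k"] that by simp
  qed
  note Fatou = L2_limit_of_AE_limit[where u = u, OF us us um lim[folded u_def] ev]
  have "(\<lambda>p. us (N 1) p - (us (N 1) p - u p)) \<in> L2 \<mu>"
    by (rule L2.diff_mem[OF us]) (rule Fatou(1)[of 1 "N 1"], auto)
  then have "u \<in> L2 \<mu>" by simp
  moreover have "(\<lambda>n. L2_dist \<mu> (us n) u) \<longlonglongrightarrow> 0"
  proof (rule LIMSEQ_I)
    fix e :: real assume "e > 0"
    have "norm (L2_dist \<mu> (us n) u - 0) < e" if "n \<ge> N (e/2)" for n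
      using Fatou[of "e/2" n] that \<open>e > 0\<close> L2.nrm_nonneg[OF Fatou(1)[of "e/2" n]] by simp
    then show "\<exists>no. \<forall>n\<ge>no. norm (L2_dist \<mu> (us n) u - 0) < e" by blast
  qed
  ultimately show ?thesis by blast
qed

lemma L2_inner_tendsto:
  assumes "\<And>n. us n \<in> L2 \<mu>" "u \<in> L2 \<mu>" "v \<in> L2 \<mu>"
    and "(\<lambda>n. L2_dist \<mu> (us n) u) \<longlonglongrightarrow> 0"
  shows "(\<lambda>n. L2_inner \<mu> (us n) v) \<longlonglongrightarrow> L2_inner \<mu> u v"
proof (rule Lim_transform2)
  show "(\<lambda>n. L2_inner \<mu> u v) \<longlonglongrightarrow> L2_inner \<mu> u v" by simp
  have "(\<lambda>n. L2_inner \<mu> (\<lambda>p. us n p - u p) v) \<longlonglongrightarrow> 0"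
  proof (rule Lim_null_comparison)
    show "\<forall>\<^sub>F n in sequentially. norm (L2_inner \<mu> (\<lambda>p. us n p - u p) v)
        \<le> L2_dist \<mu> (us n) u * L2_norm \<mu> v"
      using assms by (auto intro!: always_eventually L2.Cauchy_Schwarz L2.mem)
    show "(\<lambda>n. L2_dist \<mu> (us n) u * L2_norm \<mu> v) \<longlonglongrightarrow> 0"
      using tendsto_mult_right[OF assms(4), of "L2_norm \<mu> v"] by simp
  qed
  then show "(\<lambda>n. L2_inner \<mu> u v - L2_inner \<mu> (us n) v) \<longlonglongrightarrow> 0"
    using tendsto_minus[of "\<lambda>n. L2_inner \<mu> (us n) v - L2_inner \<mu> u v" 0] assms
    by (simp add: L2.bilin)
qed

text \<open>The representing function is the minimiser of (x, x) - 2 l x. Near-minimisers form a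
  Cauchy sequence; comparing each with its translate by t v and passing to the limit gives a
  quadratic in t without constant term that is never negative, so its linear coefficient
  vanishes.\<close>

lemma L2_Riesz:
  assumes add: "\<And>u v. u \<in> L2 \<mu> \<Longrightarrow> v \<in> L2 \<mu> \<Longrightarrow> l (\<lambda>p. u p + v p) = l u + l v"
    and scale: "\<And>r u. u \<in> L2 \<mu> \<Longrightarrow> l (\<lambda>p. r * u p) = r * l u"
    and bound: "\<And>u. u \<in> L2 \<mu> \<Longrightarrow> \<bar>l u\<bar> \<le> C * L2_norm \<mu> u"
  shows "\<exists>U\<in>L2 \<mu>. \<forall>v\<in>L2 \<mu>. L2_inner \<mu> U v = l v"
proof -
  let ?G = "\<lambda>x. L2_inner \<mu> x x - 2 * l x"
  \<comment> \<open>Completing the square in |x|^2 - 2 C |x|.\<close>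
  have lower: "- C\<^sup>2 \<le> ?G x" if "x \<in> L2 \<mu>" for x
    using bound[OF that] zero_le_power2[of "L2_norm \<mu> x - C"] L2.nrm_square[OF that]
    by (simp add: power2_diff abs_le_iff mult.commute)
  have half: "2 * (2 * l (\<lambda>p. (x p + y p) / 2)) = 2 * l x + 2 * l y" if "x \<in> L2 \<mu>" "y \<in> L2 \<mu>" for x y
    using scale[of "\<lambda>p. x p + y p" "1/2"] add[OF that] that by (simp add: L2.mem)
  have mid: "(\<lambda>p. (x p + y p) / 2) \<in> L2 \<mu>" if "x \<in> L2 \<mu>" "y \<in> L2 \<mu>" for x y
    using L2.scale_mem[of "\<lambda>p. x p + y p" \<mu> "1/2"] that by (simp add: L2.mem)
  have "\<exists>xs. (\<forall>n. xs n \<in> L2 \<mu>) \<and> (\<forall>n. \<forall>y\<in>L2 \<mu>. ?G (xs n) \<le> ?G y + 1 / Suc n) \<and>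
    (\<forall>e>0. \<exists>N. \<forall>j\<ge>N. \<forall>k\<ge>N. L2_inner \<mu> (\<lambda>p. xs j p - xs k p) (\<lambda>p. xs j p - xs k p) < e)"
    by (rule L2.minimising_sequence_Cauchy[where b = "- C\<^sup>2" and w = "\<lambda>_ _. 0" and B = "?G (\<lambda>_. 0)"])
      (use lower half mid in \<open>auto simp: L2.mem\<close>)
  then obtain xs where xs: "\<And>n. xs n \<in> L2 \<mu>" and min: "\<And>n y. y \<in> L2 \<mu> \<Longrightarrow> ?G (xs n) \<le> ?G y + 1 / Suc n"
    and Cau: "\<And>e. e > 0 \<Longrightarrow> \<exists>N. \<forall>j\<ge>N. \<forall>k\<ge>N.
      L2_inner \<mu> (\<lambda>p. xs j p - xs k p) (\<lambda>p. xs j p - xs k p) < e"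
    by blast
  have "\<exists>N. \<forall>j\<ge>N. \<forall>k\<ge>N. L2_dist \<mu> (xs j) (xs k) < e" if "e > 0" for e
    using Cau[of "e\<^sup>2"] that real_sqrt_less_iff[of _ "e\<^sup>2"]
    by (simp add: L2_norm_def L2_inner_self)
  then obtain U where U: "U \<in> L2 \<mu>" "(\<lambda>n. L2_dist \<mu> (xs n) U) \<longlonglongrightarrow> 0"
    using L2_complete[of xs \<mu>] xs by blast
  have "L2_inner \<mu> U v = l v" if v: "v \<in> L2 \<mu>" for v
  proof -
    have ineq: "0 \<le> 1 / Suc n - 2 * t * (l v - L2_inner \<mu> (xs n) v) + t\<^sup>2 * L2_inner \<mu> v v" for t n
    proof -
      have "?G (\<lambda>p. xs n p + t * v p) = ?G (xs n) + 2 * t * (L2_inner \<mu> (xs n) v - l v) + t\<^sup>2 * L2_inner \<mu> v v"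
        using L2.square_expand[OF xs v, of n t] add[of "xs n" "\<lambda>p. t * v p"] scale[of v t] xs v
        by (simp add: L2.mem algebra_simps)
      then show ?thesis using min[of "\<lambda>p. xs n p + t * v p" n] xs v by (simp add: L2.mem algebra_simps)
    qed
    have "0 \<le> 0 - 2 * t * (l v - L2_inner \<mu> U v) + t\<^sup>2 * L2_inner \<mu> v v" for t
    proof (rule LIMSEQ_le_const)
      show "(\<lambda>n. 1 / Suc n - 2 * t * (l v - L2_inner \<mu> (xs n) v) + t\<^sup>2 * L2_inner \<mu> v v)
        \<longlonglongrightarrow> 0 - 2 * t * (l v - L2_inner \<mu> U v) + t\<^sup>2 * L2_inner \<mu> v v"
        by (intro tendsto_intros L2_inner_tendsto xs U v lim_1_over_n[THEN LIMSEQ_Suc, unfolded of_nat_Suc[symmetric]])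
           (use LIMSEQ_inverse_real_of_nat in \<open>simp add: inverse_eq_divide\<close>)?
    qed (use ineq in auto)
    then have "(l v - L2_inner \<mu> U v)\<^sup>2 \<le> 0 * L2_inner \<mu> v v"
      by (intro discriminant_le_if_quadratic_nonneg L2.nonneg v) auto
    then show ?thesis by simp
  qed
  then show ?thesis using U(1) by blast
qed

section \<open>Strongly continuous semigroups on \<open>L\<^sub>2\<close>\<close>

lemma L2_operator_mem: "bounded_L2_operator \<mu> S \<Longrightarrow> u \<in> L2 \<mu> \<Longrightarrow> S u \<in> L2 \<mu>"
  by (simp add: bounded_L2_operator_def)

lemma L2_operator_add:
  assumes "bounded_L2_operator \<mu> S" "u \<in> L2 \<mu>" "v \<in> L2 \<mu>"
  shows "AE p in \<mu>. S (\<lambda>p. u p + v p) p = S u p + S v p"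
  using assms by (simp add: bounded_L2_operator_def)

lemma L2_operator_scale:
  assumes "bounded_L2_operator \<mu> S" "u \<in> L2 \<mu>"
  shows "AE p in \<mu>. S (\<lambda>p. r * u p) p = r * S u p"
  using assms by (simp add: bounded_L2_operator_def)

lemma L2_operator_diff:
  assumes "bounded_L2_operator \<mu> S" "u \<in> L2 \<mu>" "v \<in> L2 \<mu>"
  shows "AE p in \<mu>. S (\<lambda>p. u p - v p) p = S u p - S v p"
  using L2_operator_add[OF assms(1,2) L2.scale_mem[OF assms(3), of "-1"]]
    L2_operator_scale[OF assms(1,3), of "-1"]
  by (rule AE_mp[OF _ AE_mp]) auto

lemma L2_operator_bound:
  assumes "bounded_L2_operator \<mu> S"
  obtains C where "C \<ge> 0" "\<And>u. u \<in> L2 \<mu> \<Longrightarrow> L2_norm \<mu> (S u) \<le> C * L2_norm \<mu> u"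
proof -
  obtain C where C: "\<forall>u\<in>L2 \<mu>. L2_norm \<mu> (S u) \<le> C * L2_norm \<mu> u"
    using assms by (auto simp: bounded_L2_operator_def)
  have "L2_norm \<mu> (S u) \<le> \<bar>C\<bar> * L2_norm \<mu> u" if "u \<in> L2 \<mu>" for u
    using C that mult_right_mono[OF abs_ge_self L2.nrm_nonneg[OF that], of C] by force
  then show ?thesis using that[of "\<bar>C\<bar>"] by simp
qed

lemma L2_operator_norm_diff:
  assumes "bounded_L2_operator \<mu> S" "u \<in> L2 \<mu>" "v \<in> L2 \<mu>"
  shows "L2_dist \<mu> (S u) (S v) = L2_norm \<mu> (S (\<lambda>p. u p - v p))"
  by (rule L2_norm_cong_AE)
     (use L2_operator_diff[OF assms] assms in \<open>auto simp: L2.mem L2_operator_mem[OF assms(1)] L2_measurable\<close>)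

text \<open>If no ball had a common bound, then every ball would contain a smaller one on which some
  operator is at least k in norm. Nested balls for k = 0, 1, 2, ... shrink to a point that
  contradicts the pointwise bound. On a ball that does have a common bound, linearity turns the
  bound into an operator bound.\<close>

lemma L2_uniform_boundedness:
  fixes \<mu> :: "'a measure"
  assumes S: "\<And>n::nat. bounded_L2_operator \<mu> (S n)"
    and pointwise: "\<And>u. u \<in> L2 \<mu> \<Longrightarrow> \<exists>B. \<forall>n. L2_norm \<mu> (S n u) \<le> B"
  shows "\<exists>B. \<forall>n. \<forall>u\<in>L2 \<mu>. L2_norm \<mu> (S n u) \<le> B * L2_norm \<mu> u"
proof -
  have "\<exists>x\<in>L2 \<mu>. \<exists>r>0. \<exists>K. \<forall>z\<in>L2 \<mu>. L2_dist \<mu> z x \<le> r \<longrightarrow> (\<forall>n. L2_norm \<mu> (S n z) \<le> K)"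
  proof (rule ccontr)
    assume neg: "\<not> ?thesis"
    have step: "\<exists>x' r'. x' \<in> L2 \<mu> \<and> 0 < r' \<and> r' \<le> r / 2 \<and> L2_dist \<mu> x' x \<le> r / 2 \<and>
        (\<exists>n. \<forall>z\<in>L2 \<mu>. L2_dist \<mu> z x' \<le> r' \<longrightarrow> k \<le> L2_norm \<mu> (S n z))"
      if x: "x \<in> L2 \<mu>" and "r > 0" for x r and k :: real
    proof -
      have "r / 2 > 0" using that by simp
      then have "\<not> (\<forall>z\<in>L2 \<mu>. L2_dist \<mu> z x \<le> r / 2 \<longrightarrow> (\<forall>n. L2_norm \<mu> (S n z) \<le> k))"
        using neg x by blast
      then obtain y n where y: "y \<in> L2 \<mu>" "L2_dist \<mu> y x \<le> r / 2" "k < L2_norm \<mu> (S n y)"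
        by (auto simp: not_le)
      obtain C where C: "C \<ge> 0" "\<And>u. u \<in> L2 \<mu> \<Longrightarrow> L2_norm \<mu> (S n u) \<le> C * L2_norm \<mu> u"
        using L2_operator_bound[OF S] by blast
      \<comment> \<open>The second term makes C r' at most |S n y| - k, so the norm cannot fall
        below k on the new ball; C + 1 keeps the denominator positive.\<close>
      define r' where "r' = min (r / 2) ((L2_norm \<mu> (S n y) - k) / (C + 1))"
      have r': "r' > 0" using \<open>r / 2 > 0\<close> y(3) C(1) by (simp add: r'_def)
      have r'2: "r' \<le> r / 2" unfolding r'_def by (rule min.cobounded1)
      have "C * r' \<le> (C + 1) * r'" using r' by (simp add: distrib_right)
      also have "\<dots> \<le> (C + 1) * ((L2_norm \<mu> (S n y) - k) / (C + 1))"
        using C(1) by (intro mult_left_mono) (auto simp: r'_def)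
      also have "\<dots> = L2_norm \<mu> (S n y) - k" using C(1) by simp
      finally have Cr: "C * r' \<le> L2_norm \<mu> (S n y) - k" .
      have "k \<le> L2_norm \<mu> (S n z)" if z: "z \<in> L2 \<mu>" "L2_dist \<mu> z y \<le> r'" for z
      proof -
        have "L2_norm \<mu> (S n y) \<le> L2_norm \<mu> (S n z) + L2_dist \<mu> (S n y) (S n z)"
          by (intro L2.nrm_le_add_diff L2_operator_mem[OF S] y(1) z(1))
        also have "L2_dist \<mu> (S n y) (S n z) \<le> C * L2_dist \<mu> y z"
          using C(2)[of "\<lambda>p. y p - z p"] y z by (simp add: L2_operator_norm_diff[OF S] L2.mem)
        also have "\<dots> \<le> C * r'"
          using z y by (intro mult_left_mono C) (simp add: L2.nrm_diff_commute[of y _ z])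
        finally show ?thesis using Cr by linarith
      qed
      then show ?thesis using y r' r'2 by blast
    qed
    \<comment> \<open>States are pairs of centre and radius. Halving the radius and moving the
      centre by at most half of it keeps the new ball inside the old one.\<close>
    define Q where "Q k X X' \<longleftrightarrow> snd X' \<le> snd X / 2 \<and> L2_dist \<mu> (fst X') (fst X) \<le> snd X / 2 \<and>
        (\<exists>n. \<forall>z\<in>L2 \<mu>. L2_dist \<mu> z (fst X') \<le> snd X' \<longrightarrow> real k \<le> L2_norm \<mu> (S n z))"
      for k :: nat and X X' :: "('a \<Rightarrow> real) \<times> real"
    have "\<exists>X. \<forall>k. (fst (X k) \<in> L2 \<mu> \<and> snd (X k) > 0) \<and> Q k (X k) (X (Suc k))"
    proof (rule dependent_nat_choice)
      show "\<exists>X. fst X \<in> L2 \<mu> \<and> snd X > (0::real)" 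
        using L2.zero_mem[of \<mu>] by (metis fst_conv snd_conv zero_less_one)
      show "\<exists>X'. (fst X' \<in> L2 \<mu> \<and> snd X' > 0) \<and> Q k X X'" if X: "fst X \<in> L2 \<mu> \<and> snd X > 0" for X k
      proof -
        obtain x' r' where "x' \<in> L2 \<mu>" "0 < r'" "r' \<le> snd X / 2" "L2_dist \<mu> x' (fst X) \<le> snd X / 2"
          "\<exists>n. \<forall>z\<in>L2 \<mu>. L2_dist \<mu> z x' \<le> r' \<longrightarrow> real k \<le> L2_norm \<mu> (S n z)"
          using step[OF conjunct1[OF X] conjunct2[OF X], of "real k"] by blast
        then show ?thesis unfolding Q_def by (intro exI[of _ "(x', r')"]) simp
      qed
    qed
    then obtain X where X: "\<And>k. fst (X k) \<in> L2 \<mu>" "\<And>k. snd (X k) > 0" "\<And>k. Q k (X k) (X (Suc k))"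
      by blast
    define x r where "x k = fst (X k)" and "r k = snd (X k)" for k
    have x: "x k \<in> L2 \<mu>" and r: "r k > 0" and half: "r (Suc k) \<le> r k / 2"
      and near: "L2_norm \<mu> (\<lambda>p. x (Suc k) p - x k p) \<le> r k / 2" for k
      using X[of k] by (auto simp: x_def r_def Q_def)
    have big: "\<exists>n. \<forall>z\<in>L2 \<mu>. L2_norm \<mu> (\<lambda>p. z p - x (Suc k) p) \<le> r (Suc k) \<longrightarrow> real k \<le> L2_norm \<mu> (S n z)" for k
      using X(3)[of k] by (auto simp: x_def r_def Q_def)
    have nested: "L2_dist \<mu> z (x k) \<le> r k"
      if "z \<in> L2 \<mu>" "L2_norm \<mu> (\<lambda>p. z p - x (k + d) p) \<le> r (k + d)" for z k d
      using that(2)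
    proof (induction d)
      case 0
      then show ?case by (simp only: add_0_right)
    next
      case (Suc d)
      have "L2_norm \<mu> (\<lambda>p. z p - x (k + d) p)
          \<le> L2_norm \<mu> (\<lambda>p. z p - x (Suc (k + d)) p) + L2_norm \<mu> (\<lambda>p. x (Suc (k + d)) p - x (k + d) p)"
        by (intro L2.nrm_diff_triangle that x)
      also have "\<dots> \<le> r (k + d)" using Suc.prems near[of "k + d"] half[of "k + d"] by simp
      finally show ?case by (rule Suc.IH)
    qed
    have close: "L2_dist \<mu> (x m) (x k) \<le> r k" if "k \<le> m" for m k
      using nested[of "x m" k "m - k"] that x r[of m] L2.nrm_zero[of \<mu>] by (simp add: less_imp_le)
    have rk: "r k \<le> r 0 * (1/2) ^ k" for k
    proof (induction k)
      case (Suc k)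
      then show ?case using half[of k] by simp
    qed simp
    have r0: "r \<longlonglongrightarrow> 0"
    proof (rule tendsto_sandwich[of "\<lambda>_. 0"])
      show "(\<lambda>k. r 0 * (1/2) ^ k) \<longlonglongrightarrow> 0" by (intro tendsto_mult_right_zero LIMSEQ_power_zero) simp
    qed (use r rk in \<open>auto intro!: always_eventually less_imp_le\<close>)
    have "\<exists>N. \<forall>j\<ge>N. \<forall>k\<ge>N. L2_dist \<mu> (x j) (x k) < e" if "e > 0" for e
    proof -
      obtain N where N: "r N < e / 2"
        using eventually_happens[OF order_tendstoD(2)[OF r0, of "e / 2"]] \<open>e > 0\<close> by auto
      have "L2_dist \<mu> (x j) (x k) < e" if "j \<ge> N" "k \<ge> N" for j k
        using L2.nrm_diff_triangle[OF x x x, of j k N] close[of N j] close[of N k] N that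
          L2.nrm_diff_commute[OF x x, of N k] by simp
      then show ?thesis by blast
    qed
    then obtain y where y: "y \<in> L2 \<mu>" "(\<lambda>n. L2_dist \<mu> (x n) y) \<longlonglongrightarrow> 0"
      using L2_complete[of x \<mu>] x by blast
    have y_close: "L2_dist \<mu> y (x k) \<le> r k" for k
    proof (rule LIMSEQ_le_const)
      show "(\<lambda>m. L2_dist \<mu> (x m) y + r k) \<longlonglongrightarrow> r k"
        using tendsto_add[OF y(2) tendsto_const[of "r k"]] by simp
      show "\<exists>N. \<forall>m\<ge>N. L2_dist \<mu> y (x k) \<le> L2_dist \<mu> (x m) y + r k"
      proof (intro exI allI impI)
        fix m assume "k \<le> m"
        then show "L2_dist \<mu> y (x k) \<le> L2_dist \<mu> (x m) y + r k"
          using L2.nrm_diff_triangle[OF y(1) x x, of k m] close[of k m] L2.nrm_diff_commute[OF y(1) x, of m]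
          by linarith
      qed
    qed
    obtain B where B: "\<And>n. L2_norm \<mu> (S n y) \<le> B" using pointwise[OF y(1)] by blast
    obtain k where "B < real k" using reals_Archimedean2 by blast
    obtain n where n: "\<forall>z\<in>L2 \<mu>. L2_norm \<mu> (\<lambda>p. z p - x (Suc k) p) \<le> r (Suc k) \<longrightarrow> real k \<le> L2_norm \<mu> (S n z)"
      using big[of k] by (elim exE) (rule that)
    have "real k \<le> L2_norm \<mu> (S n y)"
      using bspec[OF n y(1)] y_close[of "Suc k"] by (rule mp)
    then show False using B[of n] \<open>B < real k\<close> by linarith
  qed
  then obtain x r K where x: "x \<in> L2 \<mu>" "r > 0"
    and K: "\<And>z n. z \<in> L2 \<mu> \<Longrightarrow> L2_dist \<mu> z x \<le> r \<Longrightarrow> L2_norm \<mu> (S n z) \<le> K"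
    by blast
  have "L2_norm \<mu> (S n u) \<le> (2 * K / r) * L2_norm \<mu> u" if u: "u \<in> L2 \<mu>" for n u
  proof (cases "L2_norm \<mu> u = 0")
    case True
    obtain C where "L2_norm \<mu> (S n u) \<le> C * L2_norm \<mu> u"
      using L2_operator_bound[OF S] u by blast
    then show ?thesis using True by simp
  next
    case False
    then have pos: "L2_norm \<mu> u > 0" using L2.nrm_nonneg[OF u] by simp
    \<comment> \<open>The multiple s u has length r, so x + s u stays in the good ball. Then s |S n
      u| is the distance of two images of norm at most K, whence the constant 2 K / r.\<close>
    define s where "s = r / L2_norm \<mu> u"
    have s: "s > 0" using pos x by (simp add: s_def)
    define z where "z p = x p + s * u p" for p
    have z: "z \<in> L2 \<mu>" using x u unfolding z_def by (simp add: L2.mem)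
    have "L2_dist \<mu> z x = s * L2_norm \<mu> u"
      using L2.nrm_scale[OF u, of s] s by (simp add: z_def)
    then have "L2_dist \<mu> z x \<le> r" using pos by (simp add: s_def)
    then have "L2_norm \<mu> (S n z) \<le> K" "L2_norm \<mu> (S n x) \<le> K"
      using K[OF z] K[OF x(1)] x(2) L2.nrm_zero[of \<mu>] by (auto simp: less_imp_le)
    moreover have "s * L2_norm \<mu> (S n u) = L2_dist \<mu> (S n z) (S n x)"
    proof -
      have "s * L2_norm \<mu> (S n u) = L2_norm \<mu> (\<lambda>p. s * S n u p)"
        using L2.nrm_scale[OF L2_operator_mem[OF S u], of s n] s by simp
      also have "\<dots> = L2_norm \<mu> (S n (\<lambda>p. s * u p))"
        by (rule L2_norm_cong_AE)
           (use eventually_mono[OF L2_operator_scale[OF S u, of n s]] u in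
             \<open>auto simp: L2.mem L2_operator_mem[OF S] L2_measurable\<close>)
      also have "\<dots> = L2_dist \<mu> (S n z) (S n x)"
        using L2_operator_norm_diff[OF S z x(1)] by (simp add: z_def)
      finally show ?thesis .
    qed
    moreover have "L2_dist \<mu> (S n z) (S n x) \<le> L2_norm \<mu> (S n z) + L2_norm \<mu> (S n x)"
      using L2.nrm_triangle[of "S n z" \<mu> "\<lambda>p. - S n x p"] L2.nrm_minus[of "S n x" \<mu>] z x(1)
      by (simp add: L2_operator_mem[OF S] L2.mem)
    ultimately have "s * L2_norm \<mu> (S n u) \<le> 2 * K" by linarith
    then show ?thesis using s pos x(2) by (simp add: s_def field_simps)
  qed
  then show ?thesis by blast
qed

section \<open>Local bounds and continuity of orbits\<close>

context
  fixes \<mu> :: "'a measure" and T :: "real \<Rightarrow> ('a \<Rightarrow> real) \<Rightarrow> 'a \<Rightarrow> real"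
  assumes C0: "C0_semigroup \<mu> T"
begin

lemma C0_operator: "t \<ge> 0 \<Longrightarrow> bounded_L2_operator \<mu> (T t)"
  using C0 by (simp add: C0_semigroup_def)

lemma C0_mem: "t \<ge> 0 \<Longrightarrow> u \<in> L2 \<mu> \<Longrightarrow> T t u \<in> L2 \<mu>"
  by (rule L2_operator_mem[OF C0_operator])

lemma C0_0: "u \<in> L2 \<mu> \<Longrightarrow> AE p in \<mu>. T 0 u p = u p"
  using C0 by (simp add: C0_semigroup_def)

lemma C0_add: "s \<ge> 0 \<Longrightarrow> t \<ge> 0 \<Longrightarrow> u \<in> L2 \<mu> \<Longrightarrow> AE p in \<mu>. T (s + t) u p = T s (T t u) p"
  using C0 by (simp add: C0_semigroup_def)

text \<open>The limit in the definition excludes the time 0, where \<open>T 0 u\<close> and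
  \<open>u\<close> agree only almost everywhere. Including that time gives a closed interval, which
  suits the later estimates.\<close>

lemma C0_right_continuous:
  assumes u: "u \<in> L2 \<mu>" and "e > 0"
  shows "\<exists>d>0. \<forall>s\<in>{0..d}. L2_dist \<mu> (T s u) u < e"
proof -
  have "((\<lambda>t. L2_dist \<mu> (T t u) u) \<longlongrightarrow> 0) (at_right 0)"
    using C0 u by (simp add: C0_semigroup_def)
  from order_tendstoD(2)[OF this \<open>e > 0\<close>]
  obtain b where b: "b > 0" "\<And>s. 0 < s \<Longrightarrow> s < b \<Longrightarrow> L2_dist \<mu> (T s u) u < e"
    by (auto simp: eventually_at_right_field)
  have "L2_dist \<mu> (T 0 u) u = L2_norm \<mu> (\<lambda>p. 0)"
    by (rule L2_norm_cong_AE)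
       (use C0_0[OF u] L2_measurable[OF C0_mem[OF _ u], of 0] L2_measurable[OF u] in auto)
  then have 0: "L2_dist \<mu> (T 0 u) u < e" using \<open>e > 0\<close> by (simp add: L2.nrm_zero)
  have "L2_dist \<mu> (T s u) u < e" if "s \<in> {0..b/2}" for s
  proof (cases "s = 0")
    case False
    then show ?thesis using b that by auto
  qed (use 0 in simp)
  then show ?thesis using b(1) by (intro exI[of _ "b/2"]) auto
qed

text \<open>Otherwise there are times t_n tending to 0 at which the n-th operator violates the bound
  with constant n. Strong continuity bounds each sequence T (t_n) u, so the uniform boundedness
  principle is contradicted.\<close>

lemma C0_bounded_near_0:
  "\<exists>d>0. \<exists>M. \<forall>t\<in>{0..d}. \<forall>u\<in>L2 \<mu>. L2_norm \<mu> (T t u) \<le> M * L2_norm \<mu> u"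
proof (rule ccontr)
  assume neg: "\<not> ?thesis"
  have "\<exists>t\<in>{0..1 / Suc n}. \<exists>u\<in>L2 \<mu>. real n * L2_norm \<mu> u < L2_norm \<mu> (T t u)" for n
  proof -
    have "(0::real) < 1 / Suc n" by simp
    then have "\<not> (\<forall>t\<in>{0..1 / Suc n}. \<forall>u\<in>L2 \<mu>. L2_norm \<mu> (T t u) \<le> real n * L2_norm \<mu> u)"
      using neg by blast
    then show ?thesis by (auto simp: not_le)
  qed
  then obtain t where t: "\<And>n. t n \<in> {0..1 / Suc n}"
    and big: "\<And>n. \<exists>u\<in>L2 \<mu>. real n * L2_norm \<mu> u < L2_norm \<mu> (T (t n) u)"
    by metis
  have "\<exists>B. \<forall>n. \<forall>u\<in>L2 \<mu>. L2_norm \<mu> (T (t n) u) \<le> B * L2_norm \<mu> u"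
  proof (rule L2_uniform_boundedness)
    show "bounded_L2_operator \<mu> (T (t n))" for n using t by (intro C0_operator) auto
    show "\<exists>B. \<forall>n. L2_norm \<mu> (T (t n) u) \<le> B" if u: "u \<in> L2 \<mu>" for u
    proof -
      have Tu: "T (t n) u \<in> L2 \<mu>" for n using t u by (intro C0_mem) auto
      have "(\<lambda>n. L2_norm \<mu> (\<lambda>p. T (t n) u p - u p)) \<longlonglongrightarrow> 0"
      proof (rule LIMSEQ_I)
        fix e :: real assume "e > 0"
        then obtain d where d: "d > 0" "\<And>s. s \<in> {0..d} \<Longrightarrow> L2_dist \<mu> (T s u) u < e"
          using C0_right_continuous[OF u] by blast
        obtain n0 where "1 / d < real n0" using reals_Archimedean2 by blast
        then have n0: "1 / Suc n \<le> d" if "n \<ge> n0" for n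
          using d(1) that by (simp add: field_simps) (smt (verit) mult_left_mono of_nat_mono)
        have "norm (L2_norm \<mu> (\<lambda>p. T (t n) u p - u p) - 0) < e" if "n \<ge> n0" for n
          using d(2)[of "t n"] t[of n] n0[OF that] L2.nrm_nonneg[OF L2.diff_mem[OF Tu u], of n] by auto
        then show "\<exists>n0. \<forall>n\<ge>n0. norm (L2_norm \<mu> (\<lambda>p. T (t n) u p - u p) - 0) < e" by blast
      qed
      then have "Bseq (\<lambda>n. L2_norm \<mu> (\<lambda>p. T (t n) u p - u p))"
        by (intro convergent_imp_Bseq convergentI)
      then obtain K where K: "\<And>n. norm (L2_norm \<mu> (\<lambda>p. T (t n) u p - u p)) \<le> K"
        by (auto simp: Bseq_def)
      have "L2_norm \<mu> (T (t n) u) \<le> L2_norm \<mu> u + K" for n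
        using L2.nrm_le_add_diff[OF Tu u, of n] K[of n] by simp
      then show ?thesis by blast
    qed
  qed
  then obtain B where B: "\<And>n u. u \<in> L2 \<mu> \<Longrightarrow> L2_norm \<mu> (T (t n) u) \<le> B * L2_norm \<mu> u" by blast
  obtain n where n: "B < real n" using reals_Archimedean2 by blast
  obtain u where u: "u \<in> L2 \<mu>" "real n * L2_norm \<mu> u < L2_norm \<mu> (T (t n) u)" using big by blast
  have "B * L2_norm \<mu> u \<le> real n * L2_norm \<mu> u"
    using n by (intro mult_right_mono L2.nrm_nonneg u(1)) simp
  then show False using B[OF u(1), of n] u(2) by linarith
qed

lemma C0_norm_add:
  assumes "s \<ge> 0" "t \<ge> 0" "u \<in> L2 \<mu>"
  shows "L2_norm \<mu> (T (s + t) u) = L2_norm \<mu> (T s (T t u))"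
  by (rule L2_norm_cong_AE)
     (use C0_add[OF assms] assms in \<open>auto intro!: L2_measurable C0_mem\<close>)

lemma C0_locally_bounded:
  "\<exists>M\<ge>0. \<forall>t\<in>{0..\<tau>}. \<forall>u\<in>L2 \<mu>. L2_norm \<mu> (T t u) \<le> M * L2_norm \<mu> u"
proof -
  obtain d M0 where d: "d > 0"
    and M0: "\<And>t u. t \<in> {0..d} \<Longrightarrow> u \<in> L2 \<mu> \<Longrightarrow> L2_norm \<mu> (T t u) \<le> M0 * L2_norm \<mu> u"
    using C0_bounded_near_0 by blast
  \<comment> \<open>At least 1, so that the bounds \<open>M ^ Suc k\<close> increase with
    \<open>k\<close> as the time interval is extended by steps of length \<open>d\<close>.\<close>
  define M where "M = max 1 M0"
  have M: "L2_norm \<mu> (T t u) \<le> M * L2_norm \<mu> u" if "t \<in> {0..d}" "u \<in> L2 \<mu>" for t u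
    using M0[OF that] mult_right_mono[OF max.cobounded2[of M0 1] L2.nrm_nonneg[OF that(2)]]
    by (simp add: M_def)
  have M1: "M \<ge> 1" by (simp add: M_def)
  have "\<forall>t\<in>{0..real k * d}. \<forall>u\<in>L2 \<mu>. L2_norm \<mu> (T t u) \<le> M ^ Suc k * L2_norm \<mu> u" for k
  proof (induction k)
    case 0
    then show ?case using M d by auto
  next
    case (Suc k)
    show ?case
    proof (intro ballI)
      fix t u assume t: "t \<in> {0..real (Suc k) * d}" and u: "u \<in> L2 \<mu>"
      show "L2_norm \<mu> (T t u) \<le> M ^ Suc (Suc k) * L2_norm \<mu> u"
      proof (cases "t \<le> d")
        case True
        have "M * 1 \<le> M * M ^ Suc k"
          using M1 one_le_power[OF M1, of "Suc k"] by (intro mult_left_mono) auto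
        then have "M * L2_norm \<mu> u \<le> M ^ Suc (Suc k) * L2_norm \<mu> u"
          by (intro mult_right_mono L2.nrm_nonneg u) simp
        then show ?thesis using M[of t u] True t u by auto
      next
        case False
        then have s: "t - d \<in> {0..real k * d}" using t by (auto simp: distrib_right)
        have "L2_norm \<mu> (T t u) = L2_norm \<mu> (T d (T (t - d) u))"
          using C0_norm_add[of d "t - d" u] s d u by auto
        also have "\<dots> \<le> M * L2_norm \<mu> (T (t - d) u)"
          using s d u by (intro M C0_mem) auto
        also have "\<dots> \<le> M * (M ^ Suc k * L2_norm \<mu> u)"
          using Suc.IH s u M1 by (intro mult_left_mono) auto
        finally show ?thesis by (simp add: mult.assoc)
      qed
    qed
  qed
  moreover obtain k :: nat where "\<tau> / d < real k" using reals_Archimedean2 by blast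
  moreover from this have "t \<le> real k * d" if "t \<le> \<tau>" for t
    using d that by (simp add: field_simps)
  ultimately have "\<forall>t\<in>{0..\<tau>}. \<forall>u\<in>L2 \<mu>. L2_norm \<mu> (T t u) \<le> M ^ Suc k * L2_norm \<mu> u"
    by auto
  then show ?thesis using M1 by (intro exI[of _ "M ^ Suc k"]) auto
qed

text \<open>For s <= t the semigroup law writes the difference as T s applied to T (t - s) u - u. A
  local bound on T s thus carries right continuity at 0 to all times, from both sides.\<close>

lemma C0_uniformly_continuous:
  assumes u: "u \<in> L2 \<mu>" and "e > 0"
  shows "\<exists>d>0. \<forall>s\<in>{0..\<tau>}. \<forall>t\<in>{0..\<tau>}. \<bar>t - s\<bar> \<le> d \<longrightarrow> L2_dist \<mu> (T t u) (T s u) < e"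
proof -
  obtain M where M: "M \<ge> 0" "\<And>t u. t \<in> {0..\<tau>} \<Longrightarrow> u \<in> L2 \<mu> \<Longrightarrow> L2_norm \<mu> (T t u) \<le> M * L2_norm \<mu> u"
    using C0_locally_bounded by blast
  obtain d where d: "d > 0" "\<And>s. s \<in> {0..d} \<Longrightarrow> L2_dist \<mu> (T s u) u < e / (M + 1)"
    using C0_right_continuous[OF u, of "e / (M + 1)"] M(1) \<open>e > 0\<close> by auto
  have *: "L2_dist \<mu> (T t u) (T s u) < e" if "s \<in> {0..\<tau>}" "s \<le> t" "t - s \<le> d" for s t
  proof -
    have s: "0 \<le> s" "0 \<le> t - s" "0 \<le> t" using that by auto
    have "L2_dist \<mu> (T t u) (T s u) = L2_norm \<mu> (\<lambda>p. T s (T (t - s) u) p - T s u p)"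
      by (rule L2_norm_cong_AE)
         (use C0_add[OF s(1,2) u] s u in \<open>auto intro!: L2_measurable L2.mem C0_mem\<close>)
    also have "\<dots> = L2_norm \<mu> (T s (\<lambda>p. T (t - s) u p - u p))"
      by (rule L2_operator_norm_diff[OF C0_operator[OF s(1)] C0_mem[OF s(2) u] u])
    also have "\<dots> \<le> M * L2_norm \<mu> (\<lambda>p. T (t - s) u p - u p)"
      using that by (intro M L2.mem C0_mem s u) auto
    also have "\<dots> \<le> M * (e / (M + 1))"
      using d(2)[of "t - s"] that M(1) by (intro mult_left_mono) auto
    also have "\<dots> < e" using M(1) \<open>e > 0\<close> by (simp add: field_simps)
    finally show ?thesis .
  qed
  have "L2_dist \<mu> (T t u) (T s u) < e" if "s \<in> {0..\<tau>}" "t \<in> {0..\<tau>}" "\<bar>t - s\<bar> \<le> d" for s t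
  proof (cases "s \<le> t")
    case False
    have "L2_dist \<mu> (T t u) (T s u) = L2_dist \<mu> (T s u) (T t u)"
      using that by (intro L2.nrm_diff_commute C0_mem u) auto
    then show ?thesis using *[of t s] that False by auto
  qed (use * that in auto)
  then show ?thesis using d(1) by blast
qed

lemma continuous_on_L2_inner_orbit:
  assumes u: "u \<in> L2 \<mu>" and v: "v \<in> L2 \<mu>"
  shows "continuous_on {0..\<tau>} (\<lambda>s. L2_inner \<mu> (T s u) v)"
  unfolding continuous_on_iff
proof (intro ballI allI impI)
  fix s e :: real assume s: "s \<in> {0..\<tau>}" and "e > 0"
  define e' where "e' = e / (L2_norm \<mu> v + 1)"
  have v0: "L2_norm \<mu> v \<ge> 0" by (rule L2.nrm_nonneg[OF v])
  then have "e' > 0" using \<open>e > 0\<close> by (simp add: e'_def)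
  then obtain d where d: "d > 0"
    "\<And>s t. s \<in> {0..\<tau>} \<Longrightarrow> t \<in> {0..\<tau>} \<Longrightarrow> \<bar>t - s\<bar> \<le> d \<Longrightarrow> L2_dist \<mu> (T t u) (T s u) < e'"
    using C0_uniformly_continuous[OF u, of e' \<tau>] by blast
  have "dist (L2_inner \<mu> (T t u) v) (L2_inner \<mu> (T s u) v) < e" if t: "t \<in> {0..\<tau>}" "dist t s < d" for t
  proof -
    have m: "T t u \<in> L2 \<mu>" "T s u \<in> L2 \<mu>" using s t by (auto intro!: C0_mem u)
    have "dist (L2_inner \<mu> (T t u) v) (L2_inner \<mu> (T s u) v) = \<bar>L2_inner \<mu> (\<lambda>p. T t u p - T s u p) v\<bar>"
      using m v by (simp add: L2.diff_left dist_real_def)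
    also have "\<dots> \<le> L2_dist \<mu> (T t u) (T s u) * L2_norm \<mu> v"
      using m v by (intro L2.Cauchy_Schwarz L2.mem)
    also have "\<dots> \<le> e' * L2_norm \<mu> v"
      using d(2)[OF s t(1)] t(2) v0 by (intro mult_right_mono) (auto simp: dist_real_def)
    also have "\<dots> < e" using \<open>e > 0\<close> v0 by (simp add: e'_def field_simps)
    finally show ?thesis .
  qed
  then show "\<exists>d>0. \<forall>t\<in>{0..\<tau>}. dist t s < d \<longrightarrow> dist (L2_inner \<mu> (T t u) v) (L2_inner \<mu> (T s u) v) < e"
    using d(1) by blast
qed

text \<open>T t commutes with difference quotients and is bounded. The dissipativity inequality,
  stated for pairs in the generator, thereby applies at every time of an orbit that starts in the
  domain.\<close>

lemma generator_invariant:
  assumes xf: "(x, f) \<in> generator \<mu> T" and t: "t \<ge> 0"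
  shows "(T t x, T t f) \<in> generator \<mu> T"
proof -
  have x: "x \<in> L2 \<mu>" and f: "f \<in> L2 \<mu>"
    and lim: "((\<lambda>h. L2_norm \<mu> (\<lambda>p. (T h x p - x p) / h - f p)) \<longlongrightarrow> 0) (at_right 0)"
    using xf by (auto simp: generator_def)
  obtain C where C: "C \<ge> 0" "\<And>u. u \<in> L2 \<mu> \<Longrightarrow> L2_norm \<mu> (T t u) \<le> C * L2_norm \<mu> u"
    using L2_operator_bound[OF C0_operator[OF t]] by blast
  have le: "L2_norm \<mu> (\<lambda>p. (T h (T t x) p - T t x p) / h - T t f p)
      \<le> C * L2_norm \<mu> (\<lambda>p. (T h x p - x p) / h - f p)" if "h > 0" for h
  proof -
    have h: "h \<ge> 0" using that by simp
    note S = C0_operator[OF t]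
    define D where "D p = (1 / h) * (T h x p - x p)" for p
    have d: "(\<lambda>p. T h x p - x p) \<in> L2 \<mu>" using h x by (intro L2.mem C0_mem)
    have D: "D \<in> L2 \<mu>" using L2.scale_mem[OF d, of "1 / h"] by (simp only: D_def[abs_def])
    have ae: "AE p in \<mu>. (T h (T t x) p - T t x p) / h - T t f p = T t (\<lambda>p. D p - f p) p"
      using C0_add[OF h t x] C0_add[OF t h x] L2_operator_diff[OF S D f]
        L2_operator_scale[OF S d, of "1 / h"] L2_operator_diff[OF S C0_mem[OF h x] x]
    proof eventually_elim
      case (elim p)
      then show ?case by (simp add: add.commute D_def[abs_def])
    qed
    have "L2_norm \<mu> (\<lambda>p. (T h (T t x) p - T t x p) / h - T t f p) = L2_norm \<mu> (T t (\<lambda>p. D p - f p))"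
    proof (rule L2_norm_cong_AE[OF _ _ ae])
      have [measurable]: "T h (T t x) \<in> borel_measurable \<mu>" "T t x \<in> borel_measurable \<mu>" "T t f \<in> borel_measurable \<mu>"
        using h t x f by (auto intro!: L2_measurable C0_mem)
      show "(\<lambda>p. (T h (T t x) p - T t x p) / h - T t f p) \<in> borel_measurable \<mu>" by measurable
      show "T t (\<lambda>p. D p - f p) \<in> borel_measurable \<mu>"
        using t D f by (intro L2_measurable C0_mem L2.mem)
    qed
    also have "\<dots> \<le> C * L2_dist \<mu> D f" using D f by (intro C L2.mem)
    finally show ?thesis by (simp add: D_def)
  qed
  have "((\<lambda>h. L2_norm \<mu> (\<lambda>p. (T h (T t x) p - T t x p) / h - T t f p)) \<longlongrightarrow> 0) (at_right 0)"
  proof (rule Lim_null_comparison)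
    show "\<forall>\<^sub>F h in at_right 0. norm (L2_norm \<mu> (\<lambda>p. (T h (T t x) p - T t x p) / h - T t f p))
        \<le> C * L2_norm \<mu> (\<lambda>p. (T h x p - x p) / h - f p)"
      using eventually_at_right_less[of "0::real"]
    proof eventually_elim
      case (elim h)
      have "(\<lambda>p. (1 / h) * (T h (T t x) p - T t x p) - T t f p) \<in> L2 \<mu>"
        using elim t x f by (intro L2.mem C0_mem) auto
      from L2.nrm_nonneg[OF this] show ?case using le[OF elim] by simp
    qed
    show "((\<lambda>h. C * L2_norm \<mu> (\<lambda>p. (T h x p - x p) / h - f p)) \<longlongrightarrow> 0) (at_right 0)"
      using tendsto_mult_right_zero[OF lim] .
  qed
  then show ?thesis using x f t by (auto simp: generator_def intro: C0_mem)
qed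

end

section \<open>Weak averages of orbits and density of the domain\<close>

lemma integral_near_const:
  fixes k :: "real \<Rightarrow> real"
  assumes "continuous_on {a..b} k" "a \<le> b" "\<And>s. s \<in> {a..b} \<Longrightarrow> \<bar>k s - c\<bar> \<le> B"
  shows "\<bar>integral {a..b} k - (b - a) * c\<bar> \<le> B * (b - a)"
proof -
  have "norm (integral {a..b} (\<lambda>s. k s - c)) \<le> B * (b - a)"
    using assms by (intro integral_bound continuous_intros) auto
  moreover have "integral {a..b} (\<lambda>s. k s - c) = integral {a..b} k - (b - a) * c"
    using assms by (simp add: Henstock_Kurzweil_Integration.integral_diff integrable_continuous_interval)
  ultimately show ?thesis by simp
qed

text \<open>Converts weak estimates into norm estimates: a bound for inner products with arbitrary
  test vectors is used with the error itself as test vector.\<close>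

lemma L2_norm_le_if_inner_le:
  assumes "w \<in> L2 \<mu>" "L2_inner \<mu> w w \<le> B * L2_norm \<mu> w" "B \<ge> 0"
  shows "L2_norm \<mu> w \<le> B"
proof (rule ccontr)
  assume "\<not> L2_norm \<mu> w \<le> B"
  then have "L2_norm \<mu> w > B" by simp
  moreover from this have "L2_norm \<mu> w > 0" using assms(3) by simp
  ultimately have "B * L2_norm \<mu> w < L2_norm \<mu> w * L2_norm \<mu> w" by simp
  then show False using assms(2) L2.nrm_square[OF assms(1)] by (simp add: power2_eq_square)
qed

text \<open>The average of an orbit is known only through its inner products. To describe its image
  under \<open>T t\<close>, the operator has to be moved onto the test vector.\<close>

lemma L2_operator_adjoint:
  assumes S: "bounded_L2_operator \<mu> S" and v: "v \<in> L2 \<mu>"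
  shows "\<exists>w\<in>L2 \<mu>. \<forall>x\<in>L2 \<mu>. L2_inner \<mu> w x = L2_inner \<mu> (S x) v"
proof -
  obtain C where C: "C \<ge> 0" "\<And>u. u \<in> L2 \<mu> \<Longrightarrow> L2_norm \<mu> (S u) \<le> C * L2_norm \<mu> u"
    using L2_operator_bound[OF S] by blast
  show ?thesis
  proof (rule L2_Riesz)
    fix x y assume x: "x \<in> L2 \<mu>" and y: "y \<in> L2 \<mu>"
    have "L2_inner \<mu> (S (\<lambda>p. x p + y p)) v = L2_inner \<mu> (\<lambda>p. S x p + S y p) v"
      using L2_operator_add[OF S x y] x y v
      by (intro L2_inner_cong_AE) (auto intro!: L2_operator_mem[OF S] L2.add_mem)
    then show "L2_inner \<mu> (S (\<lambda>p. x p + y p)) v = L2_inner \<mu> (S x) v + L2_inner \<mu> (S y) v"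
      using x y v by (simp add: L2.add_left L2_operator_mem[OF S])
  next
    fix r x assume x: "x \<in> L2 \<mu>"
    have "L2_inner \<mu> (S (\<lambda>p. r * x p)) v = L2_inner \<mu> (\<lambda>p. r * S x p) v"
      using L2_operator_scale[OF S x] x v
      by (intro L2_inner_cong_AE) (auto intro!: L2_operator_mem[OF S] L2.scale_mem)
    then show "L2_inner \<mu> (S (\<lambda>p. r * x p)) v = r * L2_inner \<mu> (S x) v"
      using x v by (simp add: L2.scale_left L2_operator_mem[OF S])
  next
    fix x assume x: "x \<in> L2 \<mu>"
    have "\<bar>L2_inner \<mu> (S x) v\<bar> \<le> L2_norm \<mu> (S x) * L2_norm \<mu> v"
      by (intro L2.Cauchy_Schwarz L2_operator_mem[OF S] x v)
    also have "\<dots> \<le> (C * L2_norm \<mu> x) * L2_norm \<mu> v"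
      by (intro mult_right_mono C x L2.nrm_nonneg v)
    finally show "\<bar>L2_inner \<mu> (S x) v\<bar> \<le> (C * L2_norm \<mu> v) * L2_norm \<mu> x"
      by (simp add: mult.commute mult.left_commute)
  qed
qed

context
  fixes \<mu> :: "'a measure" and T :: "real \<Rightarrow> ('a \<Rightarrow> real) \<Rightarrow> 'a \<Rightarrow> real"
  assumes C0: "C0_semigroup \<mu> T"
begin

text \<open>The Riesz representation theorem gives a weak integral of the orbit, which makes a
  vector-valued integration theory unnecessary.\<close>

lemma orbit_average:
  assumes u: "u \<in> L2 \<mu>" and h: "h > 0"
  shows "\<exists>U\<in>L2 \<mu>. \<forall>v\<in>L2 \<mu>. L2_inner \<mu> U v = integral {0..h} (\<lambda>s. L2_inner \<mu> (T s u) v) / h"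
proof -
  obtain M where M: "M \<ge> 0" "\<And>t u. t \<in> {0..h} \<Longrightarrow> u \<in> L2 \<mu> \<Longrightarrow> L2_norm \<mu> (T t u) \<le> M * L2_norm \<mu> u"
    using C0_locally_bounded[OF C0] by blast
  have cont: "continuous_on {0..h} (\<lambda>s. L2_inner \<mu> (T s u) v)" if "v \<in> L2 \<mu>" for v
    using continuous_on_L2_inner_orbit[OF C0 u that] .
  have Tu: "T s u \<in> L2 \<mu>" if "s \<in> {0..h}" for s using that by (intro C0_mem[OF C0] u) auto
  show ?thesis
  proof (rule L2_Riesz)
    fix v w assume v: "v \<in> L2 \<mu>" and w: "w \<in> L2 \<mu>"
    have "integral {0..h} (\<lambda>s. L2_inner \<mu> (T s u) (\<lambda>p. v p + w p))
        = integral {0..h} (\<lambda>s. L2_inner \<mu> (T s u) v + L2_inner \<mu> (T s u) w)"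
      using Tu v w by (intro Henstock_Kurzweil_Integration.integral_cong) (simp add: L2.add_right)
    also have "\<dots> = integral {0..h} (\<lambda>s. L2_inner \<mu> (T s u) v) + integral {0..h} (\<lambda>s. L2_inner \<mu> (T s u) w)"
      using v w by (intro Henstock_Kurzweil_Integration.integral_add integrable_continuous_interval cont)
    finally show "integral {0..h} (\<lambda>s. L2_inner \<mu> (T s u) (\<lambda>p. v p + w p)) / h
        = integral {0..h} (\<lambda>s. L2_inner \<mu> (T s u) v) / h + integral {0..h} (\<lambda>s. L2_inner \<mu> (T s u) w) / h"
      by (simp add: add_divide_distrib)
  next
    fix r v assume v: "v \<in> L2 \<mu>"
    have "integral {0..h} (\<lambda>s. L2_inner \<mu> (T s u) (\<lambda>p. r * v p))
        = integral {0..h} (\<lambda>s. r * L2_inner \<mu> (T s u) v)"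
      using Tu v by (intro Henstock_Kurzweil_Integration.integral_cong) (simp add: L2.scale_right)
    then show "integral {0..h} (\<lambda>s. L2_inner \<mu> (T s u) (\<lambda>p. r * v p)) / h
        = r * (integral {0..h} (\<lambda>s. L2_inner \<mu> (T s u) v) / h)"
      by simp
  next
    fix v assume v: "v \<in> L2 \<mu>"
    have "\<bar>L2_inner \<mu> (T s u) v\<bar> \<le> M * L2_norm \<mu> u * L2_norm \<mu> v" if s: "s \<in> {0..h}" for s
      by (rule order_trans[OF L2.Cauchy_Schwarz[OF Tu[OF s] v]])
         (intro mult_right_mono M s u L2.nrm_nonneg v)
    then have "\<bar>integral {0..h} (\<lambda>s. L2_inner \<mu> (T s u) v)\<bar> \<le> M * L2_norm \<mu> u * L2_norm \<mu> v * h"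
      using integral_near_const[OF cont[OF v], of 0 "M * L2_norm \<mu> u * L2_norm \<mu> v"] h by simp
    then show "\<bar>integral {0..h} (\<lambda>s. L2_inner \<mu> (T s u) v) / h\<bar> \<le> M * L2_norm \<mu> u * L2_norm \<mu> v"
      using h by (simp add: field_simps)
  qed
qed

text \<open>Shifting the interval of integration by t leaves only its two ends: T t U - U is weakly
  1/h times the integral over [h, t + h] minus the integral over [0, t]. After division by t these
  tend to T h u and u by continuity of the orbit.\<close>

lemma orbit_average_in_generator:
  assumes u: "u \<in> L2 \<mu>" and h: "h > 0" and U: "U \<in> L2 \<mu>"
    and avg: "\<And>v. v \<in> L2 \<mu> \<Longrightarrow> L2_inner \<mu> U v = integral {0..h} (\<lambda>s. L2_inner \<mu> (T s u) v) / h"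
  shows "(U, \<lambda>p. (1 / h) * (T h u p - u p)) \<in> generator \<mu> T"
proof -
  let ?k = "\<lambda>v s. L2_inner \<mu> (T s u) v"
  let ?f = "\<lambda>p. (1 / h) * (T h u p - u p)"
  have Thu: "T h u \<in> L2 \<mu>" using h by (intro C0_mem[OF C0] u) simp
  have f: "?f \<in> L2 \<mu>" using Thu u by (intro L2.scale_mem L2.diff_mem)
  have cont: "continuous_on {a..b} (?k v)" if "v \<in> L2 \<mu>" "0 \<le> a" for v a b
    by (rule continuous_on_subset[OF continuous_on_L2_inner_orbit[OF C0 u that(1), of b]])
       (use that in auto)
  have TU: "L2_inner \<mu> (T t U) v = integral {t..t + h} (?k v) / h" if t: "t > 0" and v: "v \<in> L2 \<mu>" for t v
  proof -
    have t0: "t \<ge> 0" using t by simp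
    obtain w where w: "w \<in> L2 \<mu>" "\<And>x. x \<in> L2 \<mu> \<Longrightarrow> L2_inner \<mu> w x = L2_inner \<mu> (T t x) v"
      using L2_operator_adjoint[OF C0_operator[OF C0 t0] v] by blast
    have "L2_inner \<mu> (T t U) v = L2_inner \<mu> U w"
      using w(2)[OF U] L2.sym[OF U w(1)] by simp
    also have "\<dots> = integral {0..h} (?k w) / h" by (rule avg[OF w(1)])
    also have "integral {0..h} (?k w) = integral {0..h} (?k v \<circ> (+) t)"
    proof (rule Henstock_Kurzweil_Integration.integral_cong)
      fix s assume s: "s \<in> {0..h}"
      then have s0: "s \<ge> 0" by simp
      note Ts = C0_mem[OF C0 s0 u]
      have "?k w s = L2_inner \<mu> (T t (T s u)) v"
        using w(2)[OF Ts] L2.sym[OF Ts w(1)] by simp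
      also have "\<dots> = L2_inner \<mu> (T (t + s) u) v"
        using C0_add[OF C0 t0 s0 u] t0 s0 v
        by (intro L2_inner_cong_AE) (auto intro!: C0_mem[OF C0] u Ts elim: eventually_mono)
      finally show "?k w s = (?k v \<circ> (+) t) s" by simp
    qed
    also have "\<dots> = integral {t..t + h} (?k v)"
      using integral_shift_Icc_real[of 0 h "?k v" t] by (simp add: add.commute)
    finally show ?thesis .
  qed
  have split: "L2_inner \<mu> (T t U) v - L2_inner \<mu> U v = (integral {h..t + h} (?k v) - integral {0..t} (?k v)) / h"
    if t: "t > 0" and v: "v \<in> L2 \<mu>" for t v
  proof -
    have int: "?k v integrable_on {0..t + h}" using v by (intro integrable_continuous_interval cont) auto
    have "integral {0..t} (?k v) + integral {t..t + h} (?k v) = integral {0..h} (?k v) + integral {h..t + h} (?k v)"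
      using Henstock_Kurzweil_Integration.integral_combine[OF _ _ int, of t]
        Henstock_Kurzweil_Integration.integral_combine[OF _ _ int, of h] t h by simp
    then have "integral {t..t + h} (?k v) - integral {0..h} (?k v) = integral {h..t + h} (?k v) - integral {0..t} (?k v)"
      by simp
    then show ?thesis using TU[OF t v] avg[OF v] by (simp flip: diff_divide_distrib)
  qed
  have "((\<lambda>t. L2_norm \<mu> (\<lambda>p. (T t U p - U p) / t - ?f p)) \<longlongrightarrow> 0) (at_right 0)"
  proof (rule tendstoI)
    fix e :: real assume "e > 0"
    define e' where "e' = e * h / 4"
    have e': "e' > 0" using \<open>e > 0\<close> h by (simp add: e'_def)
    \<comment> \<open>As t < h below, every time up to t + h lies in [0, 2 h]. Each end of the
      interval contributes an error e' t |W|, and dividing the total by t h gives (e / 2) |W|, which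
      explains e h / 4.\<close>
    obtain d where d: "d > 0" "\<And>s t. s \<in> {0..2 * h} \<Longrightarrow> t \<in> {0..2 * h} \<Longrightarrow> \<bar>t - s\<bar> \<le> d \<Longrightarrow>
        L2_dist \<mu> (T t u) (T s u) < e'"
      using C0_uniformly_continuous[OF C0 u e'] by blast
    have "L2_norm \<mu> (\<lambda>p. (T t U p - U p) / t - ?f p) < e" if t: "0 < t" "t < min d h" for t
    proof -
      have t0: "t \<ge> 0" using t by simp
      \<comment> \<open>The error of the difference quotient, used as its own test vector. The
        modulus of continuity of the orbit does not depend on it, so the weak estimate becomes one
        in norm.\<close>
      define W where "W p = (1 / t) * (T t U p - U p) - ?f p" for p
      have W: "W \<in> L2 \<mu>" unfolding W_def[abs_def]
        by (intro L2.diff_mem[OF L2.scale_mem f] L2.diff_mem C0_mem[OF C0 t0] U)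
      have k_close: "\<bar>?k W s - ?k W r\<bar> \<le> e' * L2_norm \<mu> W" if "r \<in> {0..2 * h}" "s \<in> {0..2 * h}" "\<bar>s - r\<bar> \<le> d" for r s
      proof -
        have m: "T s u \<in> L2 \<mu>" "T r u \<in> L2 \<mu>" using that by (auto intro!: C0_mem[OF C0] u)
        have "\<bar>?k W s - ?k W r\<bar> = \<bar>L2_inner \<mu> (\<lambda>p. T s u p - T r u p) W\<bar>"
          using m W by (simp add: L2.diff_left)
        also have "\<dots> \<le> L2_dist \<mu> (T s u) (T r u) * L2_norm \<mu> W"
          by (intro L2.Cauchy_Schwarz L2.diff_mem m W)
        also have "\<dots> \<le> e' * L2_norm \<mu> W"
          using d(2)[OF that] by (intro mult_right_mono L2.nrm_nonneg W) simp
        finally show ?thesis .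
      qed
      have "\<bar>integral {h..t + h} (?k W) - (t + h - h) * ?k W h\<bar> \<le> e' * L2_norm \<mu> W * (t + h - h)"
        by (rule integral_near_const) (use t h W in \<open>auto intro!: cont k_close\<close>)
      moreover have "\<bar>integral {0..t} (?k W) - (t - 0) * ?k W 0\<bar> \<le> e' * L2_norm \<mu> W * (t - 0)"
        by (rule integral_near_const) (use t h W in \<open>auto intro!: cont k_close\<close>)
      ultimately have near: "\<bar>(integral {h..t + h} (?k W) - integral {0..t} (?k W)) - t * (?k W h - ?k W 0)\<bar>
          \<le> 2 * e' * L2_norm \<mu> W * t"
        by (simp add: right_diff_distrib)
      have k0: "?k W 0 = L2_inner \<mu> u W"
        by (rule L2_inner_cong_AE) (use C0_0[OF C0 u] W u in \<open>auto intro: C0_mem[OF C0]\<close>)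
      have "L2_inner \<mu> W W = (1 / t) * (L2_inner \<mu> (T t U) W - L2_inner \<mu> U W) - (1 / h) * (?k W h - L2_inner \<mu> u W)"
      proof -
        have "L2_inner \<mu> W W = L2_inner \<mu> (\<lambda>p. (1 / t) * (T t U p - U p) - ?f p) W"
          by (simp only: W_def[abs_def])
        also have "\<dots> = (1 / t) * (L2_inner \<mu> (T t U) W - L2_inner \<mu> U W) - (1 / h) * (?k W h - L2_inner \<mu> u W)"
          using W U u f Thu C0_mem[OF C0 t0 U] by (simp only: L2.diff_left L2.scale_left L2.scale_mem L2.diff_mem)
        finally show ?thesis .
      qed
      also have "\<dots> = ((integral {h..t + h} (?k W) - integral {0..t} (?k W)) - t * (?k W h - ?k W 0)) / (t * h)"
        using t h split[OF t(1) W] k0 by (simp add: field_simps)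
      also have "\<dots> \<le> (2 * e' * L2_norm \<mu> W * t) / (t * h)"
        using near t h by (intro divide_right_mono) auto
      also have "\<dots> = (e / 2) * L2_norm \<mu> W"
        using t h by (simp add: e'_def field_simps)
      finally have "L2_norm \<mu> W \<le> e / 2"
        using \<open>e > 0\<close> by (intro L2_norm_le_if_inner_le W) auto
      then show ?thesis using \<open>e > 0\<close> by (simp add: W_def[abs_def])
    qed
    moreover have "L2_norm \<mu> w \<ge> 0" for w by (simp add: L2_norm_def)
    ultimately have "\<forall>\<^sub>F t in at_right 0. L2_norm \<mu> (\<lambda>p. (T t U p - U p) / t - ?f p) < e"
      using d(1) h by (subst eventually_at_right_field) (auto intro!: exI[of _ "min d h"])
    then show "\<forall>\<^sub>F t in at_right 0. dist (L2_norm \<mu> (\<lambda>p. (T t U p - U p) / t - ?f p)) 0 < e"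
      by (simp add: L2_norm_def)
  qed
  then show ?thesis using U f by (simp add: generator_def)
qed

text \<open>Over a short interval the whole orbit stays near u, hence so does its average, which
  lies in the domain.\<close>

lemma generator_dense:
  assumes u: "u \<in> L2 \<mu>" and "e > 0"
  shows "\<exists>x f. (x, f) \<in> generator \<mu> T \<and> L2_dist \<mu> x u < e"
proof -
  obtain h where h: "h > 0" "\<And>s. s \<in> {0..h} \<Longrightarrow> L2_dist \<mu> (T s u) u < e / 2"
    using C0_right_continuous[OF C0 u, of "e / 2"] \<open>e > 0\<close> by auto
  obtain U where U: "U \<in> L2 \<mu>"
    and avg: "\<And>v. v \<in> L2 \<mu> \<Longrightarrow> L2_inner \<mu> U v = integral {0..h} (\<lambda>s. L2_inner \<mu> (T s u) v) / h"
    using orbit_average[OF u h(1)] by blast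
  define W where "W p = U p - u p" for p
  have W: "W \<in> L2 \<mu>" unfolding W_def[abs_def] by (intro L2.diff_mem U u)
  have near: "\<bar>integral {0..h} (\<lambda>s. L2_inner \<mu> (T s u) W) - (h - 0) * L2_inner \<mu> u W\<bar> \<le> e / 2 * L2_norm \<mu> W * (h - 0)"
  proof (rule integral_near_const)
    fix s assume s: "s \<in> {0..h}"
    then have m: "T s u \<in> L2 \<mu>" by (intro C0_mem[OF C0] u) simp
    have "\<bar>L2_inner \<mu> (T s u) W - L2_inner \<mu> u W\<bar> = \<bar>L2_inner \<mu> (\<lambda>p. T s u p - u p) W\<bar>"
      using m u W by (simp add: L2.diff_left)
    also have "\<dots> \<le> L2_dist \<mu> (T s u) u * L2_norm \<mu> W"
      by (intro L2.Cauchy_Schwarz L2.diff_mem m u W)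
    also have "\<dots> \<le> e / 2 * L2_norm \<mu> W"
      using h(2)[OF s] by (intro mult_right_mono L2.nrm_nonneg W) simp
    finally show "\<bar>L2_inner \<mu> (T s u) W - L2_inner \<mu> u W\<bar> \<le> e / 2 * L2_norm \<mu> W" .
  qed (use h(1) continuous_on_L2_inner_orbit[OF C0 u W] in auto)
  have "L2_inner \<mu> W W = (integral {0..h} (\<lambda>s. L2_inner \<mu> (T s u) W) - h * L2_inner \<mu> u W) / h"
  proof -
    have "L2_inner \<mu> W W = L2_inner \<mu> (\<lambda>p. U p - u p) W" by (simp only: W_def[abs_def])
    also have "\<dots> = L2_inner \<mu> U W - L2_inner \<mu> u W" by (rule L2.diff_left[OF U u W])
    finally show ?thesis using avg[OF W] h(1) by (simp add: diff_divide_distrib)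
  qed
  also have "\<dots> \<le> (e / 2 * L2_norm \<mu> W * h) / h"
    using order_trans[OF abs_ge_self near] h(1) by (intro divide_right_mono) auto
  finally have "L2_inner \<mu> W W \<le> (e / 2 * L2_norm \<mu> W * h) / h" .
  then have "L2_norm \<mu> W \<le> e / 2"
    using h(1) \<open>e > 0\<close> by (intro L2_norm_le_if_inner_le W) auto
  then have "L2_norm \<mu> W < e" using \<open>e > 0\<close> by linarith
  then show ?thesis
    using orbit_average_in_generator[OF u h(1) U avg] unfolding W_def[abs_def] by blast
qed

end

section \<open>Invariance of truncation under the semigroup\<close>

text \<open>A semigroup controls only forward increments, so the hypothesis is a bound on the upper
  right derivative. Consider the last time at which \<phi> lies on or below the line of slope e
  through its initial value; before b, the growth bound would move that time further right.\<close>

lemma le_if_right_growth_le: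
  fixes \<phi> :: "real \<Rightarrow> real"
  assumes ab: "a \<le> b" and cont: "continuous_on {a..b} \<phi>"
    and dini: "\<And>t e. a \<le> t \<Longrightarrow> t < b \<Longrightarrow> e > 0 \<Longrightarrow> \<exists>d>0. \<forall>h\<in>{0<..d}. \<phi> (t + h) \<le> \<phi> t + e * h"
  shows "\<phi> b \<le> \<phi> a"
proof (rule field_le_epsilon)
  fix e0 :: real assume "e0 > 0"
  \<comment> \<open>The line rises by at most e0 over the whole interval; the summand 1 covers a =
    b.\<close>
  define e where "e = e0 / (b - a + 1)"
  have e: "e > 0" "e * (b - a) \<le> e0" using \<open>e0 > 0\<close> ab by (auto simp: e_def field_simps)
  define \<psi> where "\<psi> t = \<phi> t - \<phi> a - e * (t - a)" for t
  have cont\<psi>: "continuous_on {a..b} \<psi>" unfolding \<psi>_def by (intro continuous_intros cont)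
  define Z where "Z = {a..b} \<inter> \<psi> -` {..0}"
  have "closed Z" unfolding Z_def by (intro continuous_closed_preimage cont\<psi>) auto
  moreover have "bounded Z" by (rule bounded_subset[of "{a..b}"]) (auto simp: Z_def)
  ultimately have "compact Z" by (simp add: compact_eq_bounded_closed)
  moreover have "a \<in> Z" using ab by (simp add: Z_def \<psi>_def)
  ultimately obtain c where c: "c \<in> Z" "\<And>t. t \<in> Z \<Longrightarrow> t \<le> c"
    using compact_attains_sup[of Z] by auto
  have "c = b"
  proof (rule ccontr)
    assume "c \<noteq> b"
    then have cb: "a \<le> c" "c < b" using c(1) by (auto simp: Z_def)
    then obtain d where d: "d > 0" "\<And>h. h \<in> {0<..d} \<Longrightarrow> \<phi> (c + h) \<le> \<phi> c + e * h"
      using dini[OF cb e(1)] by blast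
    define h where "h = min d (b - c)"
    have h: "h \<in> {0<..d}" "c + h \<le> b" using d(1) cb by (auto simp: h_def)
    have "\<psi> (c + h) \<le> \<psi> c" using d(2)[OF h(1)] by (simp add: \<psi>_def algebra_simps)
    then have "c + h \<in> Z" using c(1) h cb by (auto simp: Z_def)
    then show False using c(2)[of "c + h"] h(1) by simp
  qed
  then have "\<psi> b \<le> 0" using c(1) by (simp add: Z_def)
  then show "\<phi> b \<le> \<phi> a + e0" using e(2) by (simp add: \<psi>_def)
qed

section \<open>Truncation at a level along orbits\<close>

definition excess :: "real \<Rightarrow> ('a \<Rightarrow> real) \<Rightarrow> 'a \<Rightarrow> real" where
  "excess c u p = max (u p - c) 0"

lemma excess_measurable [measurable]:
  fixes u :: "'a \<Rightarrow> real"
  assumes "u \<in> borel_measurable \<mu>"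
  shows "excess c u \<in> borel_measurable \<mu>"
  unfolding excess_def[abs_def] using assms
  by (intro borel_measurable_max borel_measurable_diff) simp_all

lemma excess_mem: "c \<ge> 0 \<Longrightarrow> u \<in> L2 \<mu> \<Longrightarrow> excess c u \<in> L2 \<mu>"
  by (rule L2_dominated) (auto simp: excess_def excess_measurable L2_measurable)

lemma excess_norm_diff_le:
  assumes "u \<in> L2 \<mu>" "v \<in> L2 \<mu>"
  shows "L2_dist \<mu> (excess c u) (excess c v) \<le> L2_dist \<mu> u v"
proof (rule L2_norm_mono)
  have [measurable]: "u \<in> borel_measurable \<mu>" "v \<in> borel_measurable \<mu>"
    using assms L2_measurable by blast+
  show "(\<lambda>p. excess c u p - excess c v p) \<in> borel_measurable \<mu>" by measurable
qed (use assms in \<open>auto simp: excess_def intro: L2.diff_mem\<close>)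

lemma excess_norm_le_add:
  assumes "c \<ge> 0" "u \<in> L2 \<mu>" "v \<in> L2 \<mu>"
  shows "L2_norm \<mu> (excess c u) \<le> L2_norm \<mu> (excess c v) + L2_dist \<mu> u v"
  using L2.nrm_le_add_diff[OF excess_mem[OF assms(1,2)] excess_mem[OF assms(1,3)]]
    excess_norm_diff_le[OF assms(2,3), of c] by linarith

lemma excess_norm_le:
  assumes "c \<ge> 0" "u \<in> L2 \<mu>"
  shows "L2_norm \<mu> (excess c u) \<le> L2_norm \<mu> u"
  by (rule L2_norm_mono) (use assms in \<open>auto simp: excess_def excess_measurable L2_measurable\<close>)

text \<open>Convexity of \<open>s \<mapsto> (max (s - c) 0)\<^sup>2\<close>.\<close>

lemma excess_square_diff_le:
  assumes c: "c \<ge> 0" and u: "u \<in> L2 \<mu>" and v: "v \<in> L2 \<mu>"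
  shows "L2_inner \<mu> (excess c v) (excess c v) - L2_inner \<mu> (excess c u) (excess c u)
    \<le> 2 * L2_inner \<mu> (excess c v) (\<lambda>p. v p - u p)"
proof -
  note m = excess_mem[OF c u] excess_mem[OF c v] L2.diff_mem[OF v u]
  have pw: "y' * y' - x' * x' \<le> 2 * (y' * (y - x))" if "x' = max (x - c) 0" "y' = max (y - c) 0"
    for x y x' y' :: real
  proof -
    have "0 \<le> (y' - x')\<^sup>2" by simp
    then have "y' * y' - x' * x' \<le> 2 * (y' * (y' - x'))" by (simp add: power2_eq_square algebra_simps)
    \<comment> \<open>If y <= c then y' = 0. Otherwise y' = y - c, and x' >= x - c gives y' - x' <=
      y - x.\<close>
    also have "y' * (y' - x') \<le> y' * (y - x)"
      using that by (cases "y \<le> c") (auto intro!: mult_left_mono)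
    finally show ?thesis by simp
  qed
  have "L2_inner \<mu> (excess c v) (excess c v) - L2_inner \<mu> (excess c u) (excess c u)
      = (LINT p|\<mu>. excess c v p * excess c v p - excess c u p * excess c u p)"
    using m by (simp add: L2_inner_def L2_integrable_mult)
  also have "\<dots> \<le> (LINT p|\<mu>. 2 * (excess c v p * (v p - u p)))"
    using m by (intro integral_mono pw[OF excess_def excess_def]) (simp_all add: L2_integrable_mult)
  finally show ?thesis by (simp add: L2_inner_def)
qed

text \<open>Convexity, with the tangent taken at the new point z = T h y, bounds the increment of
  the squared norm by 2 (E z, z - y), and z - y = h (g + R) with a small remainder R. Replacing E z
  by E y in the product with g costs little, and (E y, g) is not positive by dissipativity.\<close>

lemma excess_norm_generator_nonincreasing:
  assumes C0: "C0_semigroup \<mu> T" and c: "c \<ge> 0" and xf: "(x, f) \<in> generator \<mu> T"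
    and diss: "\<And>y g. (y, g) \<in> generator \<mu> T \<Longrightarrow> L2_inner \<mu> g (excess c y) \<le> 0"
    and \<tau>: "\<tau> \<ge> 0"
  shows "L2_norm \<mu> (excess c (T \<tau> x)) \<le> L2_norm \<mu> (excess c x)"
proof -
  let ?E = "\<lambda>u. excess c u"
  have x: "x \<in> L2 \<mu>" using xf by (simp add: generator_def)
  have Tx: "T t x \<in> L2 \<mu>" if "t \<ge> 0" for t using C0_mem[OF C0 that x] .
  define \<phi> where "\<phi> t = L2_inner \<mu> (?E (T t x)) (?E (T t x))" for t
  have \<phi>: "\<phi> t = (L2_norm \<mu> (?E (T t x)))\<^sup>2" if "t \<ge> 0" for t
    unfolding \<phi>_def by (rule L2.nrm_square[OF excess_mem[OF c Tx[OF that]], symmetric])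
  have "continuous_on {0..\<tau>} (\<lambda>t. L2_norm \<mu> (?E (T t x)))"
    unfolding continuous_on_iff
  proof (intro ballI allI impI)
    fix s e :: real assume s: "s \<in> {0..\<tau>}" and "e > 0"
    obtain d where d: "d > 0" "\<And>s t. s \<in> {0..\<tau>} \<Longrightarrow> t \<in> {0..\<tau>} \<Longrightarrow> \<bar>t - s\<bar> \<le> d \<Longrightarrow>
        L2_dist \<mu> (T t x) (T s x) < e"
      using C0_uniformly_continuous[OF C0 x \<open>e > 0\<close>] by blast
    have "dist (L2_norm \<mu> (?E (T t x))) (L2_norm \<mu> (?E (T s x))) < e" if t: "t \<in> {0..\<tau>}" "dist t s < d" for t
    proof -
      have m: "T t x \<in> L2 \<mu>" "T s x \<in> L2 \<mu>" using s t by (auto intro: Tx)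
      have "L2_dist \<mu> (T t x) (T s x) < e"
        using d(2)[OF s t(1)] t(2) by (auto simp: dist_real_def)
      then show ?thesis
        using excess_norm_le_add[OF c m] excess_norm_le_add[OF c m(2,1)] L2.nrm_diff_commute[OF m]
        by (auto simp: dist_real_def)
    qed
    then show "\<exists>d>0. \<forall>t\<in>{0..\<tau>}. dist t s < d \<longrightarrow>
        dist (L2_norm \<mu> (?E (T t x))) (L2_norm \<mu> (?E (T s x))) < e"
      using d(1) by blast
  qed
  then have "continuous_on {0..\<tau>} (\<lambda>t. (L2_norm \<mu> (?E (T t x)))\<^sup>2)" by (intro continuous_intros)
  then have cont: "continuous_on {0..\<tau>} \<phi>"
    by (rule continuous_on_eq) (simp add: \<phi>)
  have "\<phi> \<tau> \<le> \<phi> 0"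
  proof (rule le_if_right_growth_le[OF \<tau> cont])
    fix t e :: real assume t: "0 \<le> t" "t < \<tau>" and "e > 0"
    define y g where "y = T t x" and "g = T t f"
    have gen: "(y, g) \<in> generator \<mu> T" unfolding y_def g_def by (rule generator_invariant[OF C0 xf t(1)])
    then have y: "y \<in> L2 \<mu>" and g: "g \<in> L2 \<mu>"
      and lim: "((\<lambda>h. L2_norm \<mu> (\<lambda>p. (T h y p - y p) / h - g p)) \<longlongrightarrow> 0) (at_right 0)"
      by (auto simp: generator_def)
    \<comment> \<open>Collects the factors of the two errors of size \<open>\<eta>\<close>: |g| from
      replacing E z by E y, and |y| + 1, which bounds |E z|, from the remainder.\<close>
    define K where "K = L2_norm \<mu> g + L2_norm \<mu> y + 1"
    have K: "K > 0" using L2.nrm_nonneg[OF g] L2.nrm_nonneg[OF y] by (simp add: K_def)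
    define \<eta> where "\<eta> = min 1 (e / (2 * K))"
    have \<eta>: "\<eta> > 0" "\<eta> \<le> 1" "2 * (\<eta> * K) \<le> e"
      using \<open>e > 0\<close> K by (auto simp: \<eta>_def min_def field_simps)
    obtain d1 where d1: "d1 > 0" "\<And>h. h \<in> {0..d1} \<Longrightarrow> L2_dist \<mu> (T h y) y < \<eta>"
      using C0_right_continuous[OF C0 y \<eta>(1)] by blast
    obtain d2 where d2: "d2 > 0" "\<And>h. 0 < h \<Longrightarrow> h < d2 \<Longrightarrow> L2_norm \<mu> (\<lambda>p. (T h y p - y p) / h - g p) < \<eta>"
      using order_tendstoD(2)[OF lim \<eta>(1)] by (auto simp: eventually_at_right_field)
    have "\<phi> (t + h) \<le> \<phi> t + e * h" if h: "h \<in> {0<..min d1 (d2 / 2)}" for h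
    proof -
      have h0: "h > 0" "h \<ge> 0" using h by auto
      define z where "z = T h y"
      have z: "z \<in> L2 \<mu>" unfolding z_def by (rule C0_mem[OF C0 h0(2) y])
      define R where "R p = (z p - y p) / h - g p" for p
      have "R = (\<lambda>p. (1 / h) * (z p - y p) - g p)" by (auto simp: R_def)
      then have R: "R \<in> L2 \<mu>"
        using L2.diff_mem[OF L2.scale_mem[OF L2.diff_mem[OF z y], of "1 / h"] g] by (simp only:)
      have zy: "L2_dist \<mu> z y \<le> \<eta>" using d1(2)[of h] h by (simp add: z_def)
      have NR: "L2_norm \<mu> R \<le> \<eta>"
        using d2(2)[of h] h d2(1) by (simp add: z_def R_def[abs_def])
      have Ez: "?E z \<in> L2 \<mu>" and Ey: "?E y \<in> L2 \<mu>" using excess_mem[OF c] y z by auto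
      have "\<phi> (t + h) = (L2_norm \<mu> (?E (T (h + t) x)))\<^sup>2" using \<phi>[of "t + h"] t h0 by (simp add: add.commute)
      also have "L2_norm \<mu> (?E (T (h + t) x)) = L2_norm \<mu> (?E z)"
      proof (rule L2_norm_cong_AE)
        show "AE p in \<mu>. ?E (T (h + t) x) p = ?E z p"
          using C0_add[OF C0 h0(2) t(1) x] by eventually_elim (simp add: excess_def z_def y_def)
      qed (use t h0 x z Ez in \<open>auto intro!: L2_measurable excess_measurable Tx\<close>)
      also have "(L2_norm \<mu> (?E z))\<^sup>2 = L2_inner \<mu> (?E z) (?E z)" by (rule L2.nrm_square[OF Ez])
      finally have "\<phi> (t + h) - \<phi> t \<le> 2 * L2_inner \<mu> (?E z) (\<lambda>p. z p - y p)"
        using excess_square_diff_le[OF c y z] by (simp add: \<phi>_def y_def)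
      also have "(\<lambda>p. z p - y p) = (\<lambda>p. h * (g p + R p))"
        using h0 by (auto simp: R_def)
      also have "L2_inner \<mu> (?E z) (\<lambda>p. h * (g p + R p)) = h * (L2_inner \<mu> (?E z) g + L2_inner \<mu> (?E z) R)"
        using Ez g R by (simp add: L2.scale_right L2.add_right L2.add_mem)
      also have "L2_inner \<mu> (?E z) g = L2_inner \<mu> (?E y) g + L2_inner \<mu> (\<lambda>p. ?E z p - ?E y p) g"
        using Ez Ey g by (simp add: L2.diff_left)
      finally have main: "\<phi> (t + h) - \<phi> t \<le> 2 * (h * (L2_inner \<mu> (?E y) g
          + L2_inner \<mu> (\<lambda>p. ?E z p - ?E y p) g + L2_inner \<mu> (?E z) R))" .
      have "L2_inner \<mu> (?E y) g \<le> 0" using diss[OF gen] L2.sym[OF Ey g] by simp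
      moreover have "L2_inner \<mu> (\<lambda>p. ?E z p - ?E y p) g \<le> \<eta> * L2_norm \<mu> g"
      proof -
        have "L2_inner \<mu> (\<lambda>p. ?E z p - ?E y p) g \<le> L2_dist \<mu> (?E z) (?E y) * L2_norm \<mu> g"
          by (rule order_trans[OF abs_ge_self L2.Cauchy_Schwarz]) (intro L2.diff_mem Ez Ey g)+
        also have "\<dots> \<le> \<eta> * L2_norm \<mu> g"
          using excess_norm_diff_le[OF z y, of c] zy by (intro mult_right_mono L2.nrm_nonneg g) simp
        finally show ?thesis .
      qed
      moreover have "L2_inner \<mu> (?E z) R \<le> (L2_norm \<mu> y + 1) * \<eta>"
      proof -
        have "L2_inner \<mu> (?E z) R \<le> L2_norm \<mu> (?E z) * L2_norm \<mu> R"
          by (rule order_trans[OF abs_ge_self L2.Cauchy_Schwarz]) (intro Ez R)+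
        also have "\<dots> \<le> (L2_norm \<mu> y + 1) * \<eta>"
          using excess_norm_le[OF c z] L2.nrm_le_add_diff[OF z y] zy \<eta>(2) NR L2.nrm_nonneg[OF y]
          by (intro mult_mono L2.nrm_nonneg R) auto
        finally show ?thesis .
      qed
      ultimately have "L2_inner \<mu> (?E y) g + L2_inner \<mu> (\<lambda>p. ?E z p - ?E y p) g + L2_inner \<mu> (?E z) R \<le> \<eta> * K"
        by (simp add: K_def algebra_simps)
      from mult_left_mono[OF this h0(2)]
      have "\<phi> (t + h) - \<phi> t \<le> 2 * (h * (\<eta> * K))" using main by linarith
      also have "\<dots> \<le> h * e" using mult_left_mono[OF \<eta>(3) h0(2)] by (simp add: mult.left_commute)
      finally show ?thesis by (simp add: mult.commute)
    qed
    then show "\<exists>d>0. \<forall>h\<in>{0<..d}. \<phi> (t + h) \<le> \<phi> t + e * h"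
      using d1(1) d2(1) by (intro exI[of _ "min d1 (d2 / 2)"]) auto
  qed
  then have "(L2_norm \<mu> (?E (T \<tau> x)))\<^sup>2 \<le> (L2_norm \<mu> (?E (T 0 x)))\<^sup>2"
    by (simp only: \<phi>[OF \<tau>] \<phi>[OF order_refl])
  then have "L2_norm \<mu> (?E (T \<tau> x)) \<le> L2_norm \<mu> (?E (T 0 x))"
    by (rule power2_le_imp_le) (rule L2.nrm_nonneg[OF excess_mem[OF c Tx[OF order_refl]]])
  also have "\<dots> = L2_norm \<mu> (?E x)"
  proof (rule L2_norm_cong_AE)
    show "AE p in \<mu>. ?E (T 0 x) p = ?E x p"
      using C0_0[OF C0 x] by eventually_elim (simp add: excess_def)
  qed (auto intro!: L2_measurable excess_measurable Tx x)
  finally show ?thesis .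
qed

text \<open>Truncation is a contraction of L2 and T t is bounded, so the estimate extends from the
  dense domain. An approximation error counts once for u and at most C times for T t u, hence the
  tolerance e / (C + 1).\<close>

lemma excess_norm_nonincreasing:
  assumes C0: "C0_semigroup \<mu> T" and c: "c \<ge> 0" and u: "u \<in> L2 \<mu>"
    and diss: "\<And>y g. (y, g) \<in> generator \<mu> T \<Longrightarrow> L2_inner \<mu> g (excess c y) \<le> 0"
    and t: "t \<ge> 0"
  shows "L2_norm \<mu> (excess c (T t u)) \<le> L2_norm \<mu> (excess c u)"
proof (rule field_le_epsilon)
  fix e :: real assume "e > 0"
  obtain C where C: "C \<ge> 0" "\<And>u. u \<in> L2 \<mu> \<Longrightarrow> L2_norm \<mu> (T t u) \<le> C * L2_norm \<mu> u"
    using L2_operator_bound[OF C0_operator[OF C0 t]] by blast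
  have "e / (C + 1) > 0" using \<open>e > 0\<close> C(1) by simp
  then obtain x f where xf: "(x, f) \<in> generator \<mu> T" "L2_dist \<mu> x u < e / (C + 1)"
    using generator_dense[OF C0 u] by blast
  have x: "x \<in> L2 \<mu>" using xf(1) by (simp add: generator_def)
  have Tx: "T t x \<in> L2 \<mu>" and Tu: "T t u \<in> L2 \<mu>" using C0_mem[OF C0 t] x u by auto
  have ux: "L2_dist \<mu> u x < e / (C + 1)" using xf(2) L2.nrm_diff_commute[OF u x] by simp
  have "L2_norm \<mu> (excess c (T t u)) \<le> L2_norm \<mu> (excess c (T t x)) + L2_dist \<mu> (T t u) (T t x)"
    by (rule excess_norm_le_add[OF c Tu Tx])
  also have "L2_dist \<mu> (T t u) (T t x) = L2_norm \<mu> (T t (\<lambda>p. u p - x p))"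
    by (rule L2_operator_norm_diff[OF C0_operator[OF C0 t] u x])
  also have "\<dots> \<le> C * L2_dist \<mu> u x" by (intro C L2.diff_mem u x)
  also have "\<dots> \<le> C * (e / (C + 1))" using ux C(1) by (intro mult_left_mono) auto
  also have "L2_norm \<mu> (excess c (T t x)) \<le> L2_norm \<mu> (excess c x)"
    by (rule excess_norm_generator_nonincreasing[OF C0 c xf(1) diss t])
  also have "\<dots> \<le> L2_norm \<mu> (excess c u) + L2_dist \<mu> x u"
    by (rule excess_norm_le_add[OF c x u])
  finally have "L2_norm \<mu> (excess c (T t u)) \<le> L2_norm \<mu> (excess c u) + e / (C + 1) + C * (e / (C + 1))"
    using xf(2) by linarith
  also have "\<dots> = L2_norm \<mu> (excess c u) + e"
  proof -
    have "e / (C + 1) + C * (e / (C + 1)) = (1 + C) * (e / (C + 1))"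
      by (simp only: distrib_right mult_1_left)
    also have "\<dots> = e" using C(1) by (simp add: add.commute[of 1 C])
    finally show ?thesis by (simp only: add.assoc)
  qed
  finally show "L2_norm \<mu> (excess c (T t u)) \<le> L2_norm \<mu> (excess c u) + e" .
qed

theorem markovian_if_dissipative_above_levels:
  assumes C0: "C0_semigroup \<mu> T"
    and diss: "\<And>c y g. c > 0 \<Longrightarrow> (y, g) \<in> generator \<mu> T \<Longrightarrow> L2_inner \<mu> g (excess c y) \<le> 0"
  shows "markovian \<mu> T"
proof -
  have upper: "AE p in \<mu>. T t u p \<le> c"
    if t: "t \<ge> 0" and u: "u \<in> L2 \<mu>" and c: "c > 0" and le: "AE p in \<mu>. u p \<le> c" for t u c
  proof -
    have c0: "c \<ge> 0" using c by simp
    have Tu: "T t u \<in> L2 \<mu>" by (rule C0_mem[OF C0 t u])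
    have "L2_norm \<mu> (excess c u) = L2_norm \<mu> (\<lambda>p. 0)"
    proof (rule L2_norm_cong_AE)
      show "AE p in \<mu>. excess c u p = 0" using le by eventually_elim (simp add: excess_def)
    qed (use u in \<open>auto intro!: L2_measurable excess_measurable\<close>)
    moreover have "L2_norm \<mu> (excess c (T t u)) \<le> L2_norm \<mu> (excess c u)"
      by (rule excess_norm_nonincreasing[OF C0 c0 u _ t]) (rule diss[OF c])
    ultimately have "L2_norm \<mu> (excess c (T t u)) \<le> 0" by (simp only: L2.nrm_zero)
    then have "AE p in \<mu>. excess c (T t u) p = 0"
      using L2.nrm_nonneg[OF excess_mem[OF c0 Tu]] by (intro L2_norm_zero_AE excess_mem c0 Tu) simp
    then show ?thesis by eventually_elim (simp add: excess_def max_def split: if_splits)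
  qed
  have lower: "AE p in \<mu>. - c \<le> T t u p"
    if t: "t \<ge> 0" and u: "u \<in> L2 \<mu>" and c: "c > 0" and le: "AE p in \<mu>. - c \<le> u p" for t u c
  proof -
    have "AE p in \<mu>. (- 1) * u p \<le> c" using le by eventually_elim simp
    from upper[OF t L2.scale_mem[OF u] c this] L2_operator_scale[OF C0_operator[OF C0 t] u, of "- 1"]
    show ?thesis by eventually_elim simp
  qed
  have "AE p in \<mu>. 0 \<le> T t u p" if t: "t \<ge> 0" and u: "u \<in> L2 \<mu>" and pos: "AE p in \<mu>. 0 \<le> u p" for t u
  proof -
    have "AE p in \<mu>. - (1 / Suc n) \<le> T t u p" for n
    proof (rule lower[OF t u])
      show "AE p in \<mu>. - (1 / Suc n) \<le> u p"
        using pos by eventually_elim (rule order_trans[of _ 0], auto)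
    qed simp
    then have "AE p in \<mu>. \<forall>n. - (1 / Suc n) \<le> T t u p" by (simp add: AE_all_countable)
    then show ?thesis
    proof eventually_elim
      case (elim p)
      have "(\<lambda>n. - (1 / Suc n)) \<longlonglongrightarrow> - 0"
        by (intro tendsto_minus) (use LIMSEQ_inverse_real_of_nat in \<open>simp add: inverse_eq_divide\<close>)
      then show ?case using elim LIMSEQ_le_const2[of _ "- 0" "T t u p"] by auto
    qed
  qed
  moreover have "Linf_norm \<mu> (T t u) \<le> Linf_norm \<mu> u"
    if t: "t \<ge> 0" and u: "u \<in> L2 \<mu>" and fin: "Linf_norm \<mu> u < \<infinity>" for t u
  proof -
    have Tu: "T t u \<in> L2 \<mu>" by (rule C0_mem[OF C0 t u])
    have [measurable]: "T t u \<in> borel_measurable \<mu>" by (rule L2_measurable[OF Tu])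
    have AEu: "AE p in \<mu>. ereal \<bar>u p\<bar> \<le> Linf_norm \<mu> u" unfolding Linf_norm_def by (rule esssup_AE)
    show ?thesis
    \<comment> \<open>On a null space the essential supremum is minus infinity. A negative value
      means that |u p| < 0 almost everywhere, so every property holds almost everywhere.\<close>
    proof (cases "Linf_norm \<mu> u < 0")
      case True
      have "AE p in \<mu>. ereal \<bar>T t u p\<bar> \<le> Linf_norm \<mu> u"
        using AEu
      proof eventually_elim
        case (elim p)
        then have "ereal \<bar>u p\<bar> < 0" using True by (rule le_less_trans)
        then show ?case by simp
      qed
      then show ?thesis unfolding Linf_norm_def[of _ "T t u"] by (intro esssup_I) measurable
    next
      case False
      show ?thesis
      \<comment> \<open>Levels must be positive, while the norm of u may be 0; it is therefore
        approached from strictly larger levels.\<close>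
      proof (rule dense_ge)
        fix y assume y: "Linf_norm \<mu> u < y"
        show "Linf_norm \<mu> (T t u) \<le> y"
        proof (cases y)
          case (real c)
          have "c > 0" using False y real by (cases "Linf_norm \<mu> u") auto
          have "AE p in \<mu>. \<bar>u p\<bar> \<le> c"
            using AEu
          proof eventually_elim
            case (elim p)
            then have "ereal \<bar>u p\<bar> \<le> ereal c" using y real by (metis less_imp_le order_trans)
            then show ?case by simp
          qed
          then have "AE p in \<mu>. u p \<le> c" "AE p in \<mu>. - c \<le> u p"
            by (eventually_elim, simp)+
          from upper[OF t u \<open>c > 0\<close> this(1)] lower[OF t u \<open>c > 0\<close> this(2)]
          have "AE p in \<mu>. ereal \<bar>T t u p\<bar> \<le> ereal c"
            by eventually_elim simp
          then show ?thesis unfolding Linf_norm_def real by (intro esssup_I) measurable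
        qed (use y in auto)
      qed
    qed
  qed
  ultimately show ?thesis using C0 by (simp add: markovian_def)
qed

section \<open>Closure of a form\<close>

locale L2_form = psd_form D a for D :: "('a \<Rightarrow> real) set" and a +
  fixes \<mu> :: "'a measure"
  assumes D_L2: "D \<subseteq> L2 \<mu>"
begin

lemma D_L2': "u \<in> D \<Longrightarrow> u \<in> L2 \<mu>"
  using D_L2 by blast

abbreviation approx :: "(nat \<Rightarrow> 'a \<Rightarrow> real) \<Rightarrow> ('a \<Rightarrow> real) \<Rightarrow> bool" where
  "approx \<equiv> form_approx \<mu> D a"

lemma nrm_less_iff: "e > 0 \<Longrightarrow> nrm u < e \<longleftrightarrow> a u u < e\<^sup>2"
  using real_sqrt_less_iff[of "a u u" "e\<^sup>2"] by (simp add: nrm_def)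

lemma approx_iff:
  "approx us u \<longleftrightarrow> (\<forall>k. us k \<in> D) \<and> u \<in> L2 \<mu> \<and> (\<lambda>k. L2_dist \<mu> (us k) u) \<longlonglongrightarrow> 0 \<and>
    (\<forall>e>0. \<exists>N. \<forall>j\<ge>N. \<forall>k\<ge>N. nrm (\<lambda>p. us j p - us k p) < e)"
proof -
  have "(\<forall>e>0. \<exists>N. \<forall>j\<ge>N. \<forall>k\<ge>N. a (\<lambda>p. us j p - us k p) (\<lambda>p. us j p - us k p) < e)
      \<longleftrightarrow> (\<forall>e>0. \<exists>N. \<forall>j\<ge>N. \<forall>k\<ge>N. nrm (\<lambda>p. us j p - us k p) < e)" (is "?A \<longleftrightarrow> ?B")
  proof
    assume ?A
    show ?B
    proof (intro allI impI)
      fix e :: real assume "e > 0"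
      then obtain N where "\<forall>j\<ge>N. \<forall>k\<ge>N. a (\<lambda>p. us j p - us k p) (\<lambda>p. us j p - us k p) < e\<^sup>2"
        using \<open>?A\<close>[rule_format, of "e\<^sup>2"] by auto
      then show "\<exists>N. \<forall>j\<ge>N. \<forall>k\<ge>N. nrm (\<lambda>p. us j p - us k p) < e"
        using nrm_less_iff[OF \<open>e > 0\<close>] by blast
    qed
  next
    assume ?B
    show ?A
    proof (intro allI impI)
      fix e :: real assume "e > 0"
      then have s: "sqrt e > 0" by simp
      then obtain N where "\<forall>j\<ge>N. \<forall>k\<ge>N. nrm (\<lambda>p. us j p - us k p) < sqrt e"
        using \<open>?B\<close> by blast
      then show "\<exists>N. \<forall>j\<ge>N. \<forall>k\<ge>N. a (\<lambda>p. us j p - us k p) (\<lambda>p. us j p - us k p) < e"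
        using nrm_less_iff[OF s] \<open>e > 0\<close> by auto
    qed
  qed
  then show ?thesis by (auto simp: form_approx_def)
qed

lemma approx_mem: "approx us u \<Longrightarrow> us k \<in> D"
  and approx_L2: "approx us u \<Longrightarrow> u \<in> L2 \<mu>"
  and approx_norm: "approx us u \<Longrightarrow> (\<lambda>k. L2_dist \<mu> (us k) u) \<longlonglongrightarrow> 0"
  and approx_Cauchy: "approx us u \<Longrightarrow> e > 0 \<Longrightarrow> \<exists>N. \<forall>j\<ge>N. \<forall>k\<ge>N. nrm (\<lambda>p. us j p - us k p) < e"
  by (auto simp: approx_iff)

lemma approx_zero: "approx (\<lambda>_ _. 0) (\<lambda>_. 0)"
  by (auto simp: approx_iff zero_mem L2.zero_mem nrm_zero L2.nrm_zero)

lemma approx_scale_add: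
  assumes us: "approx us u" and vs: "approx vs v"
  shows "approx (\<lambda>k p. us k p + r * vs k p) (\<lambda>p. u p + r * v p)"
  unfolding approx_iff
proof (intro conjI allI impI)
  note m = approx_mem[OF us] approx_mem[OF vs] approx_L2[OF us] approx_L2[OF vs]
  show "(\<lambda>p. us k p + r * vs k p) \<in> D" for k by (intro add_mem scale_mem m)
  show "(\<lambda>p. u p + r * v p) \<in> L2 \<mu>" by (intro L2.add_mem L2.scale_mem m)
  show "(\<lambda>k. L2_norm \<mu> (\<lambda>p. us k p + r * vs k p - (u p + r * v p))) \<longlonglongrightarrow> 0"
  proof (rule Lim_null_comparison)
    show "\<forall>\<^sub>F k in sequentially. norm (L2_norm \<mu> (\<lambda>p. us k p + r * vs k p - (u p + r * v p)))
        \<le> L2_dist \<mu> (us k) u + \<bar>r\<bar> * L2_dist \<mu> (vs k) v"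
    proof (intro always_eventually allI)
      fix k
      have d: "(\<lambda>p. us k p - u p) \<in> L2 \<mu>" "(\<lambda>p. vs k p - v p) \<in> L2 \<mu>"
        by (intro L2.diff_mem D_L2' m)+
      have "(\<lambda>p. us k p + r * vs k p - (u p + r * v p)) = (\<lambda>p. (us k p - u p) + r * (vs k p - v p))"
        by (simp add: algebra_simps)
      then show "norm (L2_norm \<mu> (\<lambda>p. us k p + r * vs k p - (u p + r * v p)))
        \<le> L2_dist \<mu> (us k) u + \<bar>r\<bar> * L2_dist \<mu> (vs k) v"
        using L2.nrm_triangle[OF d(1) L2.scale_mem[OF d(2), of r]] L2.nrm_scale[OF d(2), of r]
          L2.nrm_nonneg[OF L2.add_mem[OF d(1) L2.scale_mem[OF d(2), of r]]]
        by simp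
    qed
    show "(\<lambda>k. L2_dist \<mu> (us k) u + \<bar>r\<bar> * L2_dist \<mu> (vs k) v) \<longlonglongrightarrow> 0"
      using tendsto_add[OF approx_norm[OF us] tendsto_mult_right_zero[OF approx_norm[OF vs], of "\<bar>r\<bar>"]]
      by simp
  qed
  fix e :: real assume "e > 0"
  obtain N1 where N1: "\<And>j k. j \<ge> N1 \<Longrightarrow> k \<ge> N1 \<Longrightarrow> nrm (\<lambda>p. us j p - us k p) < e / 2"
    using approx_Cauchy[OF us, of "e / 2"] \<open>e > 0\<close> by auto
  have "e / (2 * (\<bar>r\<bar> + 1)) > 0" using \<open>e > 0\<close> by simp
  then obtain N2 where N2: "\<And>j k. j \<ge> N2 \<Longrightarrow> k \<ge> N2 \<Longrightarrow> nrm (\<lambda>p. vs j p - vs k p) < e / (2 * (\<bar>r\<bar> + 1))"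
    using approx_Cauchy[OF vs] by blast
  have "nrm (\<lambda>p. us j p + r * vs j p - (us k p + r * vs k p)) < e" if "j \<ge> max N1 N2" "k \<ge> max N1 N2" for j k
  proof -
    have d: "(\<lambda>p. us j p - us k p) \<in> D" "(\<lambda>p. vs j p - vs k p) \<in> D" by (intro diff_mem m)+
    have "(\<lambda>p. us j p + r * vs j p - (us k p + r * vs k p)) = (\<lambda>p. (us j p - us k p) + r * (vs j p - vs k p))"
      by (simp add: algebra_simps)
    then have "nrm (\<lambda>p. us j p + r * vs j p - (us k p + r * vs k p))
        \<le> nrm (\<lambda>p. us j p - us k p) + \<bar>r\<bar> * nrm (\<lambda>p. vs j p - vs k p)"
      using nrm_triangle[OF d(1) scale_mem[OF d(2), of r]] nrm_scale[OF d(2), of r] by simp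
    also have "\<bar>r\<bar> * nrm (\<lambda>p. vs j p - vs k p) \<le> (\<bar>r\<bar> + 1) * (e / (2 * (\<bar>r\<bar> + 1)))"
      using N2[of j k] that nrm_nonneg[OF d(2)] by (intro mult_mono) auto
    also have "(\<bar>r\<bar> + 1) * (e / (2 * (\<bar>r\<bar> + 1))) = e / 2"
    proof -
      have *: "x * (e / (2 * x)) = e / 2" if "x > 0" for x using that by simp
      show ?thesis by (rule *) simp
    qed
    finally show ?thesis using N1[of j k] that by simp
  qed
  then show "\<exists>N. \<forall>j\<ge>N. \<forall>k\<ge>N. nrm (\<lambda>p. us j p + r * vs j p - (us k p + r * vs k p)) < e" by blast
qed

lemma approx_add:
  assumes "approx us u" "approx vs v"
  shows "approx (\<lambda>k p. us k p + vs k p) (\<lambda>p. u p + v p)"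
  using approx_scale_add[OF assms, of 1] by simp

lemma approx_diff:
  assumes "approx us u" "approx vs v"
  shows "approx (\<lambda>k p. us k p - vs k p) (\<lambda>p. u p - v p)"
  using approx_scale_add[OF assms, of "-1"] by simp

lemma approx_bounded:
  assumes us: "approx us u"
  obtains B where "B > 0" "\<And>k. nrm (us k) \<le> B"
proof -
  note m = approx_mem[OF us]
  obtain N where N: "\<And>j k. j \<ge> N \<Longrightarrow> k \<ge> N \<Longrightarrow> nrm (\<lambda>p. us j p - us k p) < 1"
    using approx_Cauchy[OF us, of 1] by auto
  have "nrm (us k) \<le> (\<Sum>i\<le>N. nrm (us i)) + 1" for k
  proof (cases "k \<le> N")
    case True
    then have "nrm (us k) \<le> (\<Sum>i\<le>N. nrm (us i))"
      by (intro member_le_sum) (auto simp: m nrm_nonneg)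
    then show ?thesis by simp
  next
    case False
    have "nrm (us k) \<le> nrm (us N) + 1"
      using nrm_le_add_diff[OF m m, of k N] N[of k N] False by simp
    moreover have "nrm (us N) \<le> (\<Sum>i\<le>N. nrm (us i))"
      by (intro member_le_sum) (auto simp: m nrm_nonneg)
    ultimately show ?thesis by simp
  qed
  moreover have "(\<Sum>i\<le>N. nrm (us i)) + 1 > 0"
    using sum_nonneg[of "{..N}" "\<lambda>i. nrm (us i)"] m by (simp add: nrm_nonneg add_nonneg_pos)
  ultimately show ?thesis using that by blast
qed

lemma approx_form_convergent:
  assumes us: "approx us u" and vs: "approx vs v"
  shows "convergent (\<lambda>k. a (us k) (vs k))"
proof -
  note m = approx_mem[OF us] approx_mem[OF vs]
  obtain B C where B: "B > 0" "\<And>k. nrm (us k) \<le> B" and C: "C > 0" "\<And>k. nrm (vs k) \<le> C"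
    using approx_bounded[OF us] approx_bounded[OF vs] by metis
  have "Cauchy (\<lambda>k. a (us k) (vs k))"
  proof (rule CauchyI)
    fix e :: real assume "e > 0"
    obtain N1 where N1: "\<And>j k. j \<ge> N1 \<Longrightarrow> k \<ge> N1 \<Longrightarrow> nrm (\<lambda>p. us j p - us k p) < e / (2 * C)"
      using approx_Cauchy[OF us, of "e / (2 * C)"] \<open>e > 0\<close> C(1) by auto
    obtain N2 where N2: "\<And>j k. j \<ge> N2 \<Longrightarrow> k \<ge> N2 \<Longrightarrow> nrm (\<lambda>p. vs j p - vs k p) < e / (2 * B)"
      using approx_Cauchy[OF vs, of "e / (2 * B)"] \<open>e > 0\<close> B(1) by auto
    have "norm (a (us j) (vs j) - a (us k) (vs k)) < e" if "j \<ge> max N1 N2" "k \<ge> max N1 N2" for j k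
    proof -
      have "a (us j) (vs j) - a (us k) (vs k) = a (\<lambda>p. us j p - us k p) (vs j) + a (us k) (\<lambda>p. vs j p - vs k p)"
        by (simp add: diff_left diff_right m)
      moreover have "\<bar>a (\<lambda>p. us j p - us k p) (vs j)\<bar> < e / (2 * C) * C"
      proof (rule le_less_trans[OF Cauchy_Schwarz])
        have "nrm (\<lambda>p. us j p - us k p) * nrm (vs j) \<le> nrm (\<lambda>p. us j p - us k p) * C"
          by (intro mult_left_mono C nrm_nonneg diff_mem m)
        also have "\<dots> < e / (2 * C) * C" using N1[of j k] that C(1) by (intro mult_strict_right_mono) auto
        finally show "nrm (\<lambda>p. us j p - us k p) * nrm (vs j) < e / (2 * C) * C" .
      qed (intro diff_mem m)+
      moreover have "\<bar>a (us k) (\<lambda>p. vs j p - vs k p)\<bar> < B * (e / (2 * B))"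
      proof (rule le_less_trans[OF Cauchy_Schwarz])
        have "nrm (us k) * nrm (\<lambda>p. vs j p - vs k p) \<le> B * nrm (\<lambda>p. vs j p - vs k p)"
          by (intro mult_right_mono B nrm_nonneg diff_mem m)
        also have "\<dots> < B * (e / (2 * B))" using N2[of j k] that B(1) by (intro mult_strict_left_mono) auto
        finally show "nrm (us k) * nrm (\<lambda>p. vs j p - vs k p) < B * (e / (2 * B))" .
      qed (intro diff_mem m)+
      moreover have "e / (2 * C) * C = e / 2" "B * (e / (2 * B)) = e / 2" using B(1) C(1) by auto
      ultimately show ?thesis by (simp add: abs_less_iff)
    qed
    then show "\<exists>N. \<forall>j\<ge>N. \<forall>k\<ge>N. norm (a (us j) (vs j) - a (us k) (vs k)) < e" by blast
  qed
  then show ?thesis by (simp add: Cauchy_convergent_iff)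
qed

text \<open>If the form is not closable, then the limit defining \<open>closure_form\<close> fails to exist for every
  pair of arguments, so that \<open>closure_form\<close> is a junk constant on the whole domain.\<close>

lemma closure_form_cases:
  assumes u: "u \<in> closure_dom \<mu> D a" and v: "v \<in> closure_dom \<mu> D a"
  obtains (limit) "\<And>us vs. approx us u \<Longrightarrow> approx vs v \<Longrightarrow> (\<lambda>k. a (us k) (vs k)) \<longlonglongrightarrow> closure_form \<mu> D a u v"
    | (junk) "closure_form \<mu> D a u v = closure_form \<mu> D a u (\<lambda>p. 0)"
proof -
  let ?P = "\<lambda>u v l. \<forall>us vs. approx us u \<longrightarrow> approx vs v \<longrightarrow> (\<lambda>k. a (us k) (vs k)) \<longlonglongrightarrow> l"
  consider (closable) "\<And>zs. approx zs (\<lambda>_. 0) \<Longrightarrow> (\<lambda>k. a (zs k) (zs k)) \<longlonglongrightarrow> 0"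
    | (not_closable) zs where "approx zs (\<lambda>_. 0)" "\<not> (\<lambda>k. a (zs k) (zs k)) \<longlonglongrightarrow> 0"
    by blast
  then show ?thesis
  proof cases
    case closable
    \<comment> \<open>Closability makes the form norm of a null sequence tend to 0, and
      Cauchy-Schwarz then makes it negligible against any bounded sequence. So the choice of
      approximating sequences does not affect the limit.\<close>
    have null: "(\<lambda>k. a (zs k) (ws k)) \<longlonglongrightarrow> 0" if zs: "approx zs (\<lambda>_. 0)" and ws: "approx ws w" for zs ws w
    proof -
      obtain B where B: "B > 0" "\<And>k. nrm (ws k) \<le> B" using approx_bounded[OF ws] by metis
      have "(\<lambda>k. sqrt (a (zs k) (zs k))) \<longlonglongrightarrow> sqrt 0" by (intro tendsto_real_sqrt closable zs)
      then have n0: "(\<lambda>k. nrm (zs k) * B) \<longlonglongrightarrow> 0" using tendsto_mult_left_zero by (auto simp: nrm_def)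
      show ?thesis
      proof (rule Lim_null_comparison[OF always_eventually n0], rule allI)
        fix k
        have "\<bar>a (zs k) (ws k)\<bar> \<le> nrm (zs k) * nrm (ws k)"
          by (intro Cauchy_Schwarz approx_mem[OF zs] approx_mem[OF ws])
        also have "\<dots> \<le> nrm (zs k) * B" by (intro mult_left_mono B nrm_nonneg approx_mem[OF zs])
        finally show "norm (a (zs k) (ws k)) \<le> nrm (zs k) * B" by simp
      qed
    qed
    obtain us0 vs0 where us0: "approx us0 u" and vs0: "approx vs0 v"
      using u v by (auto simp: closure_dom_def)
    obtain l where l: "(\<lambda>k. a (us0 k) (vs0 k)) \<longlonglongrightarrow> l"
      using approx_form_convergent[OF us0 vs0] by (auto simp: convergent_def)
    have "(\<lambda>k. a (us k) (vs k)) \<longlonglongrightarrow> l" if us: "approx us u" and vs: "approx vs v" for us vs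
    proof -
      note m = approx_mem[OF us] approx_mem[OF vs] approx_mem[OF us0] approx_mem[OF vs0]
      have z: "approx (\<lambda>k p. us k p - us0 k p) (\<lambda>_. 0)" "approx (\<lambda>k p. vs k p - vs0 k p) (\<lambda>_. 0)"
        using approx_diff[OF us us0] approx_diff[OF vs vs0] by simp_all
      have "(\<lambda>k. a (us0 k) (vs0 k) + a (\<lambda>p. us k p - us0 k p) (vs k) + a (\<lambda>p. vs k p - vs0 k p) (us0 k)) \<longlonglongrightarrow> l + 0 + 0"
        by (intro tendsto_add l null[OF z(1) vs] null[OF z(2) us0])
      moreover have "a (us0 k) (vs0 k) + a (\<lambda>p. us k p - us0 k p) (vs k) + a (\<lambda>p. vs k p - vs0 k p) (us0 k)
          = a (us k) (vs k)" for k
        by (simp add: diff_left m sym[of "vs k" "us0 k"] sym[of "vs0 k" "us0 k"])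
      ultimately show ?thesis by simp
    qed
    then have P: "?P u v l" by blast
    have "closure_form \<mu> D a u v = l"
      unfolding closure_form_def
    proof (rule the_equality[of "?P u v", OF P])
      fix l' assume "?P u v l'"
      then show "l' = l" using us0 vs0 l LIMSEQ_unique by blast
    qed
    then show ?thesis using limit P by blast
  next
    case (not_closable zs)
    note z = not_closable(1)
    \<comment> \<open>Adding \<open>zs\<close> to either argument changes neither limit function, so
      all four values below would tend to \<open>l\<close> and their alternating sum to 0. By
      bilinearity that sum is \<open>a (zs k) (zs k)\<close>.\<close>
    have no: "\<not> ?P u v l" if u: "u \<in> closure_dom \<mu> D a" and v: "v \<in> closure_dom \<mu> D a" for u v l
    proof
      assume P: "?P u v l"
      obtain us vs where us: "approx us u" and vs: "approx vs v"
        using u v by (auto simp: closure_dom_def)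
      note m = approx_mem[OF us] approx_mem[OF vs] approx_mem[OF z]
      have us': "approx (\<lambda>k p. us k p + zs k p) u" and vs': "approx (\<lambda>k p. vs k p + zs k p) v"
        using approx_add[OF us z] approx_add[OF vs z] by simp_all
      have "(\<lambda>k. a (\<lambda>p. us k p + zs k p) (\<lambda>p. vs k p + zs k p) - a (\<lambda>p. us k p + zs k p) (vs k)
          - a (us k) (\<lambda>p. vs k p + zs k p) + a (us k) (vs k)) \<longlonglongrightarrow> l - l - l + l"
        using P us vs us' vs' by (intro tendsto_add tendsto_diff) blast+
      moreover have "a (\<lambda>p. us k p + zs k p) (\<lambda>p. vs k p + zs k p) - a (\<lambda>p. us k p + zs k p) (vs k)
          - a (us k) (\<lambda>p. vs k p + zs k p) + a (us k) (vs k) = a (zs k) (zs k)" for k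
        by (simp add: add_left add_right m add_mem)
      ultimately show False using not_closable(2) by simp
    qed
    have "(\<lambda>p. 0) \<in> closure_dom \<mu> D a" using approx_zero by (auto simp: closure_dom_def)
    \<comment> \<open>Both values of \<open>closure_form\<close> are definite descriptions over the
      same empty predicate, hence equal. The second argument 0 is chosen because an operator
      equation determines the value there.\<close>
    then have "?P u v = (\<lambda>_. False)" "?P u (\<lambda>p. 0) = (\<lambda>_. False)"
      using no[OF u v] no[OF u, of "\<lambda>p. 0"] by (intro ext; blast)+
    then show ?thesis by (intro junk) (simp only: closure_form_def)
  qed
qed

end

section \<open>Truncations belong to the form domain\<close>

lemma L2_norm_contraction_tendsto:
  assumes u: "u \<in> L2 \<mu>"
    and meas: "\<And>n. F n \<in> borel_measurable borel" and E: "E \<in> borel_measurable borel"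
    and bound: "\<And>n s. \<bar>F n s\<bar> \<le> \<bar>s\<bar>" and lim: "\<And>s. (\<lambda>n. F n s) \<longlonglongrightarrow> E s"
  shows "(\<lambda>n. L2_norm \<mu> (\<lambda>p. F n (u p) - E (u p))) \<longlonglongrightarrow> 0"
proof -
  have um[measurable]: "u \<in> borel_measurable \<mu>" by (rule L2_measurable[OF u])
  note [measurable] = meas E
  have Eb: "\<bar>E s\<bar> \<le> \<bar>s\<bar>" for s
    by (rule LIMSEQ_le_const2[OF tendsto_rabs[OF lim]]) (use bound in auto)
  have "(\<lambda>n. LINT p|\<mu>. (F n (u p) - E (u p))\<^sup>2) \<longlonglongrightarrow> (LINT p|\<mu>. (0::real))"
  proof (rule integral_dominated_convergence)
    show "integrable \<mu> (\<lambda>p. 4 * (u p)\<^sup>2)" using L2_integrable_square[OF u] by simp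
    show "AE p in \<mu>. (\<lambda>n. (F n (u p) - E (u p))\<^sup>2) \<longlonglongrightarrow> 0"
    proof (rule AE_I2)
      fix p
      have "(\<lambda>n. (F n (u p) - E (u p))\<^sup>2) \<longlonglongrightarrow> (E (u p) - E (u p))\<^sup>2" by (intro tendsto_intros lim)
      then show "(\<lambda>n. (F n (u p) - E (u p))\<^sup>2) \<longlonglongrightarrow> 0" by simp
    qed
    show "AE p in \<mu>. norm ((F n (u p) - E (u p))\<^sup>2) \<le> 4 * (u p)\<^sup>2" for n
    proof (rule AE_I2)
      fix p
      have "\<bar>F n (u p) - E (u p)\<bar> \<le> \<bar>2 * u p\<bar>" using bound[of n "u p"] Eb[of "u p"] by linarith
      then have "(F n (u p) - E (u p))\<^sup>2 \<le> (2 * u p)\<^sup>2" by (simp only: abs_le_square_iff)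
      then show "norm ((F n (u p) - E (u p))\<^sup>2) \<le> 4 * (u p)\<^sup>2" by (simp add: power_mult_distrib)
    qed
  qed measurable
  then have "(\<lambda>n. sqrt (LINT p|\<mu>. (F n (u p) - E (u p))\<^sup>2)) \<longlonglongrightarrow> sqrt 0"
    by (intro tendsto_real_sqrt) simp
  then show ?thesis by (simp add: L2_norm_def)
qed

text \<open>The interface between analysis and geometry: \<open>F c n\<close> stands for smooth
  contractions that approximate truncation at the level \<open>c\<close> and preserve the domain of
  the form, which truncation itself need not do.\<close>

locale markov_form = L2_form D a \<mu> for D :: "('a \<Rightarrow> real) set" and a \<mu> +
  fixes F :: "real \<Rightarrow> nat \<Rightarrow> real \<Rightarrow> real"
  assumes F_mem: "c > 0 \<Longrightarrow> u \<in> D \<Longrightarrow> (\<lambda>p. F c n (u p)) \<in> D"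
    and F_contraction: "c > 0 \<Longrightarrow> u \<in> D \<Longrightarrow> a (\<lambda>p. F c n (u p)) (\<lambda>p. F c n (u p)) \<le> a u u"
    and F_nonneg: "c > 0 \<Longrightarrow> u \<in> D \<Longrightarrow> 0 \<le> a u (\<lambda>p. F c n (u p))"
    and F_Lipschitz: "c > 0 \<Longrightarrow> \<bar>F c n s - F c n t\<bar> \<le> \<bar>s - t\<bar>"
    and F_0: "c > 0 \<Longrightarrow> F c n 0 = 0"
    and F_tendsto: "c > 0 \<Longrightarrow> (\<lambda>n. F c n s) \<longlonglongrightarrow> max (s - c) 0"
begin

text \<open>Membership of the truncation in the form domain alone would not suffice, since in the
  limit the sign of the form at this pair is needed too. Hence one sequence \<open>xs\<close> is
  built that approximates the truncation and is almost nonnegative against the given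
  \<open>us\<close>.\<close>

lemma approx_excess:
  assumes c: "c > 0" and us: "approx us u"
  shows "\<exists>xs. approx xs (excess c u) \<and> (\<forall>e>0. \<exists>N. \<forall>n\<ge>N. - e \<le> a (us n) (xs n))"
proof -
  note m = approx_mem[OF us]
  have c0: "c \<ge> 0" using c by simp
  have u: "u \<in> L2 \<mu>" by (rule approx_L2[OF us])
  define w where "w = excess c u"
  have w: "w \<in> L2 \<mu>" unfolding w_def by (rule excess_mem[OF c0 u])
  have meas: "F c n \<in> borel_measurable borel" for n
  proof (rule borel_measurable_continuous_onI)
    show "continuous_on UNIV (F c n)"
      unfolding continuous_on_iff dist_real_def using F_Lipschitz[OF c] by (meson le_less_trans)
  qed
  have Fb: "\<bar>F c n s\<bar> \<le> \<bar>s\<bar>" for n s using F_Lipschitz[OF c, of n s 0] F_0[OF c] by simp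
  define ws where "ws n p = F c n (us n p)" for n p
  have ws: "ws n \<in> D" for n unfolding ws_def[abs_def] by (rule F_mem[OF c m])
  have Fu: "(\<lambda>p. F c n (u p)) \<in> L2 \<mu>" for n
    by (rule L2_dominated[OF u]) (use meas Fb L2_measurable[OF u] in auto)
  have ws_lim: "(\<lambda>n. L2_dist \<mu> (ws n) w) \<longlonglongrightarrow> 0"
  proof (rule Lim_null_comparison[OF always_eventually], rule allI)
    fix n
    have "L2_dist \<mu> (ws n) w
        \<le> L2_norm \<mu> (\<lambda>p. ws n p - F c n (u p)) + L2_norm \<mu> (\<lambda>p. F c n (u p) - w p)"
      by (intro L2.nrm_diff_triangle D_L2' ws Fu w)
    also have "L2_norm \<mu> (\<lambda>p. ws n p - F c n (u p)) \<le> L2_dist \<mu> (us n) u"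
      by (rule L2_norm_mono[OF L2.diff_mem[OF D_L2'[OF m] u] L2_measurable[OF L2.diff_mem[OF D_L2'[OF ws] Fu]]])
         (simp add: ws_def F_Lipschitz[OF c])
    finally show "norm (L2_dist \<mu> (ws n) w)
        \<le> L2_dist \<mu> (us n) u + L2_norm \<mu> (\<lambda>p. F c n (u p) - w p)"
      using L2.nrm_nonneg[OF L2.diff_mem[OF D_L2'[OF ws] w]] by simp
  next
    have "(\<lambda>n. L2_norm \<mu> (\<lambda>p. F c n (u p) - max (u p - c) 0)) \<longlonglongrightarrow> 0"
      by (rule L2_norm_contraction_tendsto[where E = "\<lambda>s. max (s - c) 0", OF u meas _ Fb F_tendsto[OF c]]) simp
    then show "(\<lambda>n. L2_dist \<mu> (us n) u + L2_norm \<mu> (\<lambda>p. F c n (u p) - w p)) \<longlonglongrightarrow> 0"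
      using tendsto_add[OF approx_norm[OF us]] by (force simp: w_def excess_def)
  qed
  obtain B where B: "B > 0" "\<And>k. nrm (us k) \<le> B" using approx_bounded[OF us] by metis
  have nrm_ws: "nrm (ws k) \<le> B" for k
    using F_contraction[OF c m, of k k] B(2)[of k] by (simp add: nrm_def ws_def[abs_def] order_trans[OF real_sqrt_le_mono])
  \<comment> \<open>The second tolerance is divided by \<open>B\<close> because it is multiplied
    below by a form norm of at most \<open>B\<close>.\<close>
  have "\<exists>M. (\<forall>k\<ge>M. L2_dist \<mu> (ws k) w \<le> 1 / Suc i) \<and>
      (\<forall>j\<ge>M. \<forall>k\<ge>M. nrm (\<lambda>p. us j p - us k p) \<le> 1 / Suc i / B)" for i
  proof -
    have "(1 / Suc i :: real) > 0" "(1 / Suc i / B :: real) > 0" using B(1) by auto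
    then obtain M1 M2 where "\<forall>k\<ge>M1. L2_dist \<mu> (ws k) w < 1 / Suc i"
        "\<forall>j\<ge>M2. \<forall>k\<ge>M2. nrm (\<lambda>p. us j p - us k p) < 1 / Suc i / B"
      using order_tendstoD(2)[OF ws_lim] approx_Cauchy[OF us] unfolding eventually_sequentially by blast
    then show ?thesis by (intro exI[of _ "max M1 M2"]) (auto intro: less_imp_le)
  qed
  then obtain M where M1: "\<And>i k. k \<ge> M i \<Longrightarrow> L2_dist \<mu> (ws k) w \<le> 1 / Suc i"
    and M2: "\<And>i j k. j \<ge> M i \<Longrightarrow> k \<ge> M i \<Longrightarrow> nrm (\<lambda>p. us j p - us k p) \<le> 1 / Suc i / B"
    by metis
  \<comment> \<open>Balls around \<open>w\<close> and half-spaces, so midpoints stay inside. The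
    index \<open>n\<close> only decides which conditions are active: more of them as
    \<open>n\<close> grows, whence the sets decrease. The half-spaces preserve the sign of
    \<open>a (us n) (ws n)\<close> for points that are not truncations.\<close>
  define K where "K n = {x \<in> D. \<forall>i. M i \<le> n \<longrightarrow> L2_dist \<mu> x w \<le> 1 / Suc i \<and>
      (\<forall>j\<ge>M i. - (1 / Suc i) \<le> a (us j) x)}" for n
  have wsK: "ws n \<in> K n" for n
  proof -
    \<comment> \<open>Positivity is available only for equal indices; replacing \<open>us n\<close>
      by \<open>us j\<close> costs their form distance times the bound on
      \<open>ws n\<close>.\<close>
    have "- (1 / Suc i) \<le> a (us j) (ws n)" if "M i \<le> n" "M i \<le> j" for i j
    proof -
      have "a (us j) (ws n) = a (us n) (ws n) + a (\<lambda>p. us j p - us n p) (ws n)"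
        by (simp add: diff_left m ws)
      moreover have "0 \<le> a (us n) (ws n)" unfolding ws_def[abs_def] by (rule F_nonneg[OF c m])
      moreover have "\<bar>a (\<lambda>p. us j p - us n p) (ws n)\<bar> \<le> 1 / Suc i"
      proof (rule order_trans[OF Cauchy_Schwarz])
        have "nrm (\<lambda>p. us j p - us n p) * nrm (ws n) \<le> (1 / Suc i / B) * B"
          using that B(1) by (intro mult_mono M2 nrm_ws nrm_nonneg ws) auto
        then show "nrm (\<lambda>p. us j p - us n p) * nrm (ws n) \<le> 1 / Suc i" using B(1) by simp
      qed (intro diff_mem m ws)+
      ultimately show ?thesis by linarith
    qed
    then show ?thesis using M1 ws by (simp add: K_def)
  qed
  have midD: "(\<lambda>p. (x p + y p) / 2) \<in> D" if "x \<in> D" "y \<in> D" for x y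
    using scale_mem[OF add_mem[OF that], of "1/2"] by simp
  have mid: "(\<lambda>p. (x p + y p) / 2) \<in> K n" if x: "x \<in> K n" and y: "y \<in> K n" for n x y
  proof -
    have D: "x \<in> D" "y \<in> D" using x y by (auto simp: K_def)
    note L = D_L2'[OF D(1)] D_L2'[OF D(2)]
    have "L2_norm \<mu> (\<lambda>p. (x p + y p) / 2 - w p) \<le> 1 / Suc i" if i: "M i \<le> n" for i
    proof -
      have "(\<lambda>p. (x p + y p) / 2 - w p) = (\<lambda>p. (1/2) * (x p - w p) + (1/2) * (y p - w p))" by (rule ext) argo
      moreover have "L2_norm \<mu> (\<lambda>p. (1/2) * (x p - w p) + (1/2) * (y p - w p))
          \<le> L2_norm \<mu> (\<lambda>p. (1/2) * (x p - w p)) + L2_norm \<mu> (\<lambda>p. (1/2) * (y p - w p))"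
        by (intro L2.nrm_triangle L2.scale_mem L2.diff_mem L w)
      moreover have "L2_norm \<mu> (\<lambda>p. (1/2) * (x p - w p)) = 1/2 * L2_dist \<mu> x w"
          "L2_norm \<mu> (\<lambda>p. (1/2) * (y p - w p)) = 1/2 * L2_dist \<mu> y w"
        using L2.nrm_scale[OF L2.diff_mem[OF L(1) w], of "1/2"] L2.nrm_scale[OF L2.diff_mem[OF L(2) w], of "1/2"]
        by simp_all
      moreover have "L2_dist \<mu> x w \<le> 1 / Suc i" "L2_dist \<mu> y w \<le> 1 / Suc i"
        using x y i by (auto simp: K_def)
      ultimately show ?thesis by simp
    qed
    moreover have "- (1 / Suc i) \<le> a (us j) (\<lambda>p. (x p + y p) / 2)" if i: "M i \<le> n" "M i \<le> j" for i j
    proof -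
      have "a (us j) (\<lambda>p. (x p + y p) / 2) = (1/2) * (a (us j) x + a (us j) y)"
        using scale_right[OF m add_mem[OF D], of j "1/2"] by (simp add: add_right m D)
      moreover have "- (1 / Suc i) \<le> a (us j) x" "- (1 / Suc i) \<le> a (us j) y"
        using x y i by (auto simp: K_def)
      moreover have "r \<le> t" if "t = (1/2) * (q + s)" "r \<le> q" "r \<le> s" for q r s t :: real
        using that by simp
      ultimately show ?thesis by blast
    qed
    ultimately show ?thesis using midD[OF D] by (simp add: K_def)
  qed
  have "\<exists>xs. (\<forall>n. xs n \<in> K n) \<and> (\<forall>n. \<forall>y\<in>K n. a (xs n) (xs n) - 0 \<le> a y y - 0 + 1 / Suc n) \<and>
    (\<forall>e>0. \<exists>N. \<forall>j\<ge>N. \<forall>k\<ge>N. a (\<lambda>p. xs j p - xs k p) (\<lambda>p. xs j p - xs k p) < e)"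
  proof (rule minimising_sequence_Cauchy[where b = 0 and w = ws and B = "B\<^sup>2"])
    show "K n \<subseteq> D" for n by (auto simp: K_def)
    show "K n \<subseteq> K m" if "m \<le> n" for m n using that by (auto simp: K_def)
    show "a (ws n) (ws n) - 0 \<le> B\<^sup>2" for n
      using nrm_square[OF ws, of n] power_mono[OF nrm_ws nrm_nonneg[OF ws], of n 2] by simp
  qed (use mid wsK nonneg in auto)
  then obtain xs where xs: "\<And>n. xs n \<in> K n"
    and Cau: "\<forall>e>0. \<exists>N. \<forall>j\<ge>N. \<forall>k\<ge>N. a (\<lambda>p. xs j p - xs k p) (\<lambda>p. xs j p - xs k p) < e"
    by blast
  have xsD: "xs n \<in> D" for n using xs[of n] by (simp add: K_def)
  have tail: "\<exists>i. 1 / real (Suc i) < e" if "e > 0" for e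
    using reals_Archimedean[OF that] by (simp add: inverse_eq_divide)
  have "(\<lambda>n. L2_dist \<mu> (xs n) w) \<longlonglongrightarrow> 0"
  proof (rule LIMSEQ_I)
    fix e :: real assume "e > 0"
    then obtain i where i: "1 / real (Suc i) < e" using tail by blast
    have "norm (L2_dist \<mu> (xs n) w - 0) < e" if "n \<ge> M i" for n
    proof -
      have "L2_dist \<mu> (xs n) w \<le> 1 / Suc i" using xs[of n] that by (simp add: K_def)
      then show ?thesis
        using i L2.nrm_nonneg[OF L2.diff_mem[OF D_L2'[OF xsD] w], of n] by simp
    qed
    then show "\<exists>no. \<forall>n\<ge>no. norm (L2_dist \<mu> (xs n) w - 0) < e" by blast
  qed
  then have "approx xs w" using Cau xsD w by (simp add: form_approx_def)
  moreover have "\<exists>N. \<forall>n\<ge>N. - e \<le> a (us n) (xs n)" if "e > 0" for e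
  proof -
    obtain i where i: "1 / real (Suc i) < e" using tail \<open>e > 0\<close> by blast
    have "- e \<le> a (us n) (xs n)" if "n \<ge> M i" for n
    proof -
      have "- (1 / Suc i) \<le> a (us n) (xs n)" using xs[of n] that by (simp add: K_def)
      then show ?thesis using i by linarith
    qed
    then show ?thesis by blast
  qed
  ultimately show ?thesis unfolding w_def by blast
qed

text \<open>The truncation lies in the form domain, so it may test the operator equation. This gives
  minus the inner product as the form at u and (u - c)^+, a limit of numbers that are almost
  nonnegative.\<close>

lemma associated_operator_dissipative:
  assumes c: "c > 0" and f: "f \<in> L2 \<mu>"
    and uf: "(u, \<lambda>p. - f p) \<in> associated_operator \<mu> (closure_dom \<mu> D a) (closure_form \<mu> D a)"
  shows "L2_inner \<mu> f (excess c u) \<le> 0"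
proof -
  let ?V = "closure_dom \<mu> D a" and ?b = "closure_form \<mu> D a"
  have uV: "u \<in> ?V" and b: "\<And>v. v \<in> ?V \<Longrightarrow> ?b u v = L2_inner \<mu> (\<lambda>p. - f p) v"
    using uf by (auto simp: associated_operator_def)
  obtain us where us: "approx us u" using uV by (auto simp: closure_dom_def)
  obtain xs where xs: "approx xs (excess c u)"
    and lower: "\<And>e. e > 0 \<Longrightarrow> \<exists>N. \<forall>n\<ge>N. - e \<le> a (us n) (xs n)"
    using approx_excess[OF c us] by blast
  have wV: "excess c u \<in> ?V" using xs by (auto simp: closure_dom_def)
  have w: "excess c u \<in> L2 \<mu>" by (rule approx_L2[OF xs])
  have zV: "(\<lambda>p. 0) \<in> ?V" using approx_zero by (auto simp: closure_dom_def)
  have "0 \<le> ?b u (excess c u)"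
    using uV wV
  proof (cases rule: closure_form_cases)
    case limit
    have "- e \<le> ?b u (excess c u)" if "e > 0" for e
      by (rule LIMSEQ_le_const[OF limit[OF us xs]]) (rule lower[OF that])
    then have "0 \<le> ?b u (excess c u) + e" if "e > 0" for e using that by force
    then show ?thesis by (rule field_le_epsilon)
  next
    \<comment> \<open>The constant equals the value at the zero function, where the operator
      equation gives an inner product with 0.\<close>
    case junk
    then show ?thesis using b[OF zV] f by (simp add: L2.zero_right L2.minus_mem)
  qed
  then show ?thesis using b[OF wV] L2.minus_left[OF f w] by simp
qed

end

section \<open>Calculus of \<open>C\<^sup>k\<close> functions\<close>

lemma Ck_on_subset: "Ck_on k f S \<Longrightarrow> S' \<subseteq> S \<Longrightarrow> Ck_on k f S'"
  by (induction k arbitrary: f) (auto intro: continuous_on_subset)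

lemma Ck_on_SucD: "Ck_on (Suc k) f S \<Longrightarrow> Ck_on k f S"
proof (induction k arbitrary: f)
  case 0
  then show ?case
    by (auto intro!: continuous_at_imp_continuous_on differentiable_imp_continuous_within)
next
  case (Suc k)
  show ?case
    unfolding Ck_on.simps(2)[of k]
  proof (intro conjI allI)
    show "\<forall>x\<in>S. f differentiable (at x)" using Suc.prems by simp
    show "Ck_on k (\<lambda>x. frechet_derivative f (at x) v) S" for v
      using Suc.prems by (intro Suc.IH) simp
  qed
qed

lemma frechet_derivative_cong_open:
  assumes "open S" "x \<in> S" "\<And>y. y \<in> S \<Longrightarrow> f y = g y"
  shows "frechet_derivative f (at x) = frechet_derivative g (at x)"
proof -
  have "(f has_derivative D) (at x) \<longleftrightarrow> (g has_derivative D) (at x)" for D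
    using has_derivative_transform_within_open[OF _ assms(1,2), of f D UNIV g]
      has_derivative_transform_within_open[OF _ assms(1,2), of g D UNIV f] assms(3)
    by (metis (no_types, lifting))
  then show ?thesis by (simp add: frechet_derivative_def)
qed

lemma Ck_on_cong:
  assumes "open S" "\<And>x. x \<in> S \<Longrightarrow> f x = g x" "Ck_on k f S"
  shows "Ck_on k g S"
  using assms(2,3)
proof (induction k arbitrary: f g)
  case 0
  then show ?case using continuous_on_eq by simp
next
  case (Suc k)
  have eq: "frechet_derivative f (at x) = frechet_derivative g (at x)" if "x \<in> S" for x
    by (rule frechet_derivative_cong_open[OF assms(1) that Suc.prems(1)])
  have "g differentiable (at x)" if "x \<in> S" for x
  proof -
    have "(f has_derivative frechet_derivative f (at x)) (at x)"
      using Suc.prems(2) that by (simp add: frechet_derivative_works)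
    then have "(g has_derivative frechet_derivative f (at x)) (at x)"
      by (rule has_derivative_transform_within_open[OF _ assms(1) that]) (rule Suc.prems(1))
    then show ?thesis by (rule differentiableI)
  qed
  moreover have "Ck_on k (\<lambda>x. frechet_derivative g (at x) v) S" for v
    by (rule Suc.IH[of "\<lambda>x. frechet_derivative f (at x) v"]) (use Suc.prems(2) eq in auto)
  ultimately show ?case by simp
qed

text \<open>Extensions in \<open>smooth_on\<close> are chosen point by point; locality joins them
  into one statement on an open set.\<close>

lemma Ck_on_local:
  assumes S: "open S" and loc: "\<And>x. x \<in> S \<Longrightarrow> \<exists>U. open U \<and> x \<in> U \<and> Ck_on k f (S \<inter> U)"
  shows "Ck_on k f S"
  using loc
proof (induction k arbitrary: f)
  case 0
  have "isCont f x" if x: "x \<in> S" for x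
  proof -
    obtain U where U: "open U" "x \<in> U" "continuous_on (S \<inter> U) f" using 0[OF x] by auto
    then show ?thesis using continuous_on_eq_continuous_at[of "S \<inter> U" f] S x by auto
  qed
  then show ?case by (auto intro: continuous_at_imp_continuous_on)
next
  case (Suc k)
  have "f differentiable (at x)" if "x \<in> S" for x
    using Suc.prems[OF that] that by auto
  moreover have "Ck_on k (\<lambda>x. frechet_derivative f (at x) v) S" for v
  proof (rule Suc.IH)
    fix x assume "x \<in> S"
    then show "\<exists>U. open U \<and> x \<in> U \<and> Ck_on k (\<lambda>x. frechet_derivative f (at x) v) (S \<inter> U)"
      using Suc.prems[of x] by auto
  qed
  ultimately show ?case by simp
qed

lemma smooth_on_open_iff:
  assumes "open S"
  shows "smooth_on S f \<longleftrightarrow> (\<forall>k. Ck_on k f S)"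
proof
  assume f: "smooth_on S f"
  show "\<forall>k. Ck_on k f S"
  proof
    fix k
    show "Ck_on k f S"
    proof (rule Ck_on_local[OF assms])
      fix x assume "x \<in> S"
      then obtain U G where U: "open U" "x \<in> U" and G: "\<forall>k. Ck_on k G U" "\<forall>y\<in>S \<inter> U. G y = f y"
        using f by (auto simp: smooth_on_def)
      have "Ck_on k G (S \<inter> U)" using Ck_on_subset[of k G U "S \<inter> U"] G(1) by simp
      then have "Ck_on k f (S \<inter> U)"
        using G(2) assms U(1) by (intro Ck_on_cong[of "S \<inter> U" G f k]) auto
      then show "\<exists>U. open U \<and> x \<in> U \<and> Ck_on k f (S \<inter> U)" using U by blast
    qed
  qed
next
  assume "\<forall>k. Ck_on k f S"
  then show "smooth_on S f" using assms unfolding smooth_on_def by blast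
qed

lemma smooth_on_extension_at:
  assumes "smooth_on S f" "x \<in> S"
  obtains U G where "open U" "x \<in> U" "\<And>k. Ck_on k G U" "\<And>y. y \<in> S \<inter> U \<Longrightarrow> G y = f y"
  using assms unfolding smooth_on_def by meson

lemma smooth_on_imp_continuous_on:
  assumes "smooth_on S f"
  shows "continuous_on S f"
  unfolding continuous_on_eq_continuous_within
proof
  fix x assume x: "x \<in> S"
  obtain U G where U: "open U" "x \<in> U" and G: "\<And>k. Ck_on k G U" "\<And>y. y \<in> S \<inter> U \<Longrightarrow> G y = f y"
    using smooth_on_extension_at[OF assms x] by metis
  obtain d where d: "d > 0" "ball x d \<subseteq> U" using U openE by blast
  have "isCont G x" using G(1)[of 0] U continuous_on_eq_continuous_at by auto
  then have "continuous (at x within S) G" by (rule continuous_at_imp_continuous_at_within)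
  then show "continuous (at x within S) f"
  proof (rule continuous_transform_within[OF _ d(1) x])
    fix y assume "y \<in> S" "dist y x < d"
    then have "y \<in> S \<inter> U" using d(2) by (auto simp: dist_commute)
    then show "G y = f y" by (rule G(2))
  qed
qed

text \<open>\<open>S\<close> may reach the boundary of a half-space. The neighbourhood
  \<open>V\<close> inside \<open>S\<close> ensures that \<open>f\<close> coincides near
  \<open>x\<close> with its local extension and so has a full derivative.\<close>

lemma smooth_on_imp_differentiable:
  assumes "smooth_on S f" "x \<in> S" "open V" "x \<in> V" "V \<subseteq> S"
  shows "f differentiable (at x)"
proof -
  obtain U G where U: "open U" "x \<in> U" and G: "\<And>k. Ck_on k G U" "\<And>y. y \<in> S \<inter> U \<Longrightarrow> G y = f y"
    using smooth_on_extension_at[OF assms(1,2)] by metis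
  have "Ck_on 1 G (U \<inter> V)" using G(1) by (rule Ck_on_subset) simp
  then have "Ck_on 1 f (U \<inter> V)"
    using U assms G(2) by (intro Ck_on_cong[of "U \<inter> V" G f 1]) auto
  then show ?thesis using U assms by simp
qed

section \<open>Sums, products and roots\<close>

lemma Ck_on_const: "Ck_on k (\<lambda>x. c) S"
  by (induction k arbitrary: c) auto

lemma Ck_on_add:
  fixes f g :: "'e::euclidean_space \<Rightarrow> 'f::real_normed_vector"
  assumes "open S" "Ck_on k f S" "Ck_on k g S"
  shows "Ck_on k (\<lambda>x. f x + g x) S"
  using assms(2,3)
proof (induction k arbitrary: f g)
  case 0
  then show ?case by (simp add: continuous_on_add)
next
  case (Suc k)
  have d: "f differentiable (at x)" "g differentiable (at x)" if "x \<in> S" for x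
    using Suc.prems that by auto
  have "Ck_on k (\<lambda>x. frechet_derivative (\<lambda>x. f x + g x) (at x) v) S" for v
  proof (rule Ck_on_cong[OF assms(1)])
    show "Ck_on k (\<lambda>x. frechet_derivative f (at x) v + frechet_derivative g (at x) v) S"
      using Suc.prems by (intro Suc.IH) auto
    show "frechet_derivative f (at x) v + frechet_derivative g (at x) v
        = frechet_derivative (\<lambda>x. f x + g x) (at x) v" if "x \<in> S" for x
    proof -
      have "((\<lambda>x. f x + g x) has_derivative (\<lambda>v. frechet_derivative f (at x) v + frechet_derivative g (at x) v)) (at x)"
        using d[OF that] by (intro has_derivative_add) (simp_all add: frechet_derivative_works)
      from frechet_derivative_at[OF this] show ?thesis by metis
    qed
  qed
  then show ?case using d by (simp add: differentiable_add)
qed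

lemma Ck_on_mult:
  fixes f g :: "'e::euclidean_space \<Rightarrow> real"
  assumes "open S" "Ck_on k f S" "Ck_on k g S"
  shows "Ck_on k (\<lambda>x. f x * g x) S"
  using assms(2,3)
proof (induction k arbitrary: f g)
  case 0
  then show ?case by (simp add: continuous_on_mult)
next
  case (Suc k)
  have d: "f differentiable (at x)" "g differentiable (at x)" if "x \<in> S" for x
    using Suc.prems that by auto
  have "Ck_on k (\<lambda>x. frechet_derivative (\<lambda>x. f x * g x) (at x) v) S" for v
  proof (rule Ck_on_cong[OF assms(1)])
    show "Ck_on k (\<lambda>x. f x * frechet_derivative g (at x) v + frechet_derivative f (at x) v * g x) S"
      using Suc.prems Ck_on_SucD[OF Suc.prems(1)] Ck_on_SucD[OF Suc.prems(2)]
      by (intro Ck_on_add assms(1) Suc.IH) auto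
    show "f x * frechet_derivative g (at x) v + frechet_derivative f (at x) v * g x
        = frechet_derivative (\<lambda>x. f x * g x) (at x) v" if "x \<in> S" for x
    proof -
      have "((\<lambda>x. f x * g x) has_derivative (\<lambda>v. f x * frechet_derivative g (at x) v + frechet_derivative f (at x) v * g x)) (at x)"
        using d[OF that] by (intro has_derivative_mult) (simp_all add: frechet_derivative_works)
      from frechet_derivative_at[OF this] show ?thesis by metis
    qed
  qed
  then show ?case using d by (simp add: differentiable_mult)
qed

text \<open>With r = f^(-1/2), the derivative of r is -(1/2) r^3 times that of f: a polynomial in r
  itself, so the induction closes. The root is then obtained as f r.\<close>

lemma Ck_on_inverse_sqrt:
  fixes f :: "'e::euclidean_space \<Rightarrow> real"
  assumes "open S" "Ck_on k f S" and pos: "\<And>x. x \<in> S \<Longrightarrow> f x > 0"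
  shows "Ck_on k (\<lambda>x. inverse (sqrt (f x))) S"
  using assms(2)
proof (induction k)
  case 0
  then show ?case using pos
    by (auto intro!: continuous_on_inverse continuous_on_real_sqrt dest!: pos)
next
  case (Suc k)
  let ?r = "\<lambda>x. inverse (sqrt (f x))"
  have der: "(?r has_derivative (\<lambda>v. frechet_derivative f (at x) v * (- (1/2) * (?r x * (?r x * ?r x))))) (at x)"
    if x: "x \<in> S" for x
  proof -
    have "(f has_derivative frechet_derivative f (at x)) (at x)"
      using Suc.prems x by (simp add: frechet_derivative_works)
    moreover have "((\<lambda>y. inverse (sqrt y)) has_real_derivative - (1/2) * (?r x * (?r x * ?r x))) (at (f x))"
      using pos[OF x] by (auto intro!: derivative_eq_intros simp: field_simps)
    ultimately show ?thesis using DERIV_compose_FDERIV by blast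
  qed
  have "Ck_on k (\<lambda>x. frechet_derivative ?r (at x) v) S" for v
  proof (rule Ck_on_cong[OF assms(1)])
    show "Ck_on k (\<lambda>x. frechet_derivative f (at x) v * (- (1/2) * (?r x * (?r x * ?r x)))) S"
      using Suc.prems Suc.IH[OF Ck_on_SucD[OF Suc.prems]]
      by (intro Ck_on_mult Ck_on_const assms(1)) auto
    show "frechet_derivative f (at x) v * (- (1/2) * (?r x * (?r x * ?r x))) = frechet_derivative ?r (at x) v"
      if "x \<in> S" for x
      using frechet_derivative_at[OF der[OF that]] by metis
  qed
  then show ?case using der by (auto simp: differentiable_def)
qed

lemma Ck_on_sqrt:
  fixes f :: "'e::euclidean_space \<Rightarrow> real"
  assumes "open S" "Ck_on k f S" and pos: "\<And>x. x \<in> S \<Longrightarrow> f x > 0"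
  shows "Ck_on k (\<lambda>x. sqrt (f x)) S"
proof (rule Ck_on_cong[OF assms(1)])
  show "Ck_on k (\<lambda>x. f x * inverse (sqrt (f x))) S"
    by (intro Ck_on_mult Ck_on_inverse_sqrt assms)
  show "f x * inverse (sqrt (f x)) = sqrt (f x)" if "x \<in> S" for x
    using pos[OF that] by (simp add: field_simps)
qed

section \<open>Smooth truncations\<close>

text \<open>The constant is chosen so that \<open>0\<close> is mapped to \<open>0\<close>, which preserves compact supports.\<close>

definition smooth_excess :: "real \<Rightarrow> nat \<Rightarrow> real \<Rightarrow> real" where
  "smooth_excess c n s =
    (1/2) * (s + sqrt ((s - c)\<^sup>2 + (1 / Suc n)\<^sup>2) + - sqrt (c\<^sup>2 + (1 / Suc n)\<^sup>2))"

definition smooth_excess_deriv :: "real \<Rightarrow> nat \<Rightarrow> real \<Rightarrow> real" where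
  "smooth_excess_deriv c n s = (1/2) * (1 + (s - c) / sqrt ((s - c)\<^sup>2 + (1 / Suc n)\<^sup>2))"

lemma smooth_excess_0: "smooth_excess c n 0 = 0"
  by (simp add: smooth_excess_def)

lemma smooth_excess_pos: "(s - c)\<^sup>2 + (1 / real (Suc n))\<^sup>2 > 0"
  by (intro add_nonneg_pos) auto

lemma Ck_on_smooth_excess:
  fixes f :: "'e::euclidean_space \<Rightarrow> real"
  assumes S: "open S" and f: "Ck_on k f S"
  shows "Ck_on k (\<lambda>x. smooth_excess c n (f x)) S"
proof -
  have d: "Ck_on k (\<lambda>x. f x + - c) S" by (intro Ck_on_add Ck_on_const S f)
  have "Ck_on k (\<lambda>x. (f x + - c) * (f x + - c) + (1 / Suc n)\<^sup>2) S"
    by (intro Ck_on_add[OF S] Ck_on_mult[OF S] Ck_on_const d)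
  then have "Ck_on k (\<lambda>x. sqrt ((f x - c)\<^sup>2 + (1 / Suc n)\<^sup>2)) S"
    by (intro Ck_on_sqrt[OF S] smooth_excess_pos) (simp add: power2_eq_square)
  then show ?thesis
    unfolding smooth_excess_def by (intro Ck_on_mult[OF S] Ck_on_add[OF S] Ck_on_const f)
qed

lemma DERIV_smooth_excess:
  "(smooth_excess c n has_real_derivative smooth_excess_deriv c n s) (at s)"
proof -
  have "((\<lambda>s. (1/2) * (s + sqrt ((s - c)\<^sup>2 + h) + - b)) has_real_derivative
      (1/2) * (1 + (s - c) / sqrt ((s - c)\<^sup>2 + h))) (at s)" if "(s - c)\<^sup>2 + h > 0" for h b
  proof -
    have "((\<lambda>s. (s - c)\<^sup>2 + h) has_real_derivative 2 * (s - c)) (at s)"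
      by (auto intro!: derivative_eq_intros)
    note D = DERIV_chain'[OF this DERIV_real_sqrt[OF that]]
    have *: "x / 2 * (2 * y) = y * x" "2 * y * (x / 2) = y * x" for x y :: real by simp_all
    have "((\<lambda>s. sqrt ((s - c)\<^sup>2 + h)) has_real_derivative (s - c) / sqrt ((s - c)\<^sup>2 + h)) (at s)"
      by (rule DERIV_cong[OF D]) (simp only: * divide_inverse[of "s - c"])
    from DERIV_cmult[OF DERIV_add[OF DERIV_add[OF DERIV_ident this] DERIV_const[of "- b"]], of "1/2"]
    show ?thesis by simp
  qed
  from this[OF smooth_excess_pos] show ?thesis
    unfolding smooth_excess_def[abs_def] smooth_excess_deriv_def .
qed

lemma smooth_excess_deriv_bounds: "0 \<le> smooth_excess_deriv c n s" "smooth_excess_deriv c n s \<le> 1"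
proof -
  let ?q = "sqrt ((s - c)\<^sup>2 + (1 / Suc n)\<^sup>2)"
  have q: "?q > 0" using smooth_excess_pos[of s c n] by (simp only: real_sqrt_gt_0_iff)
  have le: "\<bar>s - c\<bar> \<le> ?q"
    by (rule real_le_rsqrt) (simp only: power2_abs le_add_same_cancel1 zero_le_power2)
  have "\<bar>a / q\<bar> \<le> 1" if "\<bar>a\<bar> \<le> q" "q > 0" for a q :: real using that by simp
  from this[OF le q] have x: "\<bar>(s - c) / ?q\<bar> \<le> 1" .
  have *: "0 \<le> (1/2) * (1 + x) \<and> (1/2) * (1 + x) \<le> 1" if "\<bar>x\<bar> \<le> 1" for x :: real
    using that by auto
  show "0 \<le> smooth_excess_deriv c n s" "smooth_excess_deriv c n s \<le> 1"
    unfolding smooth_excess_deriv_def using conjunct1[OF *[OF x]] conjunct2[OF *[OF x]] .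
qed

lemma smooth_excess_Lipschitz: "\<bar>smooth_excess c n s - smooth_excess c n t\<bar> \<le> \<bar>s - t\<bar>"
proof -
  have "\<bar>smooth_excess c n s - smooth_excess c n t\<bar> \<le> 1 * \<bar>s - t\<bar>"
  proof (rule field_differentiable_bound[where S = UNIV and f' = "smooth_excess_deriv c n", unfolded real_norm_def])
    show "(smooth_excess c n has_field_derivative smooth_excess_deriv c n z) (at z within UNIV)" for z
      using DERIV_smooth_excess by simp
    show "\<bar>smooth_excess_deriv c n z\<bar> \<le> 1" for z
      using smooth_excess_deriv_bounds[of c n z] by (simp only: abs_of_nonneg)
  qed (rule convex_UNIV UNIV_I)+
  then show ?thesis by simp
qed

text \<open>The truncation is (s - c + |s - c|) / 2. Its smooth version, with eps = 1 / (n + 1),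
  replaces |s - c| by sqrt ((s - c)^2 + eps^2) and the constant c by sqrt (c^2 + eps^2). At eps = 0
  the latter root is c because c is positive.\<close>

lemma smooth_excess_tendsto:
  assumes "c > 0"
  shows "(\<lambda>n. smooth_excess c n s) \<longlonglongrightarrow> max (s - c) 0"
proof -
  have 0: "(\<lambda>n. 1 / real (Suc n)) \<longlonglongrightarrow> 0"
    using LIMSEQ_inverse_real_of_nat by (simp add: inverse_eq_divide)
  have "(\<lambda>n. smooth_excess c n s) \<longlonglongrightarrow> (1/2) * (s + sqrt ((s - c)\<^sup>2 + 0\<^sup>2) + - sqrt (c\<^sup>2 + 0\<^sup>2))"
    unfolding smooth_excess_def by (intro tendsto_intros 0)
  also have "(1/2) * (s + sqrt ((s - c)\<^sup>2 + 0\<^sup>2) + - sqrt (c\<^sup>2 + 0\<^sup>2)) = max (s - c) 0"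
  proof -
    have 1: "sqrt ((s - c)\<^sup>2 + 0\<^sup>2) = \<bar>s - c\<bar>" by simp
    have 2: "sqrt (c\<^sup>2 + 0\<^sup>2) = c" using assms by simp
    show ?thesis unfolding 1 2 by (cases "s \<le> c") auto
  qed
  finally show ?thesis .
qed

section \<open>The Riesz vector of a linear form in coordinates\<close>

text \<open>Identifies vectors indexed by \<open>'n option\<close> with the model space along the
  basis \<open>coord_frame\<close>, so that determinants and Cramer's rule for square matrices
  apply.\<close>

definition of_coeffs :: "real ^ ('n::finite option) \<Rightarrow> real \<times> (real ^ 'n)" where
  "of_coeffs x = (x $ None, \<chi> j. x $ Some j)"

definition gram :: "(real \<times> (real ^ 'n) \<Rightarrow> real \<times> (real ^ 'n) \<Rightarrow> real) \<Rightarrow> real ^ ('n::finite option) ^ ('n option)" where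
  "gram \<beta> = (\<chi> i j. \<beta> (coord_frame i) (coord_frame j))"

lemma of_coeffs_eq_sum: "of_coeffs x = (\<Sum>i\<in>UNIV. x $ i *\<^sub>R coord_frame i)"
proof -
  have "(\<Sum>i\<in>UNIV. x $ i *\<^sub>R coord_frame i) = x $ None *\<^sub>R coord_frame None + (\<Sum>j\<in>UNIV. x $ Some j *\<^sub>R coord_frame (Some j))"
    by (simp add: UNIV_option_conv sum.reindex)
  also have "\<dots> = (x $ None, \<Sum>j\<in>UNIV. x $ Some j *\<^sub>R axis j 1)"
    by (simp add: prod_eq_iff fst_sum snd_sum)
  also have "(\<Sum>j\<in>UNIV. x $ Some j *\<^sub>R axis j 1) = (\<chi> j. x $ Some j)"
    using basis_expansion[of "\<chi> j. x $ Some j"] by (simp add: scalar_mult_eq_scaleR)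
  finally show ?thesis by (simp add: of_coeffs_def)
qed

lemma of_coeffs_surj: "\<exists>x. v = of_coeffs x"
proof
  show "v = of_coeffs (\<chi> i. case i of None \<Rightarrow> fst v | Some j \<Rightarrow> snd v $ j)"
    by (simp add: of_coeffs_def prod_eq_iff vec_eq_iff)
qed

lemma of_coeffs_eq_0: "of_coeffs x = 0 \<longleftrightarrow> x = 0"
proof
  assume "of_coeffs x = 0"
  then have x: "x $ None = 0" "x $ Some j = 0" for j by (auto simp: of_coeffs_def prod_eq_iff vec_eq_iff)
  have "x $ i = 0" for i using x by (cases i) auto
  then show "x = 0" by (simp add: vec_eq_iff)
qed (simp add: of_coeffs_def prod_eq_iff vec_eq_iff)

lemma linear_eq_on_frame:
  assumes "linear l" "linear l'" "\<And>i. l (coord_frame i) = l' (coord_frame i)"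
  shows "l v = l' v"
  using of_coeffs_surj[of v] assms
  by (auto simp: of_coeffs_eq_sum linear_sum linear_scale)

definition inner_form :: "(real \<times> (real ^ 'n::finite) \<Rightarrow> real \<times> (real ^ 'n) \<Rightarrow> real) \<Rightarrow> bool" where
  "inner_form \<beta> \<longleftrightarrow> bilinear \<beta> \<and> (\<forall>v w. \<beta> v w = \<beta> w v) \<and> (\<forall>v. v \<noteq> 0 \<longrightarrow> \<beta> v v > 0)"

lemma inner_form_linear:
  assumes "inner_form \<beta>"
  shows "linear (\<beta> v)" "linear (\<lambda>v. \<beta> v w)"
  using assms unfolding inner_form_def bilinear_def by blast+

lemma inner_form_pos: "inner_form \<beta> \<Longrightarrow> v \<noteq> 0 \<Longrightarrow> 0 < \<beta> v v"
  unfolding inner_form_def by blast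

lemma inner_form_sym: "inner_form \<beta> \<Longrightarrow> \<beta> v w = \<beta> w v"
  unfolding inner_form_def by blast

lemma inner_form_nonneg:
  assumes "inner_form \<beta>"
  shows "0 \<le> \<beta> v v"
proof (cases "v = 0")
  case True
  then show ?thesis using linear_0[OF inner_form_linear(1)[OF assms]] by simp
next
  case False
  then show ?thesis using inner_form_pos[OF assms False] by simp
qed

lemma gram_mult:
  assumes "inner_form \<beta>"
  shows "(gram \<beta> *v x) $ i = \<beta> (coord_frame i) (of_coeffs x)"
  using inner_form_linear(1)[OF assms, of "coord_frame i"]
  by (simp add: gram_def matrix_vector_mult_def of_coeffs_eq_sum linear_sum linear_scale mult.commute)

text \<open>A kernel vector is orthogonal to the whole frame, hence to itself, and vanishes by
  definiteness.\<close>

lemma det_gram_nonzero: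
  assumes "inner_form \<beta>"
  shows "det (gram \<beta>) \<noteq> 0"
proof -
  have "x = 0" if "gram \<beta> *v x = 0" for x
  proof -
    have "\<beta> (coord_frame i) (of_coeffs x) = 0" for i
      using gram_mult[OF assms, of x i] that by simp
    from linear_eq_on_frame[OF inner_form_linear(2)[OF assms] linear_zero this]
    have "\<not> 0 < \<beta> (of_coeffs x) (of_coeffs x)" by simp
    then have "of_coeffs x = 0" using inner_form_pos[OF assms] by blast
    then show ?thesis by (simp add: of_coeffs_eq_0)
  qed
  then have "invertible (gram \<beta>)"
    by (auto simp: invertible_left_inverse matrix_left_invertible_ker)
  then show ?thesis by (simp add: invertible_det_nz)
qed

text \<open>Cramer's rule for the Gram system. The explicit quotient of determinants shows that the
  gradient depends continuously on the point, which the definite description in \<open>grad\<close>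
  conceals.\<close>

definition cramer_coeffs ::
    "(real \<times> (real ^ 'n::finite) \<Rightarrow> real \<times> (real ^ 'n) \<Rightarrow> real) \<Rightarrow> (real \<times> (real ^ 'n) \<Rightarrow> real) \<Rightarrow> real ^ ('n option)" where
  "cramer_coeffs \<beta> l = (\<chi> k. det (\<chi> i j. if j = k then l (coord_frame i) else gram \<beta> $ i $ j) / det (gram \<beta>))"

lemma Riesz_vector:
  assumes \<beta>: "inner_form \<beta>" and l: "linear l"
  shows "\<beta> (of_coeffs (cramer_coeffs \<beta> l)) w = l w"
proof -
  let ?b = "(\<chi> i. l (coord_frame i)) :: real ^ ('a option)"
  have "gram \<beta> *v cramer_coeffs \<beta> l = ?b"
    using cramer[OF det_gram_nonzero[OF \<beta>], of "cramer_coeffs \<beta> l" ?b]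
    by (simp add: cramer_coeffs_def cong: if_cong)
  then have "\<beta> (coord_frame i) (of_coeffs (cramer_coeffs \<beta> l)) = l (coord_frame i)" for i
    using gram_mult[OF \<beta>, of "cramer_coeffs \<beta> l" i] by simp
  from linear_eq_on_frame[OF inner_form_linear(2)[OF \<beta>] l this]
  have "\<beta> w (of_coeffs (cramer_coeffs \<beta> l)) = l w" .
  then show ?thesis using inner_form_sym[OF \<beta>] by simp
qed

lemma Riesz_vector_unique:
  assumes \<beta>: "inner_form \<beta>" and l: "linear l" and v: "\<And>w. \<beta> v w = l w"
  shows "v = of_coeffs (cramer_coeffs \<beta> l)"
proof (rule ccontr)
  let ?r = "of_coeffs (cramer_coeffs \<beta> l)"
  assume "v \<noteq> ?r"
  then have "\<beta> (v - ?r) (v - ?r) > 0" by (intro inner_form_pos[OF \<beta>]) simp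
  moreover have "\<beta> (v - ?r) (v - ?r) = \<beta> v (v - ?r) - \<beta> ?r (v - ?r)"
    by (rule linear_diff[OF inner_form_linear(2)[OF \<beta>]])
  ultimately show False using v Riesz_vector[OF \<beta> l] by simp
qed

lemma the_Riesz_vector:
  assumes "inner_form \<beta>" "linear l"
  shows "(THE v. \<forall>w. \<beta> v w = l w) = of_coeffs (cramer_coeffs \<beta> l)"
  using Riesz_vector[OF assms] Riesz_vector_unique[OF assms] by (intro the_equality) auto

lemma continuous_on_det:
  fixes A :: "'a::topological_space \<Rightarrow> real ^ 'n::finite ^ 'n"
  assumes "\<And>i j. continuous_on S (\<lambda>z. A z $ i $ j)"
  shows "continuous_on S (\<lambda>z. det (A z))"
  unfolding det_def by (intro continuous_intros assms)

lemma continuous_on_cramer_coeffs: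
  assumes \<beta>: "\<And>z. z \<in> S \<Longrightarrow> inner_form (\<beta> z)"
    and cont: "\<And>v w. continuous_on S (\<lambda>z. \<beta> z v w)" "\<And>v. continuous_on S (\<lambda>z. l z v)"
  shows "continuous_on S (\<lambda>z. cramer_coeffs (\<beta> z) (l z) $ k)"
proof -
  have "continuous_on S (\<lambda>z. det (\<chi> i j. if j = k then l z (coord_frame i) else gram (\<beta> z) $ i $ j))"
  proof (intro continuous_on_det)
    show "continuous_on S (\<lambda>z. (\<chi> i j. if j = k then l z (coord_frame i) else gram (\<beta> z) $ i $ j) $ i $ j)" for i j
      by (cases "j = k") (simp_all add: gram_def cont)
  qed
  moreover have "continuous_on S (\<lambda>z. det (gram (\<beta> z)))"
    by (intro continuous_on_det) (simp add: gram_def cont)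
  ultimately show ?thesis
    using det_gram_nonzero[OF \<beta>] by (simp add: cramer_coeffs_def continuous_on_divide)
qed

section \<open>Charts\<close>

locale manifold =
  fixes X :: "'a topology" and \<A> :: "('a, 'n::finite) chart set"
  assumes manifold: "smooth_manifold X \<A>"
begin

abbreviation M :: "'a set" where "M \<equiv> inner_part X \<A>"

text \<open>Restricted to inner points, so that the image is open in the model space and
  \<open>Ck_on\<close> has its usual meaning there.\<close>

definition chart_image :: "('a, 'n) chart \<Rightarrow> 'n coords set" where
  "chart_image c = snd c ` (fst c \<inter> M)"

lemma Hausdorff: "Hausdorff_space X"
  and charts_cover: "(\<Union>c\<in>\<A>. fst c) = topspace X"
  and chart_open: "c \<in> \<A> \<Longrightarrow> openin X (fst c)"
  and chart_image_open: "c \<in> \<A> \<Longrightarrow> openin (top_of_set half_space) (snd c ` fst c)"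
  and chart_homeo: "c \<in> \<A> \<Longrightarrow> homeomorphic_map (subtopology X (fst c)) (top_of_set (snd c ` fst c)) (snd c)"
  and compatible: "c \<in> \<A> \<Longrightarrow> c' \<in> \<A> \<Longrightarrow> smoothly_compatible c c'"
  using manifold by (auto simp: smooth_manifold_def)

lemma chart_subset: "c \<in> \<A> \<Longrightarrow> fst c \<subseteq> topspace X"
  by (rule openin_subset[OF chart_open])

lemma M_subset: "M \<subseteq> topspace X"
  by (auto simp: inner_part_def)

lemma M_chart: "p \<in> M \<Longrightarrow> \<exists>c\<in>\<A>. p \<in> fst c"
  using M_subset charts_cover by blast

lemma topspace_chart: "c \<in> \<A> \<Longrightarrow> topspace (subtopology X (fst c)) = fst c"
  by (simp add: topspace_subtopology Int_absorb1 chart_subset)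

lemma chart_inj: "c \<in> \<A> \<Longrightarrow> inj_on (snd c) (fst c)"
  using homeomorphic_imp_injective_map[OF chart_homeo] topspace_chart by metis

lemma chart_inv_chart: "c \<in> \<A> \<Longrightarrow> p \<in> fst c \<Longrightarrow> chart_inv c (snd c p) = p"
  by (rule inv_into_f_f[OF chart_inj])

lemma chart_preimage_open:
  assumes c: "c \<in> \<A>" and Q: "open Q"
  shows "openin X {p \<in> fst c. snd c p \<in> Q}"
proof -
  have "continuous_map (subtopology X (fst c)) (top_of_set (snd c ` fst c)) (snd c)"
    by (rule homeomorphic_imp_continuous_map[OF chart_homeo[OF c]])
  moreover have "openin (top_of_set (snd c ` fst c)) (snd c ` fst c \<inter> Q)"
    using Q by (rule openin_open_Int)
  ultimately have "openin (subtopology X (fst c)) {p \<in> topspace (subtopology X (fst c)). snd c p \<in> snd c ` fst c \<inter> Q}"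
    by (rule openin_continuous_map_preimage)
  then have "openin (subtopology X (fst c)) {p \<in> fst c. snd c p \<in> Q}"
    unfolding topspace_chart[OF c] by (rule back_subst[of "openin _"]) auto
  then show ?thesis using chart_open[OF c] by (rule openin_trans_full)
qed

lemma chart_first_nonneg: "c \<in> \<A> \<Longrightarrow> p \<in> fst c \<Longrightarrow> 0 \<le> fst (snd c p)"
  using openin_subset[OF chart_image_open, of c] by (auto simp: half_space_def)

text \<open>A relatively open subset of the half-space that avoids its bounding hyperplane is open
  in the whole space.\<close>

lemma chart_image_of_open:
  assumes c: "c \<in> \<A>" and W: "openin X W" "W \<subseteq> fst c" and pos: "\<And>p. p \<in> W \<Longrightarrow> fst (snd c p) > 0"
  shows "open (snd c ` W)"
proof -
  have "openin (subtopology X (fst c)) W"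
    using W by (auto simp: openin_subtopology)
  then have "openin (top_of_set (snd c ` fst c)) (snd c ` W)"
    using homeomorphic_imp_open_map[OF chart_homeo[OF c]] by (simp add: open_map_def)
  then have "openin (top_of_set half_space) (snd c ` W)"
    using chart_image_open[OF c] by (rule openin_trans)
  then obtain U where U: "open U" "snd c ` W = half_space \<inter> U"
    by (auto simp: openin_open)
  have "snd c ` W = snd c ` W \<inter> {z. fst z > 0}" using pos by blast
  also have "\<dots> = U \<inter> {z. fst z > 0}" unfolding U(2) by (auto simp: half_space_def)
  finally have "snd c ` W = U \<inter> {z. fst z > 0}" .
  moreover have "open {z :: 'n coords. fst z > 0}"
    by (intro open_Collect_less continuous_intros)
  ultimately show ?thesis using U(1) by auto
qed

text \<open>Invariance of the boundary, by invariance of domain applied to the transition map.\<close>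

lemma inner_part_iff:
  assumes c: "c \<in> \<A>" and p: "p \<in> fst c"
  shows "p \<in> M \<longleftrightarrow> fst (snd c p) > 0"
proof
  assume "p \<in> M"
  then have "fst (snd c p) \<noteq> 0" using c p by (auto simp: inner_part_def bdry_def)
  then show "fst (snd c p) > 0" using chart_first_nonneg[OF c p] by simp
next
  assume pos: "fst (snd c p) > 0"
  show "p \<in> M"
  proof (rule ccontr)
    assume "p \<notin> M"
    then obtain c' where c': "c' \<in> \<A>" "p \<in> fst c'" "fst (snd c' p) = 0"
      using chart_subset[OF c] p by (auto simp: inner_part_def bdry_def)
    have open_pos: "open {z :: 'n coords. fst z > 0}"
      by (intro open_Collect_less continuous_intros)
    \<comment> \<open>In \<open>c\<close> the image of \<open>W\<close> is open in the full space.
      Invariance of domain makes its image in \<open>c'\<close> open as well, although it contains a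
      point of the bounding hyperplane.\<close>
    define W where "W = fst c' \<inter> {q \<in> fst c. snd c q \<in> {z. fst z > 0}}"
    have "openin X W"
      unfolding W_def by (intro openin_Int chart_open[OF c'(1)] chart_preimage_open[OF c open_pos])
    moreover have "W \<subseteq> fst c" "p \<in> W" using c'(2) p pos by (auto simp: W_def)
    ultimately have W: "openin X W" "W \<subseteq> fst c" "p \<in> W" .
    have "open (snd c ` W)" by (rule chart_image_of_open[OF c W(1,2)]) (auto simp: W_def)
    moreover have sub: "snd c ` W \<subseteq> snd c ` (fst c \<inter> fst c')" by (auto simp: W_def)
    have "continuous_on (snd c ` W) (transition c c')"
      using smooth_on_imp_continuous_on[of "snd c ` (fst c \<inter> fst c')" "transition c c'"]
        compatible[OF c c'(1)] continuous_on_subset[OF _ sub] by (simp add: smoothly_compatible_def)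
    moreover have "inj_on (transition c c') (snd c ` W)"
    proof (rule inj_onI)
      fix y z assume "y \<in> snd c ` W" "z \<in> snd c ` W" and eq: "transition c c' y = transition c c' z"
      then obtain q r where q: "q \<in> W" "y = snd c q" and r: "r \<in> W" "z = snd c r" by blast
      have "q \<in> fst c" "r \<in> fst c" using q(1) r(1) W(2) by blast+
      then have "snd c' q = snd c' r" using eq q(2) r(2) by (simp add: chart_inv_chart[OF c])
      then have "q = r" using q r chart_inj[OF c'(1)] by (auto simp: W_def inj_on_def)
      then show "y = z" using q r by simp
    qed
    ultimately have "open (transition c c' ` snd c ` W)" using invariance_of_domain by blast
    moreover have "transition c c' ` snd c ` W = snd c' ` W"
      using W(2) by (force simp: chart_inv_chart[OF c] image_image)
    ultimately have op: "open (snd c' ` W)" by simp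
    obtain e where e: "e > 0" "ball (snd c' p) e \<subseteq> snd c' ` W"
      using openE[OF op] W(3) by blast
    \<comment> \<open>A point of the ball with negative first coordinate, outside the
      half-space.\<close>
    let ?z = "snd c' p - (e / 2, 0)"
    have "dist x (x - y) = norm y" for x y :: "'n coords" by (simp add: dist_norm)
    moreover have "norm (e / 2, 0 :: real ^ 'n) = e / 2" using e(1) by (simp add: norm_Pair)
    ultimately have "dist (snd c' p) ?z = e / 2" by (simp only:)
    then have "?z \<in> ball (snd c' p) e" using e(1) by simp
    then have "?z \<in> snd c' ` W" using e(2) by blast
    then obtain q where q: "q \<in> fst c'" "?z = snd c' q" by (auto simp: W_def)
    have "0 \<le> fst ?z" unfolding q(2) by (rule chart_first_nonneg[OF c'(1) q(1)])
    then show False using c'(3) e(1) by simp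
  qed
qed

lemma M_open: "openin X M"
proof -
  have open_pos: "open {z :: 'n coords. fst z > 0}"
    by (intro open_Collect_less continuous_intros)
  have "M = (\<Union>c\<in>\<A>. {p \<in> fst c. snd c p \<in> {z. fst z > 0}})"
    using M_chart inner_part_iff by blast
  then show ?thesis using chart_preimage_open[OF _ open_pos] by auto
qed

lemma open_image_inner:
  assumes c: "c \<in> \<A>" and W: "openin X W" "W \<subseteq> fst c \<inter> M"
  shows "open (snd c ` W)"
proof (rule chart_image_of_open[OF c W(1)])
  show "W \<subseteq> fst c" using W(2) by blast
  show "fst (snd c p) > 0" if "p \<in> W" for p
    using inner_part_iff[OF c, of p] W(2) that by blast
qed

lemma open_chart_image: "c \<in> \<A> \<Longrightarrow> open (chart_image c)"
  unfolding chart_image_def by (intro open_image_inner openin_Int chart_open M_open) auto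

lemma chart_imageD:
  assumes "c \<in> \<A>" "z \<in> chart_image c"
  shows "chart_inv c z \<in> fst c" "chart_inv c z \<in> M" "snd c (chart_inv c z) = z"
  using assms by (auto simp: chart_image_def chart_inv_chart)

lemma chart_imageI: "p \<in> fst c \<Longrightarrow> p \<in> M \<Longrightarrow> snd c p \<in> chart_image c"
  by (auto simp: chart_image_def)

text \<open>Stated in charts because integrands are computed in coordinates;
  \<open>chart_continuous_preimage\<close> turns it into open preimages in \<open>X\<close>, and
  these give measurability.\<close>

definition chart_continuous :: "('a \<Rightarrow> real) \<Rightarrow> bool" where
  "chart_continuous f \<longleftrightarrow> (\<forall>c\<in>\<A>. continuous_on (chart_image c) (f \<circ> chart_inv c))"

lemma chart_continuous_preimage:
  assumes f: "chart_continuous f" and "open S"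
  shows "openin X {p \<in> M. f p \<in> S}"
proof -
  have eq: "{p \<in> M. f p \<in> S} = (\<Union>c\<in>\<A>. {p \<in> fst c. snd c p \<in> chart_image c \<inter> (f \<circ> chart_inv c) -` S})" (is "?L = ?R")
  proof
    show "?L \<subseteq> ?R"
    proof
      fix p assume p: "p \<in> ?L"
      then obtain c where c: "c \<in> \<A>" "p \<in> fst c" using M_chart by blast
      then have "p \<in> {p \<in> fst c. snd c p \<in> chart_image c \<inter> (f \<circ> chart_inv c) -` S}"
        using p by (simp add: chart_inv_chart chart_imageI)
      then show "p \<in> ?R" using c(1) by blast
    qed
    show "?R \<subseteq> ?L"
    proof
      fix p assume "p \<in> ?R"
      then obtain c where c: "c \<in> \<A>" "p \<in> fst c" "snd c p \<in> chart_image c" "f (chart_inv c (snd c p)) \<in> S"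
        by auto
      then show "p \<in> ?L" using chart_imageD(2)[OF c(1,3)] by (simp add: chart_inv_chart)
    qed
  qed
  have "open (chart_image c \<inter> (f \<circ> chart_inv c) -` S)" if "c \<in> \<A>" for c
    using f that assms(2) by (intro continuous_open_preimage open_chart_image) (auto simp: chart_continuous_def)
  then have "openin X {p \<in> fst c. snd c p \<in> chart_image c \<inter> (f \<circ> chart_inv c) -` S}" if "c \<in> \<A>" for c
    using that by (intro chart_preimage_open)
  then show ?thesis unfolding eq by (intro openin_Union) blast
qed

end

section \<open>The gradient\<close>

locale riemannian_manifold = manifold X \<A>
  for X :: "'a topology" and \<A> :: "('a, 'n::finite) chart set" +
  fixes g :: "('a, 'n) tensor2"
  assumes metric: "riemannian_metric \<A> (inner_part X \<A>) g"
begin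

lemma metric_inner_form: "c \<in> \<A> \<Longrightarrow> p \<in> fst c \<Longrightarrow> p \<in> M \<Longrightarrow> inner_form (g c p)"
  using metric unfolding riemannian_metric_def inner_form_def by blast

lemma metric_continuous:
  assumes "c \<in> \<A>"
  shows "continuous_on (chart_image c) (\<lambda>z. g c (chart_inv c z) v w)"
  using metric assms unfolding riemannian_metric_def chart_image_def
  by (intro smooth_on_imp_continuous_on) blast

lemma metric_same_tensor:
  "c \<in> \<A> \<Longrightarrow> c' \<in> \<A> \<Longrightarrow> p \<in> fst c \<Longrightarrow> p \<in> fst c' \<Longrightarrow> p \<in> M \<Longrightarrow> same_tensor_at p c (g c p) c' (g c' p)"
  using metric unfolding riemannian_metric_def by blast

definition diffable_at :: "'a \<Rightarrow> ('a \<Rightarrow> real) \<Rightarrow> bool" where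
  "diffable_at p u \<longleftrightarrow> (\<forall>c\<in>\<A>. p \<in> fst c \<longrightarrow> (u \<circ> chart_inv c) differentiable (at (snd c p)))"

definition chart_deriv :: "('a, 'n) chart \<Rightarrow> ('a \<Rightarrow> real) \<Rightarrow> 'a \<Rightarrow> 'n coords \<Rightarrow> real" where
  "chart_deriv c u p = frechet_derivative (u \<circ> chart_inv c) (at (snd c p))"

definition chart_grad_inner :: "('a, 'n) chart \<Rightarrow> ('a \<Rightarrow> real) \<Rightarrow> ('a \<Rightarrow> real) \<Rightarrow> 'a \<Rightarrow> real" where
  "chart_grad_inner c u v p = g c p (grad g c u p) (grad g c v p)"

lemma chart_deriv_works:
  assumes "diffable_at p u" "c \<in> \<A>" "p \<in> fst c"
  shows "((u \<circ> chart_inv c) has_derivative chart_deriv c u p) (at (snd c p))"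
  using assms by (simp add: diffable_at_def chart_deriv_def frechet_derivative_works[symmetric])

lemma chart_deriv_eqI:
  assumes "((u \<circ> chart_inv c) has_derivative l) (at (snd c p))"
  shows "chart_deriv c u p = l"
  using frechet_derivative_at[OF assms] by (simp add: chart_deriv_def)

lemma chart_deriv_linear:
  assumes "diffable_at p u" "c \<in> \<A>" "p \<in> fst c"
  shows "linear (chart_deriv c u p)"
  by (rule has_derivative_linear[OF chart_deriv_works[OF assms]])

lemma grad_eq:
  assumes "diffable_at p u" "c \<in> \<A>" "p \<in> fst c" "p \<in> M"
  shows "grad g c u p = of_coeffs (cramer_coeffs (g c p) (chart_deriv c u p))"
  using the_Riesz_vector[OF metric_inner_form chart_deriv_linear] assms
  by (simp add: grad_def chart_deriv_def)

lemma metric_grad: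
  assumes "diffable_at p u" "c \<in> \<A>" "p \<in> fst c" "p \<in> M"
  shows "g c p (grad g c u p) w = chart_deriv c u p w"
  unfolding grad_eq[OF assms]
  by (intro Riesz_vector metric_inner_form chart_deriv_linear assms)

text \<open>At an inner point the chart overlap is a full neighbourhood, so the derivative relative
  to the overlap is an ordinary one. It carries one inner form to the other, hence is injective and,
  the dimensions being equal, surjective.\<close>

lemma transition_derivative:
  assumes c: "c \<in> \<A>" "c' \<in> \<A>" and p: "p \<in> fst c" "p \<in> fst c'" "p \<in> M"
  obtains D where "(transition c c' has_derivative D) (at (snd c p))" "surj D"
    "\<And>v w. g c p v w = g c' p (D v) (D w)"
proof -
  define V where "V = snd c ` (fst c \<inter> fst c' \<inter> M)"
  have "open V" unfolding V_def
    by (intro open_image_inner openin_Int chart_open M_open c) auto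
  moreover have "snd c p \<in> V" using p by (auto simp: V_def)
  moreover have "V \<subseteq> snd c ` (fst c \<inter> fst c')" by (auto simp: V_def)
  moreover have "smooth_on (snd c ` (fst c \<inter> fst c')) (transition c c')"
    using compatible[OF c] by (simp add: smoothly_compatible_def)
  ultimately have "transition c c' differentiable (at (snd c p))"
    using smooth_on_imp_differentiable by blast
  then obtain D where D: "(transition c c' has_derivative D) (at (snd c p))"
    by (auto simp: differentiable_def)
  have "(transition c c' has_derivative D) (at (snd c p) within snd c ` (fst c \<inter> fst c'))"
    by (rule has_derivative_at_withinI[OF D])
  then have g: "g c p v w = g c' p (D v) (D w)" for v w
    using metric_same_tensor[OF c p] unfolding same_tensor_at_def by blast
  have lin: "linear D" by (rule has_derivative_linear[OF D])
  have "v = 0" if "D v = 0" for v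
  proof (rule ccontr)
    assume "v \<noteq> 0"
    then have "0 < g c p v v" by (rule inner_form_pos[OF metric_inner_form[OF c(1) p(1,3)]])
    also have "g c p v v = 0"
      unfolding g that by (rule linear_0[OF inner_form_linear(1)[OF metric_inner_form[OF c(2) p(2,3)]]])
    finally show False by simp
  qed
  then have "inj D" using linear_injective_0[OF lin] by blast
  then have "surj D" using linear_injective_imp_surjective[OF lin] by simp
  from that[OF D this g] show ?thesis .
qed

lemma chart_deriv_transition:
  assumes c: "c \<in> \<A>" "c' \<in> \<A>" and p: "p \<in> fst c" "p \<in> fst c'" "p \<in> M"
    and u: "diffable_at p u" and D: "(transition c c' has_derivative D) (at (snd c p))"
  shows "chart_deriv c u p = chart_deriv c' u p \<circ> D"
proof (rule chart_deriv_eqI)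
  define V where "V = snd c ` (fst c \<inter> fst c' \<inter> M)"
  have V: "open V" unfolding V_def
    by (intro open_image_inner openin_Int chart_open M_open c) auto
  have tp: "transition c c' (snd c p) = snd c' p" using chart_inv_chart[OF c(1) p(1)] by simp
  have "((u \<circ> chart_inv c') \<circ> transition c c' has_derivative chart_deriv c' u p \<circ> D) (at (snd c p))"
    by (rule diff_chain_at[OF D]) (use chart_deriv_works[OF u c(2) p(2)] in \<open>simp only: tp\<close>)
  then show "(u \<circ> chart_inv c has_derivative chart_deriv c' u p \<circ> D) (at (snd c p))"
  proof (rule has_derivative_transform_within_open[OF _ V])
    show "snd c p \<in> V" using p by (auto simp: V_def)
    fix z assume "z \<in> V"
    then obtain q where q: "q \<in> fst c" "q \<in> fst c'" "z = snd c q" by (auto simp: V_def)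
    then show "((u \<circ> chart_inv c') \<circ> transition c c') z = (u \<circ> chart_inv c) z"
      using chart_inv_chart[OF c(1) q(1)] chart_inv_chart[OF c(2) q(2)] by simp
  qed
qed

text \<open>The derivative \<open>D\<close> of the transition maps gradient to gradient: both
  represent the same differential, and surjectivity of \<open>D\<close> provides every test vector
  in the second chart.\<close>

lemma chart_grad_inner_indep:
  assumes c: "c \<in> \<A>" "c' \<in> \<A>" and p: "p \<in> fst c" "p \<in> fst c'" "p \<in> M"
    and u: "diffable_at p u" and v: "diffable_at p v"
  shows "chart_grad_inner c u v p = chart_grad_inner c' u v p"
proof -
  obtain D where D: "(transition c c' has_derivative D) (at (snd c p))" "surj D"
    "\<And>v w. g c p v w = g c' p (D v) (D w)"
    using transition_derivative[OF c p] by blast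
  have grad: "D (grad g c w p) = grad g c' w p" if w: "diffable_at p w" for w
  proof -
    note inner' = metric_inner_form[OF c(2) p(2,3)] and lin' = chart_deriv_linear[OF w c(2) p(2)]
    have "g c' p (D (grad g c w p)) x = chart_deriv c' w p x" for x
    proof -
      obtain y where y: "x = D y" using D(2) by blast
      have "g c' p (D (grad g c w p)) (D y) = chart_deriv c w p y"
        using metric_grad[OF w c(1) p(1,3)] D(3) by simp
      then show ?thesis using chart_deriv_transition[OF c p w D(1)] y by simp
    qed
    then show ?thesis
      using Riesz_vector_unique[OF inner' lin'] grad_eq[OF w c(2) p(2,3)] by metis
  qed
  show ?thesis by (simp add: chart_grad_inner_def D(3) grad u v)
qed

lemma grad_inner_eq:
  assumes "c \<in> \<A>" "p \<in> fst c" "p \<in> M" "diffable_at p u" "diffable_at p v"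
  shows "grad_inner \<A> g u v p = chart_grad_inner c u v p"
proof -
  define c' where "c' = (SOME c. c \<in> \<A> \<and> p \<in> fst c)"
  have "c' \<in> \<A> \<and> p \<in> fst c'" unfolding c'_def by (rule someI[of _ c]) (use assms in blast)
  then have "chart_grad_inner c' u v p = chart_grad_inner c u v p"
    using chart_grad_inner_indep assms by blast
  then show ?thesis by (simp add: grad_inner_def chart_grad_inner_def c'_def Let_def)
qed

text \<open>With one gradient replaced by a differential, linearity and the chain rule in
  \<open>u\<close> become those of the derivative.\<close>

lemma chart_grad_inner_eq:
  assumes "c \<in> \<A>" "p \<in> fst c" "p \<in> M" "diffable_at p u"
  shows "chart_grad_inner c u v p = chart_deriv c u p (grad g c v p)"
  unfolding chart_grad_inner_def by (rule metric_grad) (use assms in auto)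

lemma grad_inner_sym:
  assumes "p \<in> M" "diffable_at p u" "diffable_at p v"
  shows "grad_inner \<A> g u v p = grad_inner \<A> g v u p"
proof -
  obtain c where c: "c \<in> \<A>" "p \<in> fst c" using M_chart[OF assms(1)] by blast
  show ?thesis
    using grad_inner_eq[OF c assms] grad_inner_eq[OF c assms(1,3,2)]
      inner_form_sym[OF metric_inner_form[OF c assms(1)]]
    by (simp add: chart_grad_inner_def)
qed

lemma grad_inner_nonneg:
  assumes "p \<in> M" "diffable_at p u"
  shows "0 \<le> grad_inner \<A> g u u p"
proof -
  obtain c where c: "c \<in> \<A>" "p \<in> fst c" using M_chart[OF assms(1)] by blast
  show ?thesis
    using grad_inner_eq[OF c assms assms(2)] inner_form_nonneg[OF metric_inner_form[OF c assms(1)]]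
    by (simp add: chart_grad_inner_def)
qed

text \<open>The chain rule in the form needed for sums, multiples and compositions alike.\<close>

lemma grad_inner_chain:
  assumes p: "p \<in> M" and u: "diffable_at p u" and v: "diffable_at p v" and w: "diffable_at p w"
    and der: "\<And>c. c \<in> \<A> \<Longrightarrow> p \<in> fst c \<Longrightarrow> ((f \<circ> chart_inv c) has_derivative
      (\<lambda>x. r * chart_deriv c u p x + s * chart_deriv c v p x)) (at (snd c p))"
  shows "diffable_at p f"
    and "grad_inner \<A> g f w p = r * grad_inner \<A> g u w p + s * grad_inner \<A> g v w p"
proof -
  show f: "diffable_at p f" unfolding diffable_at_def using der differentiableI by blast
  obtain c where c: "c \<in> \<A>" "p \<in> fst c" using M_chart[OF p] by blast
  have "chart_deriv c f p = (\<lambda>x. r * chart_deriv c u p x + s * chart_deriv c v p x)"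
    by (rule chart_deriv_eqI[OF der[OF c]])
  then show "grad_inner \<A> g f w p = r * grad_inner \<A> g u w p + s * grad_inner \<A> g v w p"
    using grad_inner_eq[OF c p _ w] chart_grad_inner_eq[OF c p] f u v by simp
qed

lemma grad_inner_add_scale:
  assumes p: "p \<in> M" and u: "diffable_at p u" and v: "diffable_at p v" and w: "diffable_at p w"
  shows "grad_inner \<A> g (\<lambda>q. r * u q + s * v q) w p = r * grad_inner \<A> g u w p + s * grad_inner \<A> g v w p"
proof (rule grad_inner_chain(2)[OF p u v w])
  fix c assume c: "c \<in> \<A>" "p \<in> fst c"
  have "((\<lambda>z. r * (u \<circ> chart_inv c) z + s * (v \<circ> chart_inv c) z) has_derivative
      (\<lambda>x. r * chart_deriv c u p x + s * chart_deriv c v p x)) (at (snd c p))"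
    by (intro has_derivative_add has_derivative_mult_right chart_deriv_works u v c)
  then show "((\<lambda>q. r * u q + s * v q) \<circ> chart_inv c has_derivative
      (\<lambda>x. r * chart_deriv c u p x + s * chart_deriv c v p x)) (at (snd c p))"
    by (simp add: o_def)
qed

lemma grad_inner_compose:
  assumes p: "p \<in> M" and u: "diffable_at p u" and w: "diffable_at p w"
    and F: "(F has_real_derivative F') (at (u p))"
  shows "diffable_at p (\<lambda>q. F (u q))" "grad_inner \<A> g (\<lambda>q. F (u q)) w p = F' * grad_inner \<A> g u w p"
proof -
  \<comment> \<open>The summand with factor 0 brings a single derivative into the two-term shape of
    \<open>grad_inner_chain\<close>.\<close>
  have der: "((\<lambda>q. F (u q)) \<circ> chart_inv c has_derivative
      (\<lambda>x. F' * chart_deriv c u p x + 0 * chart_deriv c u p x)) (at (snd c p))"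
    if c: "c \<in> \<A>" "p \<in> fst c" for c
  proof -
    have "(F has_real_derivative F') (at ((u \<circ> chart_inv c) (snd c p)))"
      using F chart_inv_chart[OF c] by simp
    from DERIV_compose_FDERIV[OF this chart_deriv_works[OF u c]] show ?thesis
      by (simp add: o_def mult.commute)
  qed
  show "diffable_at p (\<lambda>q. F (u q))"
    by (rule grad_inner_chain(1)[OF p u u w]) (rule der)
  have "grad_inner \<A> g (\<lambda>q. F (u q)) w p = F' * grad_inner \<A> g u w p + 0 * grad_inner \<A> g u w p"
    by (rule grad_inner_chain(2)[OF p u u w]) (rule der)
  then show "grad_inner \<A> g (\<lambda>q. F (u q)) w p = F' * grad_inner \<A> g u w p" by simp
qed

definition chart_C1 :: "('a \<Rightarrow> real) \<Rightarrow> bool" where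
  "chart_C1 u \<longleftrightarrow> (\<forall>c\<in>\<A>. Ck_on 1 (u \<circ> chart_inv c) (chart_image c))"

lemma chart_C1_diffable: "chart_C1 u \<Longrightarrow> p \<in> M \<Longrightarrow> diffable_at p u"
  by (auto simp: chart_C1_def diffable_at_def chart_imageI)

text \<open>Independence of the chart replaces the chosen chart at each point by a fixed one. There
  the function is a finite sum of Cramer coefficients times partial derivatives, all continuous for
  class C^1.\<close>

lemma chart_continuous_grad_inner:
  assumes u: "chart_C1 u" and v: "chart_C1 v"
  shows "chart_continuous (grad_inner \<A> g u v)"
  unfolding chart_continuous_def
proof
  fix c assume c: "c \<in> \<A>"
  let ?p = "chart_inv c"
  have der: "continuous_on (chart_image c) (\<lambda>z. chart_deriv c w (?p z) x)" if "chart_C1 w" for w x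
  proof (rule continuous_on_eq)
    have "Ck_on 1 (w \<circ> ?p) (chart_image c)" using that c unfolding chart_C1_def by blast
    then show "continuous_on (chart_image c) (\<lambda>z. frechet_derivative (w \<circ> ?p) (at z) x)"
      by (simp del: split_paired_All)
    show "frechet_derivative (w \<circ> ?p) (at z) x = chart_deriv c w (?p z) x" if "z \<in> chart_image c" for z
      using chart_imageD(3)[OF c that] by (simp add: chart_deriv_def)
  qed
  show "continuous_on (chart_image c) (grad_inner \<A> g u v \<circ> ?p)"
  proof (rule continuous_on_eq)
    show "continuous_on (chart_image c)
      (\<lambda>z. \<Sum>i\<in>UNIV. cramer_coeffs (g c (?p z)) (chart_deriv c v (?p z)) $ i * chart_deriv c u (?p z) (coord_frame i))"
      by (intro continuous_on_sum continuous_on_mult continuous_on_cramer_coeffs der u v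
          metric_continuous[OF c] metric_inner_form[OF c] chart_imageD[OF c])
    fix z assume z: "z \<in> chart_image c"
    note p = chart_imageD(1,2)[OF c z]
    note d = chart_C1_diffable[OF u p(2)] chart_C1_diffable[OF v p(2)]
    have "grad_inner \<A> g u v (?p z) = chart_deriv c u (?p z) (grad g c v (?p z))"
      using grad_inner_eq[OF c p d] chart_grad_inner_eq[OF c p d(1)] by simp
    also have "\<dots> = (\<Sum>i\<in>UNIV. cramer_coeffs (g c (?p z)) (chart_deriv c v (?p z)) $ i * chart_deriv c u (?p z) (coord_frame i))"
      using chart_deriv_linear[OF d(1) c p(1)]
      by (simp add: grad_eq[OF d(2) c p] of_coeffs_eq_sum linear_sum linear_scale)
    finally show "(\<Sum>i\<in>UNIV. cramer_coeffs (g c (?p z)) (chart_deriv c v (?p z)) $ i * chart_deriv c u (?p z) (coord_frame i))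
        = (grad_inner \<A> g u v \<circ> ?p) z" by simp
  qed
qed

text \<open>Vanishing on a neighbourhood makes the differential zero; this gives the energy
  integrands compact support.\<close>

lemma grad_inner_zero_on_open:
  assumes W: "openin X W" "W \<subseteq> M" "p \<in> W" and u0: "\<And>q. q \<in> W \<Longrightarrow> u q = 0" and v: "diffable_at p v"
  shows "grad_inner \<A> g u v p = 0"
proof -
  have p: "p \<in> M" using W by blast
  have der: "(u \<circ> chart_inv c has_derivative (\<lambda>x. 0 * chart_deriv c v p x + 0 * chart_deriv c v p x)) (at (snd c p))"
    if c: "c \<in> \<A>" "p \<in> fst c" for c
  proof (rule has_derivative_transform_within_open)
    show "((\<lambda>_. 0) has_derivative (\<lambda>x. 0 * chart_deriv c v p x + 0 * chart_deriv c v p x)) (at (snd c p))"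
      by simp
    show "open (snd c ` (fst c \<inter> W))"
      using W by (intro open_image_inner openin_Int chart_open c) auto
    show "snd c p \<in> snd c ` (fst c \<inter> W)" using c W by blast
    show "0 = (u \<circ> chart_inv c) z" if "z \<in> snd c ` (fst c \<inter> W)" for z
      using that u0 by (auto simp: chart_inv_chart[OF c(1)])
  qed
  have "grad_inner \<A> g u v p = 0 * grad_inner \<A> g v v p + 0 * grad_inner \<A> g v v p"
    by (rule grad_inner_chain(2)[OF p v v v]) (rule der)
  then show ?thesis by simp
qed

end

section \<open>Integration\<close>

locale riemannian_measure = riemannian_manifold X \<A> g
  for X :: "'a topology" and \<A> :: "('a, 'n::finite) chart set" and g +
  fixes \<mu> :: "'a measure"
  assumes volume: "riemannian_volume X \<A> (inner_part X \<A>) g \<mu>"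
begin

lemma space_volume: "space \<mu> = M"
  and sets_volume: "sets \<mu> = sigma_sets M {W. openin (subtopology X M) W}"
  and emeasure_volume: "c \<in> \<A> \<Longrightarrow> W \<in> sets \<mu> \<Longrightarrow> W \<subseteq> fst c \<Longrightarrow>
    emeasure \<mu> W = (\<integral>\<^sup>+z\<in>snd c ` W. ennreal (vol_density (g c (chart_inv c z))) \<partial>lborel)"
  using volume by (simp_all add: riemannian_volume_def)

lemma open_in_sets:
  assumes "openin X W" "W \<subseteq> M"
  shows "W \<in> sets \<mu>"
proof -
  have "openin (subtopology X M) W" using assms by (auto simp: openin_subtopology)
  then show ?thesis unfolding sets_volume by (intro sigma_sets.Basic) simp
qed

lemma chart_continuous_measurable:
  assumes "chart_continuous f"
  shows "f \<in> borel_measurable \<mu>"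
proof (rule borel_measurableI)
  fix S :: "real set" assume "open S"
  have "f -` S \<inter> space \<mu> = {p \<in> M. f p \<in> S}" by (auto simp: space_volume)
  then show "f -` S \<inter> space \<mu> \<in> sets \<mu>"
    using chart_continuous_preimage[OF assms \<open>open S\<close>] by (auto intro: open_in_sets)
qed

text \<open>Take a coordinate ball whose closure still lies in the chart image. By compactness both
  \<open>f\<close> and the volume density are bounded on it, and its Lebesgue measure is
  finite.\<close>

lemma bounded_finite_neighbourhood:
  assumes f: "chart_continuous f" and p: "p \<in> M"
  shows "\<exists>N B. openin X N \<and> p \<in> N \<and> N \<subseteq> M \<and> emeasure \<mu> N < \<infinity> \<and> (\<forall>q\<in>N. \<bar>f q\<bar> \<le> B)"
proof -
  obtain c where c: "c \<in> \<A>" "p \<in> fst c" using M_chart[OF p] by blast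
  obtain r where r: "r > 0" "cball (snd c p) r \<subseteq> chart_image c"
    using open_contains_cball[of "chart_image c"] open_chart_image[OF c(1)] chart_imageI[OF c(2) p] by blast
  define N where "N = {q \<in> fst c. snd c q \<in> ball (snd c p) r}"
  have N: "openin X N" unfolding N_def by (rule chart_preimage_open[OF c(1) open_ball])
  have pN: "p \<in> N" using c r by (simp add: N_def)
  have sub: "snd c ` N \<subseteq> ball (snd c p) r" by (auto simp: N_def)
  have NM: "N \<subseteq> M"
  proof
    fix q assume q: "q \<in> N"
    then have "snd c q \<in> chart_image c" using r(2) by (auto simp: N_def)
    from chart_imageD(2)[OF c(1) this] show "q \<in> M"
      using chart_inv_chart[OF c(1), of q] q by (simp add: N_def)
  qed
  have bounded: "\<exists>B. \<forall>z\<in>ball (snd c p) r. \<bar>h z\<bar> \<le> B" if "continuous_on (chart_image c) h" for h :: "'n coords \<Rightarrow> real"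
  proof -
    have "compact (h ` cball (snd c p) r)"
      by (intro compact_continuous_image continuous_on_subset[OF that r(2)] compact_cball)
    then have "bounded (h ` cball (snd c p) r)" by (rule compact_imp_bounded)
    then obtain B where "\<forall>y\<in>h ` cball (snd c p) r. norm y \<le> B"
      unfolding bounded_iff by blast
    then show ?thesis by (intro exI[of _ B]) auto
  qed
  obtain B where B: "\<And>z. z \<in> ball (snd c p) r \<Longrightarrow> \<bar>(f \<circ> chart_inv c) z\<bar> \<le> B"
    using bounded[of "f \<circ> chart_inv c"] f c(1) unfolding chart_continuous_def by blast
  have "continuous_on (chart_image c) (\<lambda>z. vol_density (g c (chart_inv c z)))"
    unfolding vol_density_def
    by (intro continuous_on_real_sqrt continuous_on_det) (simp add: metric_continuous[OF c(1)])
  then obtain B' where B': "\<And>z. z \<in> ball (snd c p) r \<Longrightarrow> \<bar>vol_density (g c (chart_inv c z))\<bar> \<le> B'"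
    using bounded[of "\<lambda>z. vol_density (g c (chart_inv c z))"] by blast
  have "emeasure \<mu> N = (\<integral>\<^sup>+z\<in>snd c ` N. ennreal (vol_density (g c (chart_inv c z))) \<partial>lborel)"
    by (rule emeasure_volume[OF c(1) open_in_sets[OF N NM]]) (auto simp: N_def)
  also have "\<dots> \<le> (\<integral>\<^sup>+z\<in>ball (snd c p) r. ennreal B' \<partial>lborel)"
  proof (rule nn_integral_mono)
    fix z
    show "ennreal (vol_density (g c (chart_inv c z))) * indicator (snd c ` N) z \<le> ennreal B' * indicator (ball (snd c p) r) z"
    proof (cases "z \<in> snd c ` N")
      case True
      then have z: "z \<in> ball (snd c p) r" using sub by blast
      have "vol_density (g c (chart_inv c z)) \<le> B'" using B'[OF z] by linarith
      then show ?thesis using True z by (simp add: ennreal_leI)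
    qed simp
  qed
  also have "\<dots> = ennreal B' * emeasure lborel (ball (snd c p) r)"
    by (rule nn_integral_cmult_indicator) simp
  also have "\<dots> < \<infinity>"
    using emeasure_lborel_ball_finite[of "snd c p" r] by (simp add: ennreal_mult_less_top)
  finally have "emeasure \<mu> N < \<infinity>" .
  moreover have "\<bar>f q\<bar> \<le> B" if "q \<in> N" for q
    using B[of "snd c q"] that chart_inv_chart[OF c(1), of q] by (simp add: N_def)
  ultimately show ?thesis using N pN NM by blast
qed

text \<open>Finitely many of the preceding neighbourhoods cover \<open>K\<close>, so
  \<open>f\<close> is bounded on a set of finite measure and zero off it.\<close>

lemma integrable_if_compact_support:
  assumes f: "chart_continuous f" and K: "compactin X K" "K \<subseteq> M" and zero: "\<And>p. p \<in> M - K \<Longrightarrow> f p = 0"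
  shows "integrable \<mu> f"
proof -
  define P where "P N \<longleftrightarrow> openin X N \<and> N \<subseteq> M \<and> emeasure \<mu> N < \<infinity> \<and> (\<exists>B. \<forall>q\<in>N. \<bar>f q\<bar> \<le> B)" for N
  have "K \<subseteq> \<Union>{N. P N}"
  proof
    fix p assume "p \<in> K"
    then have "p \<in> M" using K(2) by blast
    from bounded_finite_neighbourhood[OF f this]
    obtain N where "P N" "p \<in> N" unfolding P_def by blast
    then show "p \<in> \<Union>{N. P N}" by blast
  qed
  moreover have "\<forall>N\<in>{N. P N}. openin X N" by (simp add: P_def)
  ultimately obtain \<N> where \<N>: "finite \<N>" "\<N> \<subseteq> {N. P N}" "K \<subseteq> \<Union>\<N>"
    using K(1) unfolding compactin_def by (metis (no_types, lifting))
  have sets: "N \<in> sets \<mu>" if "N \<in> \<N>" for N using \<N>(2) that by (auto simp: P_def intro: open_in_sets)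
  obtain B where B: "\<And>N q. N \<in> \<N> \<Longrightarrow> q \<in> N \<Longrightarrow> \<bar>f q\<bar> \<le> B N"
  proof -
    have "\<forall>N\<in>\<N>. \<exists>B. \<forall>q\<in>N. \<bar>f q\<bar> \<le> B" using \<N>(2) by (auto simp: P_def)
    then show ?thesis using that by metis
  qed
  show ?thesis
  proof (rule integrableI_bounded_set)
    show "\<Union>\<N> \<in> sets \<mu>" using \<N>(1) sets by (intro sets.finite_Union) auto
    show "f \<in> borel_measurable \<mu>" by (rule chart_continuous_measurable[OF f])
    have "emeasure \<mu> (\<Union>\<N>) \<le> (\<Sum>N\<in>\<N>. emeasure \<mu> N)"
      using emeasure_subadditive_finite[OF \<N>(1), of "\<lambda>N. N" \<mu>] sets by auto
    also have "\<dots> < \<infinity>" using \<N>(1,2) by (auto simp: P_def)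
    finally show "emeasure \<mu> (\<Union>\<N>) < \<infinity>" .
    show "AE p in \<mu>. p \<in> \<Union>\<N> \<longrightarrow> norm (f p) \<le> (\<Sum>N\<in>\<N>. \<bar>B N\<bar>)"
    proof (intro AE_I2 impI)
      fix p assume "p \<in> \<Union>\<N>"
      then obtain N where N: "N \<in> \<N>" "p \<in> N" by blast
      have "\<bar>f p\<bar> \<le> \<bar>B N\<bar>" using B[OF N] by simp
      also have "\<dots> \<le> (\<Sum>N\<in>\<N>. \<bar>B N\<bar>)" by (rule member_le_sum[OF N(1)]) (use \<N>(1) in auto)
      finally show "norm (f p) \<le> (\<Sum>N\<in>\<N>. \<bar>B N\<bar>)" by simp
    qed
    show "AE p in \<mu>. p \<notin> \<Union>\<N> \<longrightarrow> f p = 0"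
      using zero \<N>(3) by (intro AE_I2) (auto simp: space_volume)
  qed
qed

section \<open>The Dirichlet form is Markovian\<close>

abbreviation TF :: "('a \<Rightarrow> real) set" where "TF \<equiv> test_functions X \<A> M"

abbreviation energy :: "('a \<Rightarrow> real) \<Rightarrow> ('a \<Rightarrow> real) \<Rightarrow> real" where
  "energy \<equiv> dirichlet_form \<A> g \<mu>"

lemma test_function_iff:
  "u \<in> TF \<longleftrightarrow> (\<forall>c\<in>\<A>. \<forall>k. Ck_on k (u \<circ> chart_inv c) (chart_image c)) \<and>
    (\<exists>K. compactin X K \<and> K \<subseteq> M \<and> (\<forall>p\<in>M - K. u p = 0))"
  using smooth_on_open_iff[OF open_chart_image]
  by (auto simp: test_functions_def chart_image_def[symmetric])

lemma test_function_Ck: "u \<in> TF \<Longrightarrow> c \<in> \<A> \<Longrightarrow> Ck_on k (u \<circ> chart_inv c) (chart_image c)"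
  by (simp add: test_function_iff)

lemma test_function_C1: "u \<in> TF \<Longrightarrow> chart_C1 u"
  by (simp add: chart_C1_def test_function_Ck del: One_nat_def)

lemma test_function_diffable: "u \<in> TF \<Longrightarrow> p \<in> M \<Longrightarrow> diffable_at p u"
  by (rule chart_C1_diffable[OF test_function_C1])

lemma test_function_support:
  assumes "u \<in> TF"
  obtains K where "compactin X K" "K \<subseteq> M" "\<And>p. p \<in> M - K \<Longrightarrow> u p = 0"
  using assms unfolding test_function_iff by blast

lemma test_function_L2:
  assumes u: "u \<in> TF"
  shows "u \<in> L2 \<mu>"
proof -
  have cont: "chart_continuous u"
    unfolding chart_continuous_def using test_function_Ck[OF u, of _ 0] by simp
  then have "chart_continuous (\<lambda>p. (u p)\<^sup>2)"
    unfolding chart_continuous_def o_def by (auto intro!: continuous_on_power)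
  moreover obtain K where "compactin X K" "K \<subseteq> M" "\<And>p. p \<in> M - K \<Longrightarrow> u p = 0"
    using test_function_support[OF u] by blast
  ultimately have "integrable \<mu> (\<lambda>p. (u p)\<^sup>2)"
    by (intro integrable_if_compact_support[of _ K]) auto
  then show ?thesis using chart_continuous_measurable[OF cont] by (simp add: L2_def)
qed

lemma grad_inner_integrable:
  assumes u: "u \<in> TF" and v: "v \<in> TF"
  shows "integrable \<mu> (grad_inner \<A> g u v)"
proof -
  obtain K where K: "compactin X K" "K \<subseteq> M" "\<And>p. p \<in> M - K \<Longrightarrow> u p = 0"
    using test_function_support[OF u] by blast
  have "closedin X K" by (rule compactin_imp_closedin[OF Hausdorff K(1)])
  then have W: "openin X (M - K)" by (intro openin_diff M_open)
  show ?thesis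
  proof (rule integrable_if_compact_support[OF _ K(1,2)])
    show "chart_continuous (grad_inner \<A> g u v)"
      by (intro chart_continuous_grad_inner test_function_C1 u v)
    show "grad_inner \<A> g u v p = 0" if "p \<in> M - K" for p
      using that K(3) by (intro grad_inner_zero_on_open[OF W]) (auto intro: test_function_diffable[OF v])
  qed
qed

lemma test_function_compose:
  assumes u: "u \<in> TF" and F0: "F 0 = 0"
    and F: "\<And>c k. c \<in> \<A> \<Longrightarrow> Ck_on k (\<lambda>z. F ((u \<circ> chart_inv c) z)) (chart_image c)"
  shows "(\<lambda>p. F (u p)) \<in> TF"
proof -
  obtain K where K: "compactin X K" "K \<subseteq> M" "\<And>p. p \<in> M - K \<Longrightarrow> u p = 0"
    using test_function_support[OF u] by blast
  have eq: "(\<lambda>p. F (u p)) \<circ> chart_inv c = (\<lambda>z. F ((u \<circ> chart_inv c) z))" for c by auto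
  have "Ck_on k ((\<lambda>p. F (u p)) \<circ> chart_inv c) (chart_image c)" if "c \<in> \<A>" for c k
    unfolding eq by (rule F[OF that])
  moreover have "\<forall>p\<in>M - K. F (u p) = 0" using K(3) F0 by simp
  ultimately show ?thesis unfolding test_function_iff using K(1,2) by blast
qed

lemma test_function_scale:
  assumes u: "u \<in> TF"
  shows "(\<lambda>p. r * u p) \<in> TF"
  by (rule test_function_compose[OF u])
     (auto intro!: Ck_on_mult Ck_on_const open_chart_image test_function_Ck[OF u, unfolded o_def])

lemma test_function_add:
  assumes u: "u \<in> TF" and v: "v \<in> TF"
  shows "(\<lambda>p. u p + v p) \<in> TF"
proof -
  obtain K where K: "compactin X K" "K \<subseteq> M" "\<And>p. p \<in> M - K \<Longrightarrow> u p = 0"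
    using test_function_support[OF u] by blast
  obtain K' where K': "compactin X K'" "K' \<subseteq> M" "\<And>p. p \<in> M - K' \<Longrightarrow> v p = 0"
    using test_function_support[OF v] by blast
  have eq: "(\<lambda>p. u p + v p) \<circ> chart_inv c = (\<lambda>z. (u \<circ> chart_inv c) z + (v \<circ> chart_inv c) z)" for c by auto
  have "Ck_on k ((\<lambda>p. u p + v p) \<circ> chart_inv c) (chart_image c)" if "c \<in> \<A>" for c k
    unfolding eq by (intro Ck_on_add open_chart_image test_function_Ck u v that)
  moreover have "compactin X (K \<union> K')" by (rule compactin_Un[OF K(1) K'(1)])
  moreover have "K \<union> K' \<subseteq> M" using K(2) K'(2) by blast
  moreover have "\<forall>p\<in>M - (K \<union> K'). u p + v p = 0" using K(3) K'(3) by simp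
  ultimately show ?thesis unfolding test_function_iff by blast
qed

lemma test_function_zero: "(\<lambda>p. 0) \<in> TF"
proof -
  have "(\<lambda>p. 0) \<circ> chart_inv c = (\<lambda>z. 0 :: real)" for c :: "('a, 'n) chart" by auto
  then show ?thesis unfolding test_function_iff by (auto simp: Ck_on_const intro!: exI[of _ "{}"])
qed

lemma energy_integral_cong:
  assumes "\<And>p. p \<in> M \<Longrightarrow> grad_inner \<A> g u v p = h p"
  shows "energy u v = (LINT p|\<mu>. h p)"
  unfolding dirichlet_form_def by (rule Bochner_Integration.integral_cong) (auto simp: assms space_volume)

lemma smooth_excess_test_function:
  assumes u: "u \<in> TF"
  shows "(\<lambda>p. smooth_excess c n (u p)) \<in> TF"
  by (rule test_function_compose[where F = "smooth_excess c n", OF u smooth_excess_0])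
     (intro Ck_on_smooth_excess open_chart_image test_function_Ck u)

lemma grad_inner_smooth_excess:
  assumes u: "u \<in> TF" and v: "v \<in> TF" and p: "p \<in> M"
  shows "grad_inner \<A> g (\<lambda>q. smooth_excess c n (u q)) v p = smooth_excess_deriv c n (u p) * grad_inner \<A> g u v p"
  by (rule grad_inner_compose(2)[OF p test_function_diffable[OF u p] test_function_diffable[OF v p]
        DERIV_smooth_excess])

lemma energy_linear:
  assumes u: "u \<in> TF" and v: "v \<in> TF" and w: "w \<in> TF"
  shows "energy (\<lambda>p. r * u p + s * v p) w = r * energy u w + s * energy v w"
proof -
  have "energy (\<lambda>p. r * u p + s * v p) w
      = (LINT p|\<mu>. r * grad_inner \<A> g u w p + s * grad_inner \<A> g v w p)"
    by (rule energy_integral_cong)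
       (intro grad_inner_add_scale test_function_diffable[OF u] test_function_diffable[OF v]
         test_function_diffable[OF w])
  then show ?thesis
    using grad_inner_integrable[OF u w] grad_inner_integrable[OF v w] by (simp add: dirichlet_form_def)
qed

sublocale markov_form TF energy \<mu> smooth_excess
proof
  show "(\<lambda>p. 0) \<in> TF" by (rule test_function_zero)
  show "TF \<subseteq> L2 \<mu>" using test_function_L2 by blast
  fix u v w :: "'a \<Rightarrow> real" and r c s t :: real and n :: nat
  show "(\<lambda>p. smooth_excess c n (u p)) \<in> TF" if "u \<in> TF"
    using that by (rule smooth_excess_test_function)
  show "\<bar>smooth_excess c n s - smooth_excess c n t\<bar> \<le> \<bar>s - t\<bar>" by (rule smooth_excess_Lipschitz)
  show "smooth_excess c n 0 = 0" by (rule smooth_excess_0)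
  show "(\<lambda>n. smooth_excess c n s) \<longlonglongrightarrow> max (s - c) 0" if "c > 0"
    using that by (rule smooth_excess_tendsto)
  assume u: "u \<in> TF"
  show "(\<lambda>p. r * u p) \<in> TF" by (rule test_function_scale[OF u])
  show "0 \<le> energy u u"
    unfolding dirichlet_form_def
    using grad_inner_nonneg test_function_diffable[OF u] by (intro integral_nonneg_AE AE_I2) (auto simp: space_volume)
  let ?F = "\<lambda>p. smooth_excess c n (u p)"
  have F: "?F \<in> TF" by (rule smooth_excess_test_function[OF u])
  \<comment> \<open>The chain rule acts on the left argument, so it is applied a second time after
    exchanging the arguments; this produces the square of the derivative, which is at most
    1.\<close>
  have FF: "grad_inner \<A> g ?F ?F p = (smooth_excess_deriv c n (u p))\<^sup>2 * grad_inner \<A> g u u p" if p: "p \<in> M" for p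
    using grad_inner_smooth_excess[OF u F p] grad_inner_smooth_excess[OF u u p]
      grad_inner_sym[OF p test_function_diffable[OF u p] test_function_diffable[OF F p]]
    by (simp add: power2_eq_square)
  show "energy ?F ?F \<le> energy u u"
    unfolding dirichlet_form_def
  proof (rule integral_mono[OF grad_inner_integrable[OF F F] grad_inner_integrable[OF u u]])
    fix p assume "p \<in> space \<mu>"
    then have p: "p \<in> M" by (simp add: space_volume)
    have "(smooth_excess_deriv c n (u p))\<^sup>2 \<le> 1"
      using smooth_excess_deriv_bounds[of c n "u p"] by (simp add: power_le_one)
    then have "(smooth_excess_deriv c n (u p))\<^sup>2 * grad_inner \<A> g u u p \<le> 1 * grad_inner \<A> g u u p"
      by (intro mult_right_mono grad_inner_nonneg p test_function_diffable u)
    then show "grad_inner \<A> g ?F ?F p \<le> grad_inner \<A> g u u p" by (simp add: FF[OF p])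
  qed
  have uF: "grad_inner \<A> g u ?F p = smooth_excess_deriv c n (u p) * grad_inner \<A> g u u p" if p: "p \<in> M" for p
    using grad_inner_smooth_excess[OF u u p]
      grad_inner_sym[OF p test_function_diffable[OF u p] test_function_diffable[OF F p]]
    by simp
  show "0 \<le> energy u ?F"
    unfolding dirichlet_form_def
  proof (intro integral_nonneg_AE AE_I2)
    fix p assume "p \<in> space \<mu>"
    then have p: "p \<in> M" by (simp add: space_volume)
    show "0 \<le> grad_inner \<A> g u ?F p"
      unfolding uF[OF p] by (intro mult_nonneg_nonneg smooth_excess_deriv_bounds grad_inner_nonneg p test_function_diffable u)
  qed
  assume v: "v \<in> TF"
  show "(\<lambda>p. u p + v p) \<in> TF" by (rule test_function_add[OF u v])
  show "energy u v = energy v u"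
    unfolding dirichlet_form_def
    by (rule Bochner_Integration.integral_cong)
       (auto simp: space_volume intro!: grad_inner_sym test_function_diffable u v)
  show "energy (\<lambda>p. r * u p) v = r * energy u v"
    using energy_linear[OF u u v, of r 0] by simp
  show "energy (\<lambda>p. u p + v p) w = energy u w + energy v w" if "w \<in> TF"
    using energy_linear[OF u v that, of 1 1] by simp
qed

theorem markovian_if_generated_by_friedrichs:
  assumes "semigroup_generated_by \<mu> (friedrichs_laplacian X \<A> g \<mu>) T"
  shows "markovian \<mu> T"
proof (rule markovian_if_dissipative_above_levels)
  have gen: "generator \<mu> T = friedrichs_laplacian X \<A> g \<mu>" and C0: "C0_semigroup \<mu> T"
    using assms by (auto simp: semigroup_generated_by_def)
  show "C0_semigroup \<mu> T" by (rule C0)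
  fix c :: real and y f
  assume c: "c > 0" and yf: "(y, f) \<in> generator \<mu> T"
  show "L2_inner \<mu> f (excess c y) \<le> 0"
  proof (rule associated_operator_dissipative[OF c])
    show "f \<in> L2 \<mu>" using yf by (simp add: generator_def)
    show "(y, \<lambda>p. - f p) \<in> associated_operator \<mu> (closure_dom \<mu> TF energy) (closure_form \<mu> TF energy)"
      using yf gen by (simp add: friedrichs_laplacian_def Let_def)
  qed
qed

end

theorem proposition3p4:
  fixes X :: "'a topology"
    and \<A> :: "('a, 'n::finite) chart set"
    and gt g :: "('a, 'n) tensor2"
    and \<mu> :: "'a measure"
    and T :: "real \<Rightarrow> ('a \<Rightarrow> real) \<Rightarrow> 'a \<Rightarrow> real"
  assumes "conical_manifold X \<A> gt g"
    and "riemannian_volume X \<A> (inner_part X \<A>) g \<mu>"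
    and "semigroup_generated_by \<mu> (friedrichs_laplacian X \<A> g \<mu>) T"
  shows "markovian \<mu> T"
proof -
  interpret riemannian_measure X \<A> g \<mu>
    using assms(1,2) by unfold_locales (auto simp: conical_manifold_def)
  show ?thesis by (rule markovian_if_generated_by_friedrichs[OF assms(3)])
qed

end
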